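(* (i) The process $X$ (the cell process, see context) is a homogeneous strong Markov process on $[0,\infty)$ with paths in the Skorohod space $D([0,\infty))$ of c\`adl\`ag functions on $[0,\infty)$ and whose semigroup of transition operators is $(P_t)_{t\ge0}$. In other words, for every $x\ge0$, every $t\ge 0$, every $\mathscr F$-stopping time $\tau$ and every bounded Borel function $f:[0,\infty)\to\mathbb R$, $$\mathbb E_x[f(X_{\tau+t})\,|\,\mathscr F_\tau]\,\mathbf 1_{\tau<\infty}=P_tf(X_\tau)\,\mathbf 1_{\tau<\infty}.$$ Moreover, under the Stationarity Assumption on $R$ (see context): (ii) The probability measure $\pi$ is invariant for the Markov process $X$. (iii) For every $f\in C_c^1(0,\infty)$, $\lim_{t\to0}t^{-1}(P_tf-f)=\mathscr Lf$ in $L^1(\pi)$.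
   Context: Let $R:[0,\infty)\to[0,\infty)$ be a Borel function with $\int_0^kR(x)\,dx<\infty$ for all $k>0$. Cell process. For $z>0,t\ge0$ put $S_z(t)=\exp\left(-\int_z^{ze^t}R(u)\,du\right)$ and let $S_z^{-1}(u)=\inf\{t\ge0:S_z(t)\le u\}\in[0,\infty]$. Let $U_1,U_2,\dots$ be i.i.d. uniform on $(0,1)$. For a starting point $x>0$, set $\tau_0=0$, $Y_0=x$ and for $k\ge1$: $J_k=\sqrt{U_{2k}}$; $\tau_k=\infty$ if $\tau_{k-1}=\infty$, otherwise $\tau_k=\tau_{k-1}+S_{Y_{k-1}}^{-1}(U_{2k-1})$; $Y_k=xe^{\tau_k}\prod_{j=1}^kJ_j$ (when $\tau_k<\infty$). One assumes without loss $\prod_{k}J_k=0$ surely. Set $X_t=xe^t\prod_{j=1}^kJ_j$ if $\tau_k\le t<\tau_{k+1}$, and $X_t=0$ if $t\ge\zeta:=\lim_k\tau_k$. If the starting point is $0$, set $X_t=0$ for all $t$. $\mathbb P_x$ denotes the law under which $X$ starts at $x$, $\mathscr F=(\mathscr F_t)_{t\ge0}$ is the natural filtration of $X$, and $P_tf(x)=\mathbb E_x[f(X_t)]$ for bounded Borel $f:[0,\infty)\to\mathbb R$. Stationarity Assumption. Let $\mathcal D$ be the set of c\`adl\`ag nondecreasing functions $F:[0,\infty]\to[0,1]$ (with $F(+\infty)=\lim_{x\to\infty}F(x)$). Let $\mathfrak R$ be the set of maps $t\mapsto F_t$ from $[0,\infty)$ to $\mathcal D$, Borel measurable for the $L^1_{\mathrm{loc}}([0,\infty))$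 topology on $\mathcal D$, such that $dF_t\ll\mathrm{Leb}$, $F_t(+\infty)=1$, $F_t(0)=0$ for all $t\ge 0$, $\{F_t\}_{t\ge0}$ is tight, and for all $t\ge0,x>0$ $$F_t(x)=F_0(e^{-t}x)+\int_0^t(e^{s-t}x)^2\left[\int_{e^{s-t}x}^\infty\frac{R(z)}{z}\,dF_s(z)\right]ds .$$ It is assumed that there is a distribution function $F$ such that the constant family $F_t=F$ belongs to $\mathfrak R$; $\pi=dF$ is the corresponding probability measure on $(0,\infty)$. The operator $\mathscr L:C_c^1(0,\infty)\to L^1(\pi)$ is $$\mathscr Lf(x)=xf'(x)+xR(x)\left[\int_0^x\frac{2u}{x^2}f(u)\,du-f(x)\right].$$ Functions in $C_c^1(0,\infty)$ are extended by $0$ at $0$. *)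

theory Defs
  imports "HOL-Probability.Probability"
begin

section \<open>Functions on the half-line\<close>

text \<open>
  A function on \<open>[0,\<infinity>)\<close> is a function on the reals of which only the values on \<open>{0..}\<close> matter.
\<close>

definition bounded_borel_half_line :: "(real \<Rightarrow> real) \<Rightarrow> bool" where
  "bounded_borel_half_line f \<longleftrightarrow>
     f \<in> borel_measurable (restrict_space borel {0..}) \<and> bounded (f ` {0..})"

definition cadlag_on :: "'a::linorder_topology set \<Rightarrow> ('a \<Rightarrow> 'b::topological_space) \<Rightarrow> bool" where
  "cadlag_on A f \<longleftrightarrow> (\<forall>t\<in>A.
     (f \<longlongrightarrow> f t) (at t within (A \<inter> {t<..})) \<and>
     (\<exists>l. (f \<longlongrightarrow> l) (at t within (A \<inter> {..<t}))))"

definition admissible_rate :: "(real \<Rightarrow> real) \<Rightarrow> bool" where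
  "admissible_rate R \<longleftrightarrow>
     R \<in> borel_measurable (restrict_space borel {0..}) \<and>
     (\<forall>x\<ge>0. 0 \<le> R x) \<and>
     (\<forall>k>0. (\<integral>\<^sup>+x\<in>{0..k}. ennreal (R x) \<partial>lborel) < \<infinity>)"


section \<open>The cell process\<close>

definition survival :: "(real \<Rightarrow> real) \<Rightarrow> real \<Rightarrow> real \<Rightarrow> real" where
  "survival R z t = exp (- (LBINT u:{z..z * exp t}. R u))"

text \<open>The infimum of the empty set is \<open>\<infinity>\<close>.\<close>

definition survival_inv :: "(real \<Rightarrow> real) \<Rightarrow> real \<Rightarrow> real \<Rightarrow> ennreal" where
  "survival_inv R z u = Inf {ennreal t | t. 0 \<le> t \<and> survival R z t \<le> u}"

text \<open>
  In what follows \<open>u\<close> is one realisation \<open>u 1, u 2, \<dots>\<close> of the uniform variables (\<open>u 0\<close> is not used)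
  and \<open>x\<close> is the starting point.
\<close>

definition jump_factor :: "(nat \<Rightarrow> real) \<Rightarrow> nat \<Rightarrow> real" where
  "jump_factor u k = sqrt (u (2 * k))"

definition jump_prod :: "(nat \<Rightarrow> real) \<Rightarrow> nat \<Rightarrow> real" where
  "jump_prod u k = (\<Prod>j=1..k. jump_factor u j)"

text \<open>
  The post-jump value \<open>Y\<^sub>k = x e^\<tau>\<^sub>k J\<^sub>1 \<dots> J\<^sub>k\<close> is a function of \<open>\<tau>\<^sub>k\<close>, so it is substituted into the
  recursion for the jump times.
\<close>

primrec jump_time :: "(real \<Rightarrow> real) \<Rightarrow> (nat \<Rightarrow> real) \<Rightarrow> real \<Rightarrow> nat \<Rightarrow> ennreal" where
  "jump_time R u x 0 = 0"
| "jump_time R u x (Suc k) =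
     (if jump_time R u x k = \<infinity> then \<infinity>
      else jump_time R u x k +
        survival_inv R (x * exp (enn2real (jump_time R u x k)) * jump_prod u k) (u (2 * k + 1)))"

definition lifetime :: "(real \<Rightarrow> real) \<Rightarrow> (nat \<Rightarrow> real) \<Rightarrow> real \<Rightarrow> ennreal" where
  "lifetime R u x = lim (jump_time R u x)"

text \<open>
  For \<open>x > 0\<close> and \<open>t < \<zeta>\<close> the index selected below exists and is unique, because the jump times
  are nondecreasing and start at \<open>0\<close>.
\<close>

definition cell_path :: "(real \<Rightarrow> real) \<Rightarrow> (nat \<Rightarrow> real) \<Rightarrow> real \<Rightarrow> real \<Rightarrow> real" where
  "cell_path R u x t =
     (if 0 < x \<and> ennreal t < lifetime R u x
      then x * exp t * jump_prod u
             (THE k. jump_time R u x k \<le> ennreal t \<and> ennreal t < jump_time R u x (Suc k))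
      else 0)"

definition cell_process ::
  "(real \<Rightarrow> real) \<Rightarrow> (nat \<Rightarrow> 'w \<Rightarrow> real) \<Rightarrow> real \<Rightarrow> real \<Rightarrow> 'w \<Rightarrow> real" where
  "cell_process R U x t \<omega> = cell_path R (\<lambda>i. U i \<omega>) x t"

definition driving_sequence :: "'w measure \<Rightarrow> (nat \<Rightarrow> 'w \<Rightarrow> real) \<Rightarrow> bool" where
  "driving_sequence M U \<longleftrightarrow>
     prob_space.indep_vars M (\<lambda>_. borel) U {1..} \<and>
     (\<forall>i\<ge>1. distr M borel (U i) = uniform_measure lborel {0<..<1}) \<and>
     (\<forall>i\<ge>1. \<forall>\<omega>\<in>space M. U i \<omega> \<in> {0<..<1}) \<and>
     (\<forall>\<omega>\<in>space M. jump_prod (\<lambda>i. U i \<omega>) \<longlonglongrightarrow> 0)"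


section \<open>Strong Markov processes on the half-line\<close>

text \<open>
  \<open>X x t\<close> is the state at time \<open>t \<ge> 0\<close> of the process started at \<open>x \<ge> 0\<close>. The laws \<open>\<P>\<^sub>x\<close> are all realised
  on one probability space \<open>M\<close>: an expectation under \<open>\<P>\<^sub>x\<close> of a functional of the process is the
  expectation under \<open>M\<close> of that functional of \<open>X x\<close>.
\<close>

definition transition_op ::
  "'w measure \<Rightarrow> (real \<Rightarrow> real \<Rightarrow> 'w \<Rightarrow> real) \<Rightarrow> real \<Rightarrow> (real \<Rightarrow> real) \<Rightarrow> real \<Rightarrow> real" where
  "transition_op M X t f x = (\<integral>\<omega>. f (X x t \<omega>) \<partial>M)"

text \<open>
  The filtration is indexed by \<open>[0,\<infinity>]\<close>, the value at \<open>\<infinity>\<close> being generated by the whole process, so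
  that the library's stopping times may take the value \<open>\<infinity>\<close>. Its \<open>pre_sigma \<tau>\<close> then consists of
  the events \<open>A\<close> in the \<sigma>-algebra at \<open>\<infinity>\<close> with \<open>A \<inter> {\<tau> \<le> t}\<close> in the \<sigma>-algebra at \<open>t\<close> for all finite \<open>t\<close>.
\<close>

definition natural_filtration :: "'w measure \<Rightarrow> (real \<Rightarrow> 'w \<Rightarrow> real) \<Rightarrow> ennreal \<Rightarrow> 'w measure" where
  "natural_filtration M Z t = sigma (space M)
     {Z s -` B \<inter> space M | s B. 0 \<le> s \<and> ennreal s \<le> t \<and> B \<in> sets borel}"

lemma filtration_natural_filtration: "filtration (space M) (natural_filtration M Z)"
proof
  show "space (natural_filtration M Z t) = space M" for t
    unfolding natural_filtration_def by (rule space_measure_of) auto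
  show "sets (natural_filtration M Z s) \<subseteq> sets (natural_filtration M Z t)" if "s \<le> t" for s t
  proof -
    have "{Z r -` B \<inter> space M | r B. 0 \<le> r \<and> ennreal r \<le> s \<and> B \<in> sets borel} \<subseteq>
        {Z r -` B \<inter> space M | r B. 0 \<le> r \<and> ennreal r \<le> t \<and> B \<in> sets borel}"
      using that by (blast intro: order_trans)
    then show ?thesis
      unfolding natural_filtration_def
      by (subst (1 2) sets_measure_of) (auto dest: sigma_sets_mono')
  qed
qed

abbreviation stopped_sigma ::
  "'w measure \<Rightarrow> (real \<Rightarrow> 'w \<Rightarrow> real) \<Rightarrow> ('w \<Rightarrow> ennreal) \<Rightarrow> 'w measure" where
  "stopped_sigma M Z \<tau> \<equiv> filtration.pre_sigma (space M) (natural_filtration M Z) \<tau>"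

definition transition_semigroup :: "(real \<Rightarrow> (real \<Rightarrow> real) \<Rightarrow> real \<Rightarrow> real) \<Rightarrow> bool" where
  "transition_semigroup P \<longleftrightarrow> (\<forall>f. bounded_borel_half_line f \<longrightarrow>
     (\<forall>t\<ge>0. bounded_borel_half_line (P t f)) \<and>
     (\<forall>x\<ge>0. P 0 f x = f x) \<and>
     (\<forall>s\<ge>0. \<forall>t\<ge>0. \<forall>x\<ge>0. P (s + t) f x = P s (P t f) x))"

text \<open>
  The variable \<open>f (X\<^bsub>\<tau>+t\<^esub>)\<close> is only meaningful on \<open>{\<tau> < \<infinity>}\<close>; it is set to \<open>0\<close> elsewhere, which does
  not affect the conditional expectation on \<open>{\<tau> < \<infinity>}\<close>.
\<close>

definition strong_Markov_process ::
  "'w measure \<Rightarrow> (real \<Rightarrow> real \<Rightarrow> 'w \<Rightarrow> real) \<Rightarrow> (real \<Rightarrow> (real \<Rightarrow> real) \<Rightarrow> real \<Rightarrow> real) \<Rightarrow> bool" where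
  "strong_Markov_process M X P \<longleftrightarrow>
     transition_semigroup P \<and>
     (\<forall>x\<ge>0. \<forall>t\<ge>0. X x t \<in> borel_measurable M) \<and>
     (\<forall>x\<ge>0. \<forall>\<omega>\<in>space M. X x 0 \<omega> = x) \<and>
     (\<forall>x\<ge>0. \<forall>\<omega>\<in>space M. (\<forall>t\<ge>0. 0 \<le> X x t \<omega>) \<and> cadlag_on {0..} (\<lambda>t. X x t \<omega>)) \<and>
     (\<forall>x\<ge>0. \<forall>t\<ge>0. \<forall>\<tau> f.
        stopping_time (natural_filtration M (X x)) \<tau> \<longrightarrow> bounded_borel_half_line f \<longrightarrow>
        (AE \<omega> in M.
           real_cond_exp M (stopped_sigma M (X x) \<tau>)
             (\<lambda>\<omega>'. if \<tau> \<omega>' < \<infinity> then f (X x (enn2real (\<tau> \<omega>') + t) \<omega>') else 0) \<omega>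
             * indicator {\<omega>'. \<tau> \<omega>' < \<infinity>} \<omega>
           = P t f (X x (enn2real (\<tau> \<omega>)) \<omega>) * indicator {\<omega>'. \<tau> \<omega>' < \<infinity>} \<omega>))"


section \<open>The Stationarity Assumption\<close>

definition distr_functions :: "(ennreal \<Rightarrow> real) set" where
  "distr_functions = {F. mono F \<and> range F \<subseteq> {0..1} \<and> cadlag_on UNIV F \<and>
     (F \<longlongrightarrow> F \<infinity>) (at_left \<infinity>)}"

text \<open>
  The topology of \<open>L\<^sup>1\<^sub>l\<^sub>o\<^sub>c([0,\<infinity>))\<close> is given by the seminorms \<open>\<integral>\<^bsub>[0,n]\<^esub> \<bar>\<cdot>\<bar> dLeb\<close>, which increase in \<open>n\<close>.
\<close>

definition L1loc_open :: "(ennreal \<Rightarrow> real) set \<Rightarrow> bool" where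
  "L1loc_open W \<longleftrightarrow> W \<subseteq> distr_functions \<and>
     (\<forall>F\<in>W. \<exists>n::nat. \<exists>\<epsilon>>0. \<forall>G\<in>distr_functions.
        (\<integral>\<^sup>+y\<in>{0..real n}. ennreal \<bar>G (ennreal y) - F (ennreal y)\<bar> \<partial>lborel) < ennreal \<epsilon> \<longrightarrow> G \<in> W)"

definition L1loc_borel :: "(ennreal \<Rightarrow> real) measure" where
  "L1loc_borel = sigma distr_functions {W. L1loc_open W}"

text \<open>
  The Lebesgue--Stieltjes measure \<open>dF\<close> as a measure on the reals, with \<open>F = 0\<close> on the negative
  half-line, so that \<open>dF {0} = F 0\<close>.
\<close>

definition stieltjes :: "(ennreal \<Rightarrow> real) \<Rightarrow> real measure" where
  "stieltjes F = interval_measure (\<lambda>x. if 0 \<le> x then F (ennreal x) else 0)"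

definition tight_family :: "(real \<Rightarrow> ennreal \<Rightarrow> real) \<Rightarrow> bool" where
  "tight_family F \<longleftrightarrow>
     (\<forall>\<epsilon>>0. \<exists>k::real. \<forall>t\<ge>0. measure (stieltjes (F t)) {0..k} \<ge> 1 - \<epsilon>)"

text \<open>
  All terms of the evolution equation are nonnegative, so it is stated in \<open>[0,\<infinity>]\<close>; in particular
  it forces the double integral to be finite.
\<close>

definition solutions :: "(real \<Rightarrow> real) \<Rightarrow> (real \<Rightarrow> ennreal \<Rightarrow> real) set" where
  "solutions R = {F.
     F \<in> measurable (restrict_space borel {0..}) L1loc_borel \<and>
     (\<forall>t\<ge>0. absolutely_continuous lborel (stieltjes (F t)) \<and> F t \<infinity> = 1 \<and> F t 0 = 0) \<and>
     tight_family F \<and>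
     (\<forall>t\<ge>0. \<forall>x>0.
        ennreal (F t (ennreal x)) =
          ennreal (F 0 (ennreal (exp (- t) * x))) +
          (\<integral>\<^sup>+s\<in>{0..t}. ennreal ((exp (s - t) * x)\<^sup>2) *
             (\<integral>\<^sup>+z\<in>{exp (s - t) * x..}. ennreal (R z / z) \<partial>stieltjes (F s)) \<partial>lborel))}"

definition stationary_distr :: "(real \<Rightarrow> real) \<Rightarrow> (ennreal \<Rightarrow> real) \<Rightarrow> bool" where
  "stationary_distr R F \<longleftrightarrow> (\<lambda>t. F) \<in> solutions R"

text \<open>The measure \<open>\<pi> = dF\<close> on \<open>(0,\<infinity>)\<close>.\<close>

definition stationary_measure :: "(ennreal \<Rightarrow> real) \<Rightarrow> real measure" where
  "stationary_measure F = restrict_space (stieltjes F) {0<..}"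

definition invariant_prob ::
  "(real \<Rightarrow> (real \<Rightarrow> real) \<Rightarrow> real \<Rightarrow> real) \<Rightarrow> real measure \<Rightarrow> bool" where
  "invariant_prob P \<mu> \<longleftrightarrow> prob_space \<mu> \<and>
     (\<forall>t\<ge>0. \<forall>f. bounded_borel_half_line f \<longrightarrow> (\<integral>x. P t f x \<partial>\<mu>) = (\<integral>x. f x \<partial>\<mu>))"


section \<open>The generator\<close>

text \<open>Functions in \<open>C\<^sub>c\<^sup>1(0,\<infinity>)\<close>, extended by \<open>0\<close> outside \<open>(0,\<infinity>)\<close>.\<close>

definition C1c_pos :: "(real \<Rightarrow> real) \<Rightarrow> bool" where
  "C1c_pos f \<longleftrightarrow> f C1_differentiable_on {0<..} \<and>
     (\<exists>K. compact K \<and> K \<subseteq> {0<..} \<and> (\<forall>x. x \<notin> K \<longrightarrow> f x = 0))"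

definition generator :: "(real \<Rightarrow> real) \<Rightarrow> (real \<Rightarrow> real) \<Rightarrow> real \<Rightarrow> real" where
  "generator R f x =
     x * deriv f x + x * R x * ((LBINT u:{0..x}. 2 * u / x\<^sup>2 * f u) - f x)"

definition tendsto_L1 ::
  "'a measure \<Rightarrow> ('i \<Rightarrow> 'a \<Rightarrow> real) \<Rightarrow> ('a \<Rightarrow> real) \<Rightarrow> 'i filter \<Rightarrow> bool" where
  "tendsto_L1 \<mu> g h A \<longleftrightarrow>
     (\<forall>\<^sub>F i in A. integrable \<mu> (g i)) \<and> integrable \<mu> h \<and>
     ((\<lambda>i. \<integral>x. \<bar>g i x - h x\<bar> \<partial>\<mu>) \<longlongrightarrow> 0) A"

end

theory Submission
  imports Defs
begin

text \<open>
  Up to a given time, split according to the number of jumps. The first jump time has density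
  \<open>k (x e\<^sup>s) S\<^sub>x(s)\<close> with \<open>k(x) = x R(x)\<close>, and after it the path is the path driven by the shifted
  uniform sequence; before it, dividing the first uniform variable by \<open>S\<^sub>x(s)\<close> restarts the process
  at \<open>x e\<^sup>s\<close>. Induction on the number of jumps gives the Markov property at fixed times. It extends to
  stopping times by dyadic approximation from above: right continuity of \<open>h \<mapsto> P\<^sub>t f(y e\<^sup>h)\<close> is enough,
  and this follows from \<open>\<E>\<^sub>y f(X\<^sub>t\<^sub>+\<^sub>h) = P\<^sub>t f(y e\<^sup>h) + O(1 - S\<^sub>y(h))\<close>.

  With \<open>H(x) = \<integral>\<^sub>0\<^sup>x R\<close>, the stationarity equation forces \<open>\<pi>(dx) = c x e\<^sup>-\<^sup>H\<^sup>(\<^sup>x\<^sup>) dx\<close> and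
  \<open>\<integral>\<^sub>v\<^sup>\<infinity> R e\<^sup>-\<^sup>H = e\<^sup>-\<^sup>H\<^sup>(\<^sup>v\<^sup>)\<close>. The flow between jumps, \<open>T\<^sub>s g(x) = S\<^sub>x(s) g(x e\<^sup>s)\<close>, then satisfies
  \<open>\<integral> T\<^sub>s g d\<pi> = e\<^sup>-\<^sup>2\<^sup>s \<integral> g d\<pi>\<close>, and the jump operator \<open>Q h(z) = k(z) \<integral>\<^sub>0\<^sup>1 2 u h(z u) du\<close> satisfies
  \<open>\<integral> Q h d\<pi> = 2 \<integral> h d\<pi>\<close>. Hence under \<open>\<pi>\<close> the number of jumps up to time \<open>t\<close> is Poisson with mean
  \<open>2t\<close> and the contribution of \<open>n\<close> jumps to \<open>\<integral> P\<^sub>t f d\<pi>\<close> is the Poisson weight times \<open>\<integral> f d\<pi>\<close>. Summing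
  over \<open>n\<close> yields invariance, and in particular shows that there is no explosion. For the generator only
  zero and one jump matter, two or more having probability \<open>O(t\<^sup>2)\<close>; the limit of the one-jump term
  is the strong continuity of \<open>T\<^sub>s\<close> in \<open>L\<^sup>1(\<pi>)\<close>.
\<close>

section \<open>The integrated rate\<close>

text \<open>Two obstacles shape the proof. First, \<open>R\<close> is only locally integrable:
  \<open>H\<close> is continuous but may fail to be differentiable at a given point, and
  \<open>x R(x)\<close> may be unbounded. Differentiation is therefore replaced by image measures,
  substitution and Fubini on nonnegative integrands, and the limits of the jump terms are taken in
  L1(\<pi>). Second, explosion is not excluded from a given starting point. Absorption at 0 after
  \<zeta> is part of every path argument, and only integration against \<pi> shows that it carries
  no mass there.

  The number 2 has two origins that must match: \<pi> has the weight x, and x dx scales by e^(2s)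
  under growth, while the jump ratio sqrt(U) has density 2u on [0,1]. This balance is what makes the
  number of jumps a Poisson clock under \<pi>.

  Expectations are computed on the canonical space \<open>Om\<close> of uniform sequences and
  carried over to \<open>M\<close> by the law of the driving sequence. The rate is taken to be Borel
  and nonnegative on the whole line; the last section reduces a rate on the half-line to its
  extension by 0.\<close>

locale rate =
  fixes R :: "real \<Rightarrow> real"
  assumes R_measurable [measurable]: "R \<in> borel_measurable borel"
    and R_nonneg: "\<And>x. 0 \<le> R x"
    and R_integrable: "\<And>k. set_integrable lborel {0..k} R"
begin

definition H :: "real \<Rightarrow> real" where "H y = (LBINT u:{0..y}. R u)"

lemma R_integrable_Icc: "0 \<le> a \<Longrightarrow> set_integrable lborel {a..b} R"
  by (rule set_integrable_subset[OF R_integrable[of b]]) auto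

lemma H_eq_integral: "H y = integral {0..y} R"
  using set_borel_integral_eq_integral[OF R_integrable[of y]] by (auto simp: H_def)

lemma R_integrable_on: "R integrable_on {0..y}"
  using set_borel_integral_eq_integral[OF R_integrable[of y]] by auto

lemma H_nonpos: "y \<le> 0 \<Longrightarrow> H y = 0"
  by (cases "y = 0") (auto simp: H_eq_integral)

lemma H_diff: "0 \<le> a \<Longrightarrow> a \<le> b \<Longrightarrow> (LBINT u:{a..b}. R u) = H b - H a"
  using Henstock_Kurzweil_Integration.integral_combine[of 0 a b R] R_integrable_on[of b]
    set_borel_integral_eq_integral[OF R_integrable_Icc[of a b]]
  by (simp add: H_eq_integral)

lemma nn_R_Icc: "0 \<le> a \<Longrightarrow> a \<le> b \<Longrightarrow> (\<integral>\<^sup>+u\<in>{a..b}. ennreal (R u) \<partial>lborel) = ennreal (H b - H a)"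
proof -
  assume ab: "0 \<le> a" "a \<le> b"
  have "(\<integral>\<^sup>+u\<in>{a..b}. ennreal (R u) \<partial>lborel) = (\<integral>\<^sup>+u. ennreal (indicator {a..b} u *\<^sub>R R u) \<partial>lborel)"
    by (intro nn_integral_cong) (auto simp: indicator_def)
  also have "\<dots> = ennreal (LBINT u:{a..b}. R u)"
    unfolding set_lebesgue_integral_def
    using R_integrable_Icc[OF ab(1), of b]
    by (intro nn_integral_eq_integral) (auto simp: R_nonneg set_integrable_def)
  finally show ?thesis using ab by (simp add: H_diff)
qed

lemma nn_R_Ioc:
  assumes "0 \<le> a" "a \<le> b"
  shows "(\<integral>\<^sup>+u\<in>{a<..b}. ennreal (R u) \<partial>lborel) = ennreal (H b - H a)"
proof -
  have "indicator {a<..b} u = (indicator {a..b} u :: ennreal)" if "u \<noteq> a" for u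
    using that by (auto simp: indicator_def)
  then have "(\<integral>\<^sup>+u\<in>{a<..b}. ennreal (R u) \<partial>lborel) = (\<integral>\<^sup>+u\<in>{a..b}. ennreal (R u) \<partial>lborel)"
    by (intro nn_integral_cong_AE, use AE_lborel_singleton[of a] in eventually_elim) simp
  then show ?thesis using nn_R_Icc[OF assms] by simp
qed

lemma H_mono: "a \<le> b \<Longrightarrow> H a \<le> H b"
  unfolding H_eq_integral
  by (rule integral_subset_le) (auto simp: R_nonneg R_integrable_on)

lemma H_continuous: "continuous_on UNIV H"
proof -
  have c: "continuous_on {0..k} H" for k
    using indefinite_integral_continuous_1[OF R_integrable_on[of k]]
    by (simp add: H_eq_integral cong: continuous_on_cong)
  have "continuous (at x) H" for x
  proof -
    \<comment> \<open>\<open>H\<close> vanishes to the left of 0; the pieces on both sides of 0 are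
      glued there.\<close>
    have "continuous_on {-(\<bar>x\<bar>+1)..0} H"
      by (subst continuous_on_cong[OF refl, of _ _ "\<lambda>_. 0"]) (auto simp: H_nonpos)
    then have "continuous_on ({-(\<bar>x\<bar>+1)..0} \<union> {0..\<bar>x\<bar>+1}) H"
      by (intro continuous_on_closed_Un c) auto
    moreover have "{-(\<bar>x\<bar>+1)..0} \<union> {0..\<bar>x\<bar>+1} = {-(\<bar>x\<bar>+1)..\<bar>x\<bar>+1}" by auto
    ultimately have "continuous_on {-(\<bar>x\<bar>+1)..\<bar>x\<bar>+1} H" by simp
    then show ?thesis
      by (rule continuous_on_interior) (simp, linarith)
  qed
  then show ?thesis by (simp add: continuous_on_eq_continuous_at)
qed

lemma H_measurable [measurable]: "H \<in> borel_measurable borel"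
  by (rule borel_measurable_continuous_onI[OF H_continuous])

lemma H_isCont: "isCont H x"
  using H_continuous by (simp add: continuous_on_eq_continuous_at)

lemma H_tendsto: "(f \<longlongrightarrow> l) F \<Longrightarrow> ((\<lambda>x. H (f x)) \<longlongrightarrow> H l) F"
  by (rule isCont_tendsto_compose[OF H_isCont])

text \<open>This replaces the chain rule for the absolutely continuous function \<open>H\<close>.\<close>

lemma nn_integral_H_image:
  assumes ab: "0 \<le> a" "a \<le> b" and f [measurable]: "f \<in> borel_measurable borel"
  shows "(\<integral>\<^sup>+z\<in>{a..b}. ennreal (R z) * f (H z) \<partial>lborel) = (\<integral>\<^sup>+v\<in>{H a..H b}. f v \<partial>lborel)"
proof -
  \<comment> \<open>It suffices that the image under \<open>H\<close> of the measure
    \<open>R z dz\<close> on [a, b] is Lebesgue measure on [H a, H b]. Both measures are compared on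
    the rays {c<..}.\<close>
  let ?D = "density lborel (\<lambda>z. ennreal (R z) * indicator {a..b} z)"
  let ?M = "distr ?D borel H" and ?N = "density lborel (indicator {H a..H b})"
  have emM: "emeasure ?M {c<..} = (\<integral>\<^sup>+z. ennreal (R z) * indicator {z\<in>{a..b}. c < H z} z \<partial>lborel)" for c
  proof -
    have [measurable]: "H -` {c<..} \<in> sets borel"
      using measurable_sets[OF H_measurable, of "{c<..}"] by simp
    show ?thesis
      by (subst emeasure_distr, simp, simp, subst emeasure_density)
         (auto intro!: nn_integral_cong simp: indicator_def)
  qed
  have emN: "emeasure ?N {c<..} = emeasure lborel ({H a..H b} \<inter> {c<..})" for c
    by (subst emeasure_density) (auto simp: indicator_inter_arith[symmetric])
  have Hab: "H a \<le> H b" using H_mono ab by auto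
  have "?M = ?N"
  proof (rule measure_eqI_lessThan)
    fix c
    have "emeasure ?M {c<..} \<le> (\<integral>\<^sup>+z\<in>{a..b}. ennreal (R z) \<partial>lborel)"
      unfolding emM by (intro nn_integral_mono) (auto simp: indicator_def)
    then show "emeasure ?M {c<..} < \<infinity>"
      using ab by (simp add: nn_R_Icc order_le_less_trans)
    consider "H b \<le> c" | "c < H a" | "H a \<le> c" "c < H b" by linarith
    then show "emeasure ?M {c<..} = emeasure ?N {c<..}"
    proof cases
      case 1
      then have "{H a..H b} \<inter> {c<..} = {}" by auto
      moreover have "{z\<in>{a..b}. c < H z} = {}" using 1 H_mono by fastforce
      ultimately show ?thesis by (simp add: emM emN del: Int_atLeastAtMostR1)
    next
      case 2
      then have "{H a..H b} \<inter> {c<..} = {H a..H b}" by auto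
      moreover have "{z\<in>{a..b}. c < H z} = {a..b}" using 2 H_mono by fastforce
      ultimately show ?thesis using ab Hab by (simp add: emM emN nn_R_Icc)
    next
      case 3
      \<comment> \<open>\<open>H\<close> may be flat at the level \<open>c\<close>, so the set where
        \<open>H\<close> exceeds \<open>c\<close> begins at the last point at which the value
        \<open>c\<close> is taken.\<close>
      define K where "K = {z\<in>{a..b}. H z = c}"
      have "compact K"
      proof -
        have "closed {z. H z = c}"
          using H_continuous by (intro closed_Collect_eq) auto
        moreover have "K = {a..b} \<inter> {z. H z = c}" by (auto simp: K_def)
        ultimately show ?thesis by (auto intro: compact_Int_closed)
      qed
      moreover have "\<exists>z\<ge>a. z \<le> b \<and> H z = c"
        using 3 ab by (intro IVT') (auto intro: continuous_on_subset[OF H_continuous])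
      then have "K \<noteq> {}" by (auto simp: K_def)
      ultimately obtain z1 where z1: "z1 \<in> K" "\<And>z. z \<in> K \<Longrightarrow> z \<le> z1"
        using compact_attains_sup[of K] by metis
      have z1': "a \<le> z1" "z1 \<le> b" "H z1 = c" using z1 by (auto simp: K_def)
      have "c < H z \<longleftrightarrow> z1 < z" if "z \<in> {a..b}" for z
        using z1' z1(2)[of z] that H_mono[of z z1] H_mono[of z1 z] unfolding K_def by force
      then have "{z\<in>{a..b}. c < H z} = {z1<..b}" using z1' by auto
      moreover have "{H a..H b} \<inter> {c<..} = {c<..H b}" using 3 by auto
      ultimately show ?thesis using ab 3 z1' by (simp add: emM emN nn_R_Ioc)
    qed
  qed auto
  then have "(\<integral>\<^sup>+v. f v \<partial>?M) = (\<integral>\<^sup>+v. f v \<partial>?N)" by simp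
  then show ?thesis
    by (simp add: nn_integral_distr nn_integral_density mult_ac)
qed

lemma nn_R_exp_neg:
  assumes ab: "0 \<le> a" "a \<le> b"
  shows "(\<integral>\<^sup>+z\<in>{a..b}. ennreal (R z) * ennreal (exp (- H z)) \<partial>lborel) = ennreal (exp (- H a) - exp (- H b))"
proof -
  have "(\<integral>\<^sup>+z\<in>{a..b}. ennreal (R z) * ennreal (exp (- H z)) \<partial>lborel)
      = (\<integral>\<^sup>+v. ennreal (exp (- v)) * indicator {H a..H b} v \<partial>lborel)"
    by (rule nn_integral_H_image[OF ab, of "\<lambda>v. ennreal (exp (- v))"]) simp
  also have "\<dots> = ennreal (- exp (- H b) - (- exp (- H a)))"
    using H_mono[OF ab(2)] by (intro nn_integral_FTC_Icc) (auto intro!: derivative_eq_intros)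
  finally show ?thesis by simp
qed

lemma nn_R_exp:
  assumes ab: "0 \<le> a" "a \<le> b"
  shows "(\<integral>\<^sup>+z\<in>{a..b}. ennreal (R z) * ennreal (exp (H z)) \<partial>lborel) = ennreal (exp (H b) - exp (H a))"
proof -
  have "(\<integral>\<^sup>+z\<in>{a..b}. ennreal (R z) * ennreal (exp (H z)) \<partial>lborel)
      = (\<integral>\<^sup>+v. ennreal (exp v) * indicator {H a..H b} v \<partial>lborel)"
    by (rule nn_integral_H_image[OF ab, of "\<lambda>v. ennreal (exp v)"]) simp
  also have "\<dots> = ennreal (exp (H b) - exp (H a))"
    using H_mono[OF ab(2)] by (intro nn_integral_FTC_Icc) (auto intro!: derivative_eq_intros)
  finally show ?thesis .
qed

section \<open>Survival function and its generalised inverse\<close>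

lemma survival_eq: "0 \<le> t \<Longrightarrow> survival R z t = exp (H z - H (z * exp t))"
proof -
  assume t: "0 \<le> t"
  consider "0 \<le> z" | "z < 0" by linarith
  then show ?thesis
  proof cases
    case 1
    then have "z \<le> z * exp t" using t by (simp add: mult_le_cancel_left1)
    then show ?thesis using 1 by (simp add: survival_def H_diff)
  next
    case 2
    then have "z * exp t \<le> z" "z * exp t \<le> 0" using t by (auto simp: mult_le_cancel_left2 mult_nonpos_nonneg)
    \<comment> \<open>The interval is empty for \<open>t > 0\<close> but is the singleton {z} for
      \<open>t = 0\<close>, whence the statement almost everywhere.\<close>
    then have "AE u in lborel. indicator {z..z * exp t} u *\<^sub>R R u = 0"
      using AE_lborel_singleton[of z] by (elim eventually_mono) (auto simp: indicator_def)
    then have "(LBINT u:{z..z * exp t}. R u) = 0"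
      unfolding set_lebesgue_integral_def by (rule integral_eq_zero_AE)
    then show ?thesis using 2 \<open>z * exp t \<le> 0\<close> by (simp add: survival_def H_nonpos)
  qed
qed

lemma H_growth_mono: "s \<le> t \<Longrightarrow> H (z * exp s) \<le> H (z * exp t)"
proof (cases "0 \<le> z")
  case True
  assume "s \<le> t" then show ?thesis using True by (intro H_mono mult_left_mono) auto
qed (simp add: H_nonpos mult_nonpos_nonneg)

text \<open>The infimum is attained because the survival function is continuous: if it exceeds
  \<open>u\<close> at \<open>t\<close>, it does so until some \<open>t + d\<close>, and by
  monotonicity also before \<open>t\<close>, so the infimum is at least \<open>t + d\<close>. All
  later facts on waiting times go through this equivalence.\<close>

lemma survival_inv_le_iff:
  assumes t: "0 \<le> t"
  shows "survival_inv R z u \<le> ennreal t \<longleftrightarrow> exp (H z - H (z * exp t)) \<le> u"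
proof
  assume "exp (H z - H (z * exp t)) \<le> u"
  then show "survival_inv R z u \<le> ennreal t"
    unfolding survival_inv_def using t by (intro Inf_lower) (auto simp: survival_eq)
next
  assume le: "survival_inv R z u \<le> ennreal t"
  show "exp (H z - H (z * exp t)) \<le> u"
  proof (rule ccontr)
    let ?g = "\<lambda>s. exp (H z - H (z * exp s))"
    assume "\<not> ?g t \<le> u"
    then have gt: "u < ?g t" by simp
    have "(?g \<longlongrightarrow> ?g t) (at t)" by (intro tendsto_intros H_tendsto)
    then have "eventually (\<lambda>s. u < ?g s) (at t)" using gt by (rule order_tendstoD)
    then obtain d where d: "d > 0" "\<And>s. s \<noteq> t \<Longrightarrow> dist s t < d \<Longrightarrow> u < ?g s"
      unfolding eventually_at by blast
    have "ennreal (t + d) \<le> survival_inv R z u"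
      unfolding survival_inv_def
    proof (rule Inf_greatest)
      fix x assume "x \<in> {ennreal t |t. 0 \<le> t \<and> survival R z t \<le> u}"
      then obtain r where r: "x = ennreal r" "0 \<le> r" "?g r \<le> u" by (auto simp: survival_eq)
      have "t + d \<le> r"
      proof (rule ccontr)
        assume "\<not> t + d \<le> r"
        then consider "r \<le> t" | "t < r" "r < t + d" by linarith
        then show False
        proof cases
          case 1
          then have "?g t \<le> ?g r" using H_growth_mono[of r t z] by simp
          then show ?thesis using r gt by linarith
        next
          case 2
          then show ?thesis using d(2)[of r] r by (auto simp: dist_real_def)
        qed
      qed
      then show "ennreal (t + d) \<le> x" using r by (simp add: ennreal_leI)
    qed
    with le have "ennreal (t + d) \<le> ennreal t" by (rule order_trans[rotated])
    then show False using t \<open>d > 0\<close> by (simp add: ennreal_le_iff)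
  qed
qed

lemma less_survival_inv_iff:
  "0 \<le> t \<Longrightarrow> ennreal t < survival_inv R z u \<longleftrightarrow> u < exp (H z - H (z * exp t))"
  using survival_inv_le_iff[of t z u] by (simp add: not_le[symmetric])

lemma survival_inv_pos: "u < 1 \<Longrightarrow> 0 < survival_inv R z u"
  using less_survival_inv_iff[of 0 z u] by simp

lemma survival_inv_measurable [measurable (raw)]:
  assumes [measurable]: "g \<in> borel_measurable N" "h \<in> borel_measurable N"
  shows "(\<lambda>w. survival_inv R (g w) (h w)) \<in> borel_measurable N"
proof (rule borel_measurableI_le)
  fix y :: ennreal
  show "{w \<in> space N. survival_inv R (g w) (h w) \<le> y} \<in> sets N"
    by (cases y) (simp_all add: survival_inv_le_iff)
qed

end

section \<open>Paths of the cell process\<close>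

declare jump_time.simps(2) [simp del]

lemma jump_prod_0 [simp]: "jump_prod u 0 = 1"
  by (simp add: jump_prod_def)

lemma jump_prod_Suc: "jump_prod u (Suc k) = jump_prod u k * sqrt (u (2 * Suc k))"
  by (simp add: jump_prod_def jump_factor_def)

lemma jump_prod_shift: "jump_prod u (Suc k) = sqrt (u 2) * jump_prod (\<lambda>i. u (i + 2)) k"
  by (induction k) (simp_all add: jump_prod_Suc numeral_2_eq_2)

lemma jump_prod_cong: "(\<And>i. 1 \<le> i \<Longrightarrow> u i = u' i) \<Longrightarrow> jump_prod u k = jump_prod u' k"
  by (induction k) (simp_all add: jump_prod_Suc)

lemma jump_time_cong: "(\<And>i. 1 \<le> i \<Longrightarrow> u i = u' i) \<Longrightarrow> jump_time R u x k = jump_time R u' x k"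
proof (induction k)
  case (Suc k)
  then show ?case using jump_prod_cong[of u u' k] Suc.prems[of "2 * k + 1"] by (simp add: jump_time.simps)
qed simp

text \<open>A path depends only on the entries from index 1 on, so the entry 0 may be fixed when
  passing to the canonical space.\<close>

lemma cell_path_cong: "(\<And>i. 1 \<le> i \<Longrightarrow> u i = u' i) \<Longrightarrow> cell_path R u x t = cell_path R u' x t"
proof -
  assume *: "\<And>i. 1 \<le> i \<Longrightarrow> u i = u' i"
  have "jump_time R u x = jump_time R u' x" by (rule ext) (rule jump_time_cong[OF *])
  moreover have "jump_prod u = jump_prod u'" by (rule ext) (rule jump_prod_cong[OF *])
  ultimately show ?thesis by (simp add: cell_path_def lifetime_def)
qed

text \<open>The defining recursion appends the last waiting time. Splitting off the first one
  instead leaves a jump sequence of the same kind, driven by the shifted variables and started at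
  the post-jump position. This renewal form drives the later inductions on the number of
  jumps.\<close>

lemma jump_time_step:
  "jump_time R u x (Suc k) =
    (if survival_inv R x (u 1) = \<infinity> then \<infinity>
     else survival_inv R x (u 1) +
       jump_time R (\<lambda>i. u (i + 2)) (x * exp (enn2real (survival_inv R x (u 1))) * sqrt (u 2)) k)"
proof (induction k)
  case (Suc k)
  let ?s = "survival_inv R x (u 1)" and ?u = "\<lambda>i. u (i + 2)"
  let ?y = "x * exp (enn2real ?s) * sqrt (u 2)"
  let ?j = "jump_time R ?u ?y k"
  have eq: "jump_time R u x (Suc (Suc k)) = (if jump_time R u x (Suc k) = \<infinity> then \<infinity>
      else jump_time R u x (Suc k) +
        survival_inv R (x * exp (enn2real (jump_time R u x (Suc k))) * jump_prod u (Suc k)) (u (2 * Suc k + 1)))"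
    by (rule jump_time.simps)
  show ?case
  proof (cases "?s = \<infinity> \<or> ?j = \<infinity>")
    case True
    then have "jump_time R u x (Suc k) = \<infinity>" unfolding Suc.IH by auto
    moreover have "?j = \<infinity> \<Longrightarrow> jump_time R ?u ?y (Suc k) = \<infinity>"
      unfolding jump_time.simps(2)[of R ?u] by (rule if_P)
    ultimately show ?thesis using True unfolding eq by auto
  next
    case False
    then have f: "jump_time R u x (Suc k) = ?s + ?j" "?s < top" "?j < top"
      unfolding Suc.IH by (auto simp: less_top)
    \<comment> \<open>The position is the same whether growth and ratios are accumulated from time 0
      or from the first jump on.\<close>
    have y: "x * exp (enn2real (jump_time R u x (Suc k))) * jump_prod u (Suc k)
        = ?y * exp (enn2real ?j) * jump_prod ?u k"
      using f by (simp add: enn2real_plus exp_add jump_prod_shift mult_ac)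
    have "jump_time R u x (Suc k) \<noteq> \<infinity>" unfolding f(1) using False by simp
    then have "jump_time R u x (Suc (Suc k)) = jump_time R u x (Suc k) +
        survival_inv R (x * exp (enn2real (jump_time R u x (Suc k))) * jump_prod u (Suc k)) (u (2 * Suc k + 1))"
      unfolding eq by (rule if_not_P)
    note this[unfolded y, unfolded f(1)]
    then show ?thesis
      using False by (simp add: add.assoc) (simp add: jump_time.simps add.assoc numeral_3_eq_3)
  qed
qed (simp add: jump_time.simps)

text \<open>An almost sure property under the product measure. Positive entries make the value 0 of
  a path a sign of death, and entries below 1 make the first waiting time positive.\<close>

definition good :: "(nat \<Rightarrow> real) \<Rightarrow> bool" where "good v \<longleftrightarrow> (\<forall>i. 0 < v i \<and> v i < 1)"

text \<open>The shift is by two because every jump consumes two variables: \<open>v 0\<close> for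
  the waiting time and \<open>v 1\<close> for the ratio.\<close>

definition shift :: "(nat \<Rightarrow> real) \<Rightarrow> nat \<Rightarrow> real" where "shift v i = v (i + 2)"

text \<open>
  Sequences on the canonical space are indexed from \<open>0\<close>: \<open>v i\<close> stands for \<open>U\<^sub>i\<^sub>+\<^sub>1\<close>. The entry of index \<open>0\<close> in
  \<open>case_nat 0 v\<close> is the unused one.
\<close>

abbreviation jprod :: "(nat \<Rightarrow> real) \<Rightarrow> nat \<Rightarrow> real" where
  "jprod v \<equiv> jump_prod (case_nat 0 v)"

lemma jprod_Suc: "jprod v (Suc n) = jprod v n * sqrt (v (2 * n + 1))"
  by (simp add: jump_prod_Suc)

lemma jprod_shift: "jprod v (Suc n) = sqrt (v 1) * jprod (shift v) n"
  unfolding jump_prod_shift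
  by (subst jump_prod_cong[of _ "case_nat 0 (shift v)"]) (auto simp: shift_def numeral_2_eq_2 split: nat.split)

lemma jprod_pos: "good v \<Longrightarrow> 0 < jprod v n"
  by (induction n) (auto simp: jprod_Suc good_def)

lemma jprod_antimono:
  assumes "good v" "m \<le> n"
  shows "jprod v n \<le> jprod v m"
  using assms(2)
proof (induction n rule: dec_induct)
  case (step n)
  have "jprod v (Suc n) \<le> jprod v n"
    using jprod_pos[OF assms(1), of n] assms(1)
    by (auto simp: jprod_Suc good_def mult_le_cancel_left2 less_imp_le)
  with step show ?case by linarith
qed simp

context rate
begin

section \<open>Renewal structure of a single path\<close>

abbreviation JT :: "(nat \<Rightarrow> real) \<Rightarrow> real \<Rightarrow> nat \<Rightarrow> ennreal" where
  "JT v x k \<equiv> jump_time R (case_nat 0 v) x k"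

definition Z :: "(nat \<Rightarrow> real) \<Rightarrow> real \<Rightarrow> real \<Rightarrow> real" where
  "Z v x t = cell_path R (case_nat 0 v) x t"

definition first :: "(nat \<Rightarrow> real) \<Rightarrow> real \<Rightarrow> ennreal" where
  "first v x = survival_inv R x (v 0)"

definition after :: "(nat \<Rightarrow> real) \<Rightarrow> real \<Rightarrow> real" where
  "after v x = x * exp (enn2real (first v x)) * sqrt (v 1)"

text \<open>Exactly \<open>n\<close> jumps up to time \<open>t\<close>. That no \<open>n\<close>
  qualifies means explosion by time \<open>t\<close>, see \<open>less_lifetime_iff\<close>.\<close>

definition count :: "nat \<Rightarrow> (nat \<Rightarrow> real) \<Rightarrow> real \<Rightarrow> real \<Rightarrow> bool" where
  "count n v x t \<longleftrightarrow> JT v x n \<le> ennreal t \<and> ennreal t < JT v x (Suc n)"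

lemma JT_1: "JT v x (Suc 0) = first v x"
  by (simp add: first_def jump_time.simps)

lemma JT_Suc: "JT v x (Suc k) = (if first v x = \<infinity> then \<infinity> else first v x + JT (shift v) (after v x) k)"
proof -
  have "jump_time R (\<lambda>i. case_nat 0 v (i + 2)) y k = JT (shift v) y k" for y
    by (rule jump_time_cong) (auto simp: shift_def split: nat.split)
  moreover have "case_nat 0 v 2 = v 1" by (simp add: numeral_2_eq_2)
  ultimately show ?thesis
    by (simp only: jump_time_step) (simp add: first_def after_def)
qed

lemma JT_incseq: "incseq (JT v x)"
  by (intro incseq_SucI) (simp add: jump_time.simps)

lemma lifetime_eq: "lifetime R (case_nat 0 v) x = (SUP n. JT v x n)"
  unfolding lifetime_def using LIMSEQ_SUP[OF JT_incseq] by (rule limI)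

lemma count_unique: "count n v x t \<Longrightarrow> count m v x t \<Longrightarrow> n = m"
proof (induction n m rule: linorder_wlog)
  case (le a b)
  then have "\<not> Suc a \<le> b"
    using incseqD[OF JT_incseq, of "Suc a" b v x] unfolding count_def
    by (meson leD order_less_le_trans)
  with le show ?case by simp
qed simp

lemma less_lifetime_iff: "ennreal t < lifetime R (case_nat 0 v) x \<longleftrightarrow> (\<exists>n. count n v x t)"
proof
  assume "ennreal t < lifetime R (case_nat 0 v) x"
  then obtain m where m: "ennreal t < JT v x m"
    unfolding lifetime_eq less_SUP_iff by blast
  define k where "k = (LEAST m. ennreal t < JT v x m)"
  have k: "ennreal t < JT v x k" unfolding k_def by (rule LeastI) (rule m)
  then obtain n where n: "k = Suc n" by (cases k) auto
  then have "\<not> ennreal t < JT v x n" unfolding k_def by (intro not_less_Least) simp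
  then show "\<exists>n. count n v x t" using k n unfolding count_def by (auto simp: not_less)
next
  assume "\<exists>n. count n v x t"
  then show "ennreal t < lifetime R (case_nat 0 v) x"
    unfolding lifetime_eq less_SUP_iff count_def by blast
qed

lemma Z_count: "0 < x \<Longrightarrow> count n v x t \<Longrightarrow> Z v x t = x * exp t * jprod v n"
proof -
  assume x: "0 < x" and n: "count n v x t"
  have "(THE k. JT v x k \<le> ennreal t \<and> ennreal t < JT v x (Suc k)) = n"
    using n count_unique unfolding count_def[symmetric] by blast
  then show ?thesis
    using x n less_lifetime_iff by (auto simp: Z_def cell_path_def)
qed

lemma Z_dead: "\<not> (\<exists>n. count n v x t) \<Longrightarrow> Z v x t = 0"
  using less_lifetime_iff[of t v x] by (simp add: Z_def cell_path_def)

lemma Z_nonpos: "x \<le> 0 \<Longrightarrow> Z v x t = 0"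
  by (simp add: Z_def cell_path_def)

text \<open>With \<open>LEAST\<close> the index is a countable-valued function of the events
  \<open>count n\<close>, which is the form used for measurability.\<close>

lemma Z_eq: "Z v x t = (if 0 < x \<and> (\<exists>n. count n v x t)
    then x * exp t * jprod v (LEAST n. count n v x t) else 0)"
proof -
  have "(LEAST n. count n v x t) = n" if "count n v x t" for n
    using that count_unique by (metis LeastI)
  then show ?thesis using Z_count Z_dead[of v x t] Z_nonpos[of x v t] by auto
qed

lemma Z_nonneg: "good v \<Longrightarrow> 0 \<le> Z v x t"
  unfolding Z_eq using jprod_pos[of v] by (auto simp: less_imp_le)

lemma after_pos: "0 < x \<Longrightarrow> good v \<Longrightarrow> 0 < after v x"
  by (auto simp: after_def good_def)

lemma count_0_iff: "count 0 v x t \<longleftrightarrow> ennreal t < first v x"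
  by (simp add: count_def JT_1)

lemma count_Suc_iff:
  assumes "0 \<le> t" "first v x \<le> ennreal t"
  shows "count (Suc n) v x t \<longleftrightarrow> count n (shift v) (after v x) (t - enn2real (first v x))"
proof -
  have fin: "first v x < top" using assms by (auto intro: order_le_less_trans)
  define s where "s = enn2real (first v x)"
  have s: "first v x = ennreal s" "0 \<le> s" using fin by (auto simp: s_def)
  then have "s \<le> t" using assms by (simp add: ennreal_le_iff)
  then have t: "ennreal t = ennreal s + ennreal (t - s)" using s by (simp add: ennreal_plus[symmetric] del: ennreal_plus)
  show ?thesis
    unfolding count_def JT_Suc s_def[symmetric] unfolding t
    using s by (simp add: ennreal_add_left_cancel_le ennreal_add_left_cancel_less)
qed

lemma not_count_Suc: "ennreal t < first v x \<Longrightarrow> \<not> count (Suc n) v x t"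
  using count_unique[of 0 v x t "Suc n"] count_0_iff by blast

lemma Z_before: "0 < x \<Longrightarrow> ennreal t < first v x \<Longrightarrow> Z v x t = x * exp t"
  using Z_count[of x 0 v t] by (simp add: count_0_iff)

text \<open>From the first jump on, the path is the one started at the post-jump position with the
  remaining variables; the growth factors and the ratios recombine to the original product.\<close>

lemma Z_after:
  assumes "0 \<le> t" "first v x \<le> ennreal t" "0 < x" "good v"
  shows "Z v x t = Z (shift v) (after v x) (t - enn2real (first v x))"
proof (cases "\<exists>n. count n v x t")
  case True
  then obtain n where n: "count n v x t" by blast
  with assms(2) have "\<not> count 0 v x t" by (simp add: count_0_iff)
  with n have "n \<noteq> 0" by metis
  then obtain m where m: "n = Suc m" by (cases n) auto
  then have c: "count m (shift v) (after v x) (t - enn2real (first v x))"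
    using n count_Suc_iff assms by auto
  show ?thesis
    using Z_count[OF assms(3) n] Z_count[OF after_pos[OF assms(3,4)] c]
    by (simp add: m jprod_shift after_def exp_diff mult_ac)
next
  case False
  then have "\<not> (\<exists>n. count n (shift v) (after v x) (t - enn2real (first v x)))"
    using count_Suc_iff[OF assms(1,2)] by blast
  then show ?thesis using False by (simp add: Z_dead)
qed

text \<open>The survival function is multiplicative along growth: surviving \<open>s + r\<close>
  from \<open>x\<close> means surviving \<open>s\<close> from \<open>x\<close> and then
  \<open>r\<close> from \<open>x e^s\<close>. Comparing \<open>v 0\<close> with the product amounts
  to comparing \<open>v 0 / S_x(s)\<close> with the second factor.\<close>

lemma first_restart:
  assumes "0 \<le> s" "ennreal s < first v x"
  defines "v' \<equiv> v(0 := v 0 / exp (H x - H (x * exp s)))"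
  shows "first v x = ennreal s + first v' (x * exp s)"
proof -
  \<comment> \<open>Both sides are determined by their comparison with finite times, and there the
    claim is the multiplicativity \<open>e\<close>.\<close>
  have iff: "first v' (x * exp s) \<le> ennreal r \<longleftrightarrow> first v x \<le> ennreal (s + r)" if "0 \<le> r" for r
  proof -
    have e: "exp (H x - H (x * exp (s + r))) = exp (H (x * exp s) - H (x * exp s * exp r)) * exp (H x - H (x * exp s))"
      by (simp add: exp_add[symmetric] mult.assoc)
    show ?thesis
      unfolding first_def survival_inv_le_iff[OF that] using that assms(1)
      by (simp add: survival_inv_le_iff[of "s + r"] v'_def e pos_le_divide_eq del: ennreal_plus)
  qed
  show ?thesis
  proof (cases "first v' (x * exp s)")
    case (real b)
    show ?thesis
    proof (rule antisym)
      show "first v x \<le> ennreal s + first v' (x * exp s)"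
        using iff[of b] real assms(1) by simp
      have "first v x < top" using iff[of b] real by (auto intro: order_le_less_trans)
      then obtain a where a: "first v x = ennreal a" "0 \<le> a" by (cases "first v x") auto
      then have sa: "s \<le> a" using assms by (simp add: ennreal_less_iff)
      then show "ennreal s + first v' (x * exp s) \<le> first v x"
        using iff[of "a - s"] a real assms(1) by (simp add: ennreal_plus[symmetric] del: ennreal_plus)
    qed
  next
    case top
    have "first v x = top"
    proof (cases "first v x")
      case (real a)
      then have sa: "s \<le> a" using assms by (simp add: ennreal_less_iff)
      then show ?thesis using iff[of "a - s"] real top by (simp add: top_unique)
    qed
    then show ?thesis using top by simp
  qed
qed

text \<open>The rescaled variable stays below 1 precisely because no jump has occurred up to
  \<open>s\<close>.\<close>

lemma good_restart:
  assumes "good v" "0 \<le> s" "ennreal s < first v x"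
  shows "good (v(0 := v 0 / exp (H x - H (x * exp s))))"
  using assms less_survival_inv_iff[of s x "v 0"] by (auto simp: good_def first_def)

text \<open>Pathwise form of the absence of memory: before the first jump only the first variable is
  rescaled. The ratio and the later variables stay, and the jump happens at the same place, so both
  paths continue alike after it.\<close>

lemma Z_restart:
  assumes "0 \<le> s" "ennreal s < first v x" "0 \<le> t" "0 < x" "good v"
  shows "Z v x (s + t) = Z (v(0 := v 0 / exp (H x - H (x * exp s)))) (x * exp s) t"
proof -
  let ?v = "v(0 := v 0 / exp (H x - H (x * exp s)))"
  have fr: "first v x = ennreal s + first ?v (x * exp s)" by (rule first_restart[OF assms(1,2)])
  have g: "good ?v" by (rule good_restart) fact+
  show ?thesis
  proof (cases "ennreal t < first ?v (x * exp s)")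
    case True
    then have "ennreal (s + t) < first v x"
      using assms by (simp add: fr ennreal_add_left_cancel_less)
    then show ?thesis using True assms by (simp add: Z_before exp_add)
  next
    case False
    then have le: "first ?v (x * exp s) \<le> ennreal t" by simp
    then have le': "first v x \<le> ennreal (s + t)"
      using assms by (simp add: fr)
    have fin: "first ?v (x * exp s) < top" using le by (auto intro: order_le_less_trans)
    have e: "enn2real (first v x) = s + enn2real (first ?v (x * exp s))"
      using fin assms by (simp add: fr enn2real_plus)
    have "shift ?v = shift v" by (auto simp: shift_def)
    moreover have "after ?v (x * exp s) = after v x"
      by (simp add: after_def e exp_add mult_ac)
    ultimately show ?thesis
      using Z_after[OF _ le' assms(4,5)] Z_after[OF assms(3) le _ g] assms by (simp add: e)
  qed
qed

lemma Z_zero: "good v \<Longrightarrow> 0 \<le> x \<Longrightarrow> Z v x 0 = x"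
  using Z_before[of x 0 v] survival_inv_pos[of "v 0" x] Z_nonpos[of x v 0]
  by (cases "x = 0") (auto simp: good_def first_def)

text \<open>Later ratios only decrease the product, and a dead path is 0. The bound forces the left
  limit 0 at an explosion.\<close>

lemma Z_le:
  assumes "good v" "0 < x" "JT v x n \<le> ennreal s"
  shows "Z v x s \<le> x * exp s * jprod v n"
proof (cases "\<exists>m. count m v x s")
  case True
  then obtain m where m: "count m v x s" by blast
  have "n \<le> m"
  proof (rule ccontr)
    assume "\<not> n \<le> m"
    then have "JT v x (Suc m) \<le> JT v x n" by (intro incseqD[OF JT_incseq]) auto
    with m assms(3) show False unfolding count_def by (meson leD order_less_le_trans)
  qed
  then show ?thesis
    using jprod_antimono[OF assms(1), of n m] assms(2) Z_count[OF assms(2) m] by simp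
next
  case False
  then show ?thesis using jprod_pos[OF assms(1), of n] assms(2) by (simp add: Z_dead)
qed

section \<open>Joint measurability in the driving sequence, the starting point and the time\<close>

lemma jump_time_measurable [measurable (raw)]:
  assumes [measurable]: "\<And>i. (\<lambda>w. u w i) \<in> borel_measurable N" "x \<in> borel_measurable N"
  shows "(\<lambda>w. jump_time R (u w) (x w) k) \<in> borel_measurable N"
    and "(\<lambda>w. jump_prod (u w) k) \<in> borel_measurable N"
proof -
  show jp: "(\<lambda>w. jump_prod (u w) k) \<in> borel_measurable N" for k
    unfolding jump_prod_def jump_factor_def by measurable
  note [measurable] = this
  show "(\<lambda>w. jump_time R (u w) (x w) k) \<in> borel_measurable N"
  proof (induction k)
    case (Suc k)
    note [measurable] = this
    show ?case by (simp add: jump_time.simps)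
  qed simp
qed

lemma count_measurable [measurable (raw)]:
  assumes [measurable]: "\<And>i. (\<lambda>w. v w i) \<in> borel_measurable N" "x \<in> borel_measurable N" "t \<in> borel_measurable N"
  shows "Measurable.pred N (\<lambda>w. count n (v w) (x w) (t w))"
proof -
  have [measurable]: "(\<lambda>w. case_nat 0 (v w) i) \<in> borel_measurable N" for i
    by (cases i) simp_all
  show ?thesis unfolding count_def by measurable
qed

lemma Z_measurable [measurable (raw)]:
  assumes [measurable]: "\<And>i. (\<lambda>w. v w i) \<in> borel_measurable N" "x \<in> borel_measurable N" "t \<in> borel_measurable N"
  shows "(\<lambda>w. Z (v w) (x w) (t w)) \<in> borel_measurable N"
proof -
  have [measurable]: "(\<lambda>w. case_nat 0 (v w) i) \<in> borel_measurable N" for i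
    by (cases i) simp_all
  have [measurable]: "(\<lambda>w. jprod (v w) (LEAST n. count n (v w) (x w) (t w))) \<in> borel_measurable N"
    by (rule measurable_compose_countable[where f="\<lambda>n w. jprod (v w) n"]) measurable
  show ?thesis unfolding Z_eq by measurable
qed

lemma first_measurable [measurable (raw)]:
  assumes [measurable]: "\<And>i. (\<lambda>w. v w i) \<in> borel_measurable N" "x \<in> borel_measurable N"
  shows "(\<lambda>w. first (v w) (x w)) \<in> borel_measurable N" "(\<lambda>w. after (v w) (x w)) \<in> borel_measurable N"
proof -
  show *: "(\<lambda>w. first (v w) (x w)) \<in> borel_measurable N" unfolding first_def by measurable
  show "(\<lambda>w. after (v w) (x w)) \<in> borel_measurable N" unfolding after_def using * by measurable
qed

section \<open>Regularity of the paths\<close>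

lemma Z_right_exp:
  assumes "good v" "0 < x" "0 \<le> t" "0 < Z v x t"
  shows "eventually (\<lambda>s. Z v x s = Z v x t * exp (s - t)) (at_right t)"
proof -
  obtain n where n: "count n v x t" using assms Z_dead by force
  have ev: "eventually (\<lambda>s. ennreal s < JT v x (Suc n)) (at_right t)"
  proof -
    have "((\<lambda>s. ennreal s) \<longlongrightarrow> ennreal t) (at_right t)" by (intro tendsto_intros)
    moreover have "ennreal t < JT v x (Suc n)" using n by (simp add: count_def)
    ultimately show ?thesis by (rule order_tendstoD)
  qed
  show ?thesis
    using ev eventually_at_right_less[of t]
  proof eventually_elim
    case (elim s)
    then have "count n v x s"
      using n ennreal_leI[of t s] unfolding count_def by auto
    then show ?case using Z_count[OF assms(2) n] Z_count[OF assms(2)] by (simp add: exp_diff)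
  qed
qed

text \<open>All factors of a living path from a positive start are positive, so the value 0 can only
  mean explosion or a nonpositive start, and both are permanent.\<close>

lemma Z_absorbed:
  assumes "good v" "t \<le> s" "Z v x t = 0" shows "Z v x s = 0"
proof (cases "0 < x")
  case True
  have "\<not> (\<exists>n. count n v x t)"
    using Z_count[OF True] jprod_pos[OF assms(1)] assms(3) True by (metis exp_gt_zero less_irrefl mult_pos_pos)
  then have "\<not> ennreal t < lifetime R (case_nat 0 v) x" by (simp add: less_lifetime_iff)
  then have "\<not> ennreal s < lifetime R (case_nat 0 v) x" using assms(2) by (meson ennreal_leI order_le_less_trans)
  then show ?thesis using Z_dead less_lifetime_iff by blast
qed (simp add: Z_nonpos)

lemma Z_right_continuous:
  assumes g: "good v" and t: "0 \<le> t"
  shows "(Z v x \<longlongrightarrow> Z v x t) (at_right t)"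
proof (cases "0 < Z v x t")
  case False
  then have "Z v x t = 0" using Z_nonneg[OF g, of x t] by simp
  then have "eventually (\<lambda>s. Z v x t = Z v x s) (at_right t)"
    using Z_absorbed[OF g, of t _ x] eventually_at_right_less[of t] by (auto elim: eventually_mono)
  then show ?thesis
    by (rule Lim_transform_eventually[OF tendsto_const])
next
  case True
  then have "0 < x" using Z_nonpos by (metis less_irrefl not_less)
  from Z_right_exp[OF g this t True]
  have ev: "eventually (\<lambda>s. Z v x t * exp (s - t) = Z v x s) (at_right t)"
    by eventually_elim simp
  have "((\<lambda>s. Z v x t * exp (s - t)) \<longlongrightarrow> Z v x t * exp (t - t)) (at_right t)" by (intro tendsto_intros)
  then show ?thesis using ev Lim_transform_eventually by force
qed

lemma Z_cadlag:
  assumes g: "good v" and z: "jprod v \<longlonglongrightarrow> 0" and x: "0 \<le> x"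
  shows "cadlag_on {0..} (Z v x)"
proof (cases "x = 0")
  case True
  then have "Z v x = (\<lambda>_. 0)" by (simp add: fun_eq_iff Z_nonpos)
  then show ?thesis by (auto simp: cadlag_on_def)
next
  case False
  then have x: "0 < x" using assms by simp
  show ?thesis
    unfolding cadlag_on_def
  proof (intro ballI conjI)
    fix t :: real assume "t \<in> {0..}"
    then have t: "0 \<le> t" by simp
    have I: "{0..} \<inter> {t<..} = {t<..}" using t by auto
    show "(Z v x \<longlongrightarrow> Z v x t) (at t within {0..} \<inter> {t<..})"
      unfolding I by (rule Z_right_continuous[OF g t])
    have L: "\<exists>l. (Z v x \<longlongrightarrow> l) (at_left t)" if "0 < t"
    proof (cases "\<exists>n. ennreal t \<le> JT v x (Suc n)")
      case True
      then obtain m where m: "ennreal t \<le> JT v x (Suc m)" by blast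
      \<comment> \<open>The n-th jump is the last one strictly before \<open>t\<close>; a jump at
        \<open>t\<close> itself leaves the left limit alone.\<close>
      define n where "n = (LEAST m. ennreal t \<le> JT v x (Suc m))"
      have n: "ennreal t \<le> JT v x (Suc n)" unfolding n_def by (rule LeastI) (rule m)
      have n': "JT v x n < ennreal t"
      proof (cases n)
        case 0 then show ?thesis using that by simp
      next
        case (Suc k)
        then have "\<not> ennreal t \<le> JT v x (Suc k)" unfolding n_def by (intro not_less_Least) simp
        then show ?thesis using Suc by simp
      qed
      have "((\<lambda>s. ennreal s) \<longlongrightarrow> ennreal t) (at_left t)" by (intro tendsto_intros)
      then have "eventually (\<lambda>s. JT v x n < ennreal s) (at_left t)" using n' by (rule order_tendstoD)
      then have "eventually (\<lambda>s. x * exp s * jprod v n = Z v x s) (at_left t)"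
        using eventually_at_left_real[OF that]
      proof eventually_elim
        case (elim s)
        then have "ennreal s < ennreal t" using that by (intro ennreal_lessI) auto
        then have "count n v x s" using elim n unfolding count_def by (auto)
        then show ?case using Z_count x by simp
      qed
      moreover have "((\<lambda>s. x * exp s * jprod v n) \<longlongrightarrow> x * exp t * jprod v n) (at_left t)" by (intro tendsto_intros)
      ultimately show ?thesis using Lim_transform_eventually by blast
    next
      case False
      \<comment> \<open>Here every jump time lies strictly before \<open>t\<close>.
        \<open>Z_le\<close> and the vanishing product squeeze the path to 0 on the left of
        \<open>t\<close>; this is where the convention that the product of the ratios tends to 0 on
        every outcome enters.\<close>
      then have lt: "JT v x n < ennreal t" for n
        using that by (cases n) (auto simp: not_le)
      have "(Z v x \<longlongrightarrow> 0) (at_left t)"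
      proof (rule tendstoI)
        fix e :: real assume e: "0 < e"
        have "(\<lambda>n. x * exp t * jprod v n) \<longlonglongrightarrow> x * exp t * 0" by (intro tendsto_intros z)
        then have "eventually (\<lambda>n. x * exp t * jprod v n < e) sequentially"
          using e by (intro order_tendstoD) auto
        then obtain n where n: "x * exp t * jprod v n < e" by (auto simp: eventually_sequentially)
        have "((\<lambda>s. ennreal s) \<longlongrightarrow> ennreal t) (at_left t)" by (intro tendsto_intros)
        then have "eventually (\<lambda>s. JT v x n < ennreal s) (at_left t)" using lt by (rule order_tendstoD)
        then show "eventually (\<lambda>s. dist (Z v x s) 0 < e) (at_left t)"
          using eventually_at_left_real[OF that]
        proof eventually_elim
          case (elim s)
          have "Z v x s \<le> x * exp s * jprod v n" using elim by (intro Z_le g x) auto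
          also have "\<dots> \<le> x * exp t * jprod v n" using elim x jprod_pos[OF g, of n] by (intro mult_right_mono mult_left_mono) auto
          finally show ?case using n Z_nonneg[OF g, of x s] by simp
        qed
      qed
      then show ?thesis by blast
    qed
    show "\<exists>l. (Z v x \<longlongrightarrow> l) (at t within {0..} \<inter> {..<t})"
    proof (cases "t = 0")
      case False
      then obtain l where l: "(Z v x \<longlongrightarrow> l) (at_left t)" using L t by auto
      then have "(Z v x \<longlongrightarrow> l) (at t within {0..} \<inter> {..<t})" by (rule tendsto_within_subset) auto
      then show ?thesis by blast
    next
      \<comment> \<open>At 0 the set of times to the left is empty, so the filter is trivial and
        every value is a limit.\<close>
      case True
      then have "{0..} \<inter> {..<t} = {}" by auto
      then show ?thesis by (simp only: at_within_empty) simp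
    qed
  qed
qed

end

section \<open>The canonical driving sequence and the Markov property\<close>

definition unif :: "real measure" where "unif = uniform_measure lborel {0<..<1}"

abbreviation Om :: "(nat \<Rightarrow> real) measure" where "Om \<equiv> PiM UNIV (\<lambda>_. unif)"

lemma sets_unif [measurable_cong, simp]: "sets unif = sets borel"
  and space_unif [simp]: "space unif = UNIV"
  by (simp_all add: unif_def)

interpretation unif: prob_space unif
  unfolding unif_def by (rule prob_space_uniform_measure) auto

interpretation canon: sequence_space unif
  by unfold_locales

lemma space_Om [simp]: "space Om = UNIV"
  by (auto simp: space_PiM)

lemma nn_integral_unif:
  assumes [measurable]: "g \<in> borel_measurable borel"
  shows "(\<integral>\<^sup>+a. g a \<partial>unif) = (\<integral>\<^sup>+a\<in>{0<..<1}. g a \<partial>lborel)"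
  by (simp add: unif_def nn_integral_uniform_measure ennreal_divide_numeral divide_ennreal_def)

lemma Om_component [measurable]: "(\<lambda>v. v i) \<in> borel_measurable Om"
  using measurable_component_singleton[of i UNIV "\<lambda>_. unif"] by (simp cong: measurable_cong_sets)

lemma measurable_into_Om:
  assumes "\<And>i. (\<lambda>w. g w i) \<in> borel_measurable N"
  shows "g \<in> measurable N Om"
  using assms by (intro measurable_PiM_single') (auto cong: measurable_cong_sets)

lemma AE_unif: "AE a in unif. 0 < a \<and> a < 1"
  unfolding unif_def by (rule AE_uniform_measureI) auto

lemma AE_good: "AE v in Om. good v"
  unfolding good_def
  by (intro AE_all_countable[THEN iffD2] allI canon.AE_component AE_unif) simp

text \<open>A sequence of independent uniforms is one uniform followed by an independent copy of the
  sequence. Applied twice, this integrates out the two variables of the first jump.\<close>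

lemma nn_integral_Om_case:
  assumes [measurable]: "g \<in> borel_measurable Om"
  shows "(\<integral>\<^sup>+v. g v \<partial>Om) = (\<integral>\<^sup>+a. (\<integral>\<^sup>+v. g (case_nat a v) \<partial>Om) \<partial>unif)"
    and "(\<lambda>a. \<integral>\<^sup>+v. g (case_nat a v) \<partial>Om) \<in> borel_measurable borel"
proof -
  have "(\<integral>\<^sup>+v. g v \<partial>Om) = (\<integral>\<^sup>+v. g v \<partial>distr (unif \<Otimes>\<^sub>M Om) Om (\<lambda>(s, \<omega>). case_nat s \<omega>))"
    by (simp only: canon.PiM_iter)
  also have "\<dots> = (\<integral>\<^sup>+p. g (case p of (s, \<omega>) \<Rightarrow> case_nat s \<omega>) \<partial>(unif \<Otimes>\<^sub>M Om))"
    by (rule nn_integral_distr) measurable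
  also have "\<dots> = (\<integral>\<^sup>+a. (\<integral>\<^sup>+v. g (case_nat a v) \<partial>Om) \<partial>unif)"
    by (subst canon.nn_integral_fst[symmetric]) (simp_all add: split_beta')
  finally show "(\<integral>\<^sup>+v. g v \<partial>Om) = (\<integral>\<^sup>+a. (\<integral>\<^sup>+v. g (case_nat a v) \<partial>Om) \<partial>unif)" .
  have "(\<lambda>a. \<integral>\<^sup>+v. g (case_nat a v) \<partial>Om) \<in> borel_measurable unif"
    by (rule canon.borel_measurable_nn_integral) measurable
  then show "(\<lambda>a. \<integral>\<^sup>+v. g (case_nat a v) \<partial>Om) \<in> borel_measurable borel"
    by (simp cong: measurable_cong_sets)
qed

lemma nn_integral_Om_case2:
  assumes [measurable]: "g \<in> borel_measurable Om"
  shows "(\<integral>\<^sup>+v. g v \<partial>Om) = (\<integral>\<^sup>+a. (\<integral>\<^sup>+b. (\<integral>\<^sup>+v. g (case_nat a (case_nat b v)) \<partial>Om) \<partial>unif) \<partial>unif)"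
proof -
  have [measurable]: "(\<lambda>v. g (case_nat a v)) \<in> borel_measurable Om" for a
    by measurable
  show ?thesis
    by (subst nn_integral_Om_case(1), simp, subst nn_integral_Om_case(1), simp_all)
qed

text \<open>The absence of memory in law: conditioned to lie below \<open>c\<close> and divided by
  \<open>c\<close>, a uniform variable is uniform again. With \<open>c = S_x(s)\<close> and
  \<open>Z_restart\<close> this restarts the process at \<open>x e^s\<close>. The proof is the
  substitution \<open>a = c a'\<close> in the first coordinate.\<close>

lemma nn_integral_Om_scale:
  assumes [measurable]: "h \<in> borel_measurable Om" and c: "0 < c" "c \<le> 1"
  shows "(\<integral>\<^sup>+v. indicator {v. v 0 < c} v * h (v(0 := v 0 / c)) \<partial>Om) = ennreal c * (\<integral>\<^sup>+v. h v \<partial>Om)"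
proof -
  let ?G = "\<lambda>a. \<integral>\<^sup>+v. h (case_nat a v) \<partial>Om"
  have [measurable]: "?G \<in> borel_measurable borel" by (rule nn_integral_Om_case(2)) simp
  have [measurable]: "(\<lambda>v. v(0 := v 0 / c)) \<in> measurable Om Om"
    by (rule measurable_into_Om) (simp add: fun_upd_def)
  have [measurable]: "(\<lambda>v. indicator {v. v 0 < c} v * h (v(0 := v 0 / c))) \<in> borel_measurable Om"
    by measurable
  have upd: "(case_nat a v)(0 := a / c) = case_nat (a / c) v" for a and v :: "nat \<Rightarrow> real"
    by (auto split: nat.split)
  have [measurable]: "(\<lambda>v. h (case_nat a v)) \<in> borel_measurable Om" for a
    by measurable
  have "(\<integral>\<^sup>+v. indicator {v. v 0 < c} v * h (v(0 := v 0 / c)) \<partial>Om)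
      = (\<integral>\<^sup>+a. (\<integral>\<^sup>+v. indicator {..<c} a * h (case_nat (a / c) v) \<partial>Om) \<partial>unif)"
    by (subst nn_integral_Om_case(1)) (simp_all add: upd indicator_def)
  also have "\<dots> = (\<integral>\<^sup>+a. indicator {..<c} a * ?G (a / c) \<partial>unif)"
    by (simp add: nn_integral_cmult)
  also have "\<dots> = (\<integral>\<^sup>+a. indicator {..<c} a * ?G (a / c) * indicator {0<..<1} a \<partial>lborel)"
    by (rule nn_integral_unif) measurable
  also have "\<dots> = ennreal c * (\<integral>\<^sup>+a. indicator {..<c} (c * a) * ?G (c * a / c) * indicator {0<..<1} (c * a) \<partial>lborel)"
    using c by (subst nn_integral_real_affine[where t = 0 and c = c]) simp_all
  also have "(\<integral>\<^sup>+a. indicator {..<c} (c * a) * ?G (c * a / c) * indicator {0<..<1} (c * a) \<partial>lborel)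
      = (\<integral>\<^sup>+a. ?G a * indicator {0<..<1} a \<partial>lborel)"
  proof (intro nn_integral_cong)
    fix a :: real
    have "c * a < c \<longleftrightarrow> a < 1" "0 < c * a \<longleftrightarrow> 0 < a" using c by (auto simp: zero_less_mult_iff)
    moreover have "c * a < 1" if "a < 1"
      using mult_strict_left_mono[OF that c(1)] c by linarith
    ultimately show "indicator {..<c} (c * a) * ?G (c * a / c) * indicator {0<..<1} (c * a) = ?G a * indicator {0<..<1} a"
      using c by (auto simp: indicator_def)
  qed
  also have "\<dots> = (\<integral>\<^sup>+v. h v \<partial>Om)"
    by (subst nn_integral_unif[symmetric]) (simp_all add: nn_integral_Om_case(1)[symmetric])
  finally show ?thesis .
qed

context rate
begin

section \<open>The Markov property at fixed times\<close>

definition Pn :: "real \<Rightarrow> (real \<Rightarrow> ennreal) \<Rightarrow> real \<Rightarrow> ennreal" where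
  "Pn t f x = (\<integral>\<^sup>+v. f (Z v x t) \<partial>Om)"

lemma Z_Om_measurable [measurable]: "(\<lambda>v. Z v x t) \<in> borel_measurable Om"
  by measurable

lemma Pn_measurable [measurable]:
  assumes [measurable]: "f \<in> borel_measurable borel"
  shows "Pn t f \<in> borel_measurable borel"
proof -
  have "(\<lambda>(x, v). f (Z v x t)) \<in> borel_measurable (borel \<Otimes>\<^sub>M Om)"
    by measurable
  then show ?thesis
    unfolding Pn_def by (rule canon.borel_measurable_nn_integral)
qed

lemma Pn_nonpos: "x \<le> 0 \<Longrightarrow> Pn t f x = f 0"
  by (simp add: Pn_def Z_nonpos canon.emeasure_space_1[simplified])

lemma path_measurable [measurable]: "(\<lambda>v. \<lambda>r\<in>T. Z v x r) \<in> measurable Om (PiM T (\<lambda>_. borel))"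
  by (rule measurable_restrict) measurable

lemma count_Om_sets [measurable]: "{v. count k v x s} \<in> sets Om"
  using measurable_sets_Collect[of "\<lambda>v. count k v x s" Om] by (simp add: pred_def[symmetric])

lemma survival_le_1: "0 \<le> s \<Longrightarrow> exp (H x - H (x * exp s)) \<le> 1"
  using H_growth_mono[of 0 s x] by simp

text \<open>The statement allows every functional \<open>\<Phi>\<close> of the path up to
  \<open>s\<close>, and \<open>x\<close>, \<open>s\<close>, \<open>\<Phi>\<close> vary in the
  induction. When the first jump is split off, the deterministic growth before it is absorbed into a
  new functional of the remaining path, so the induction hypothesis applies as it stands.\<close>

lemma markov_count:
  assumes f [measurable]: "f \<in> borel_measurable borel" and t: "0 \<le> t"
    and "0 < x" "0 \<le> s" "\<Phi> \<in> borel_measurable (PiM {0..s} (\<lambda>_. borel))"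
  shows "(\<integral>\<^sup>+v. \<Phi> (\<lambda>r\<in>{0..s}. Z v x r) * indicator {v. count k v x s} v * f (Z v x (s + t)) \<partial>Om)
    = (\<integral>\<^sup>+v. \<Phi> (\<lambda>r\<in>{0..s}. Z v x r) * indicator {v. count k v x s} v * Pn t f (Z v x s) \<partial>Om)"
  using assms(3-)
proof (induction k arbitrary: x s \<Phi>)
  case 0
  note x = 0(1) and s = 0(2) and [measurable] = 0(3)
  define c where "c = exp (H x - H (x * exp s))"
  have c: "0 < c" "c \<le> 1" using survival_le_1[OF s] by (auto simp: c_def)
  \<comment> \<open>Without a jump up to \<open>s\<close> the path there is deterministic and the
    functional is a constant.\<close>
  define \<phi> where "\<phi> = \<Phi> (\<lambda>r\<in>{0..s}. x * exp r)"
  have cnt: "count 0 v x s \<longleftrightarrow> v 0 < c" for v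
    using s by (simp add: count_0_iff first_def less_survival_inv_iff c_def)
  have path: "(\<lambda>r\<in>{0..s}. Z v x r) = (\<lambda>r\<in>{0..s}. x * exp r)" if "count 0 v x s" for v
    using that x by (auto simp: restrict_def fun_eq_iff count_0_iff intro!: Z_before intro: order_le_less_trans ennreal_leI)
  have Zs: "Z v x s = x * exp s" if "count 0 v x s" for v
    using that x by (simp add: Z_before count_0_iff)
  have scale: "(\<integral>\<^sup>+v. \<phi> * (indicator {v. v 0 < c} v * h (v(0 := v 0 / c))) \<partial>Om) = \<phi> * (ennreal c * (\<integral>\<^sup>+v. h v \<partial>Om))"
    if [measurable]: "h \<in> borel_measurable Om" for h
  proof -
    have [measurable]: "(\<lambda>v. v(0 := v 0 / c)) \<in> measurable Om Om"
      by (rule measurable_into_Om) (simp add: fun_upd_def)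
    show ?thesis
      by (subst nn_integral_cmult) (simp_all add: nn_integral_Om_scale c)
  qed
  have "(\<integral>\<^sup>+v. \<Phi> (\<lambda>r\<in>{0..s}. Z v x r) * indicator {v. count 0 v x s} v * f (Z v x (s + t)) \<partial>Om)
      = (\<integral>\<^sup>+v. \<phi> * (indicator {v. v 0 < c} v * f (Z (v(0 := v 0 / c)) (x * exp s) t)) \<partial>Om)"
  proof (rule nn_integral_cong_AE, use AE_good in eventually_elim)
    case (elim v)
    show ?case
    proof (cases "count 0 v x s")
      case True
      then have "Z v x (s + t) = Z (v(0 := v 0 / c)) (x * exp s) t"
        unfolding c_def using elim x s t by (intro Z_restart) (auto simp: count_0_iff)
      then show ?thesis using True cnt[of v] path[OF True] by (simp add: \<phi>_def indicator_def mult_ac)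
    qed (simp add: cnt)
  qed
  also have "\<dots> = \<phi> * (ennreal c * Pn t f (x * exp s))"
    unfolding Pn_def by (rule scale) measurable
  also have "\<dots> = (\<integral>\<^sup>+v. \<phi> * (indicator {v. v 0 < c} v * Pn t f (x * exp s)) \<partial>Om)"
    using scale[of "\<lambda>_. Pn t f (x * exp s)"] by (simp add: canon.emeasure_space_1[simplified])
  also have "\<dots> = (\<integral>\<^sup>+v. \<Phi> (\<lambda>r\<in>{0..s}. Z v x r) * indicator {v. count 0 v x s} v * Pn t f (Z v x s) \<partial>Om)"
  proof (rule nn_integral_cong)
    fix v
    show "\<phi> * (indicator {v. v 0 < c} v * Pn t f (x * exp s))
      = \<Phi> (\<lambda>r\<in>{0..s}. Z v x r) * indicator {v. count 0 v x s} v * Pn t f (Z v x s)"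
    proof (cases "count 0 v x s")
      case True
      then show ?thesis using cnt[of v] path[OF True] Zs[OF True] by (simp add: \<phi>_def mult_ac)
    qed (simp add: cnt)
  qed
  finally show ?case .
next
  case (Suc k)
  note x = Suc(2) and s = Suc(3) and [measurable] = Suc(4)
  have inner: "(\<integral>\<^sup>+w. \<Phi> (\<lambda>r\<in>{0..s}. Z (case_nat a (case_nat b w)) x r)
      * indicator {v. count (Suc k) v x s} (case_nat a (case_nat b w)) * f (Z (case_nat a (case_nat b w)) x (s + t)) \<partial>Om)
    = (\<integral>\<^sup>+w. \<Phi> (\<lambda>r\<in>{0..s}. Z (case_nat a (case_nat b w)) x r)
      * indicator {v. count (Suc k) v x s} (case_nat a (case_nat b w)) * Pn t f (Z (case_nat a (case_nat b w)) x s) \<partial>Om)"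
    (is "?L = ?R") if ab: "0 < a" "a < 1" "0 < b" "b < 1" for a b :: real
  proof (cases "survival_inv R x a \<le> ennreal s")
    case False
    then have "\<not> count (Suc k) (case_nat a (case_nat b w)) x s" for w
      by (intro not_count_Suc) (simp add: first_def not_le)
    then show ?thesis by simp
  next
    case True
    let ?v = "\<lambda>w. case_nat a (case_nat b w)"
    have fin: "survival_inv R x a < top" using True by (auto intro: order_le_less_trans)
    define \<tau> where "\<tau> = enn2real (survival_inv R x a)"
    have \<tau>: "survival_inv R x a = ennreal \<tau>" "0 \<le> \<tau>" using fin by (auto simp: \<tau>_def)
    then have \<tau>s: "\<tau> \<le> s" using True s by (simp add: ennreal_le_iff)
    define y where "y = x * exp \<tau> * sqrt b"
    have y: "0 < y" using x ab by (simp add: y_def)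
    have fv: "first (?v w) x = ennreal \<tau>" "after (?v w) x = y" "shift (?v w) = w" for w
      using \<tau> by (auto simp: first_def after_def y_def shift_def fun_eq_iff)
    have gv: "good (?v w)" if "good w" for w
      using that ab by (auto simp: good_def split: nat.split)
    have Zv: "Z (?v w) x r = (if r < \<tau> then x * exp r else Z w y (r - \<tau>))" if "good w" "0 \<le> r" for r w
      using Z_before[of x r "?v w"] Z_after[of r "?v w" x] gv[OF that(1)] that x \<tau>(2)
      by (auto simp: fv ennreal_less_iff)
    \<comment> \<open>\<open>\<Phi>'\<close> puts the growth from \<open>x\<close> during [0,
      \<tau>) in front of a path started at \<open>y\<close> and then applies
      \<open>\<Phi>\<close>.\<close>
    define \<Phi>' where "\<Phi>' \<psi> = \<Phi> (\<lambda>r\<in>{0..s}. if r < \<tau> then x * exp r else \<psi> (r - \<tau>))" for \<psi>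
    have [measurable]: "\<Phi>' \<in> borel_measurable (PiM {0..s - \<tau>} (\<lambda>_. borel))"
      unfolding \<Phi>'_def
    proof (rule measurable_compose[OF measurable_restrict])
      fix r assume r: "r \<in> {0..s}"
      show "(\<lambda>\<psi>. if r < \<tau> then x * exp r else \<psi> (r - \<tau>)) \<in> borel_measurable (PiM {0..s - \<tau>} (\<lambda>_. borel))"
        using r by (cases "r < \<tau>") auto
    qed measurable
    have path: "\<Phi> (\<lambda>r\<in>{0..s}. Z (?v w) x r) = \<Phi>' (\<lambda>r\<in>{0..s - \<tau>}. Z w y r)" if "good w" for w
      unfolding \<Phi>'_def
      by (rule arg_cong[of _ _ \<Phi>]) (auto simp: restrict_def fun_eq_iff Zv[OF that])
    have cnt: "count (Suc k) (?v w) x s \<longleftrightarrow> count k w y (s - \<tau>)" for w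
      using count_Suc_iff[OF s, of "?v w" x k] True \<tau>(2) by (simp add: fv \<tau>(1))
    have "?L = (\<integral>\<^sup>+w. \<Phi>' (\<lambda>r\<in>{0..s - \<tau>}. Z w y r) * indicator {v. count k v y (s - \<tau>)} w * f (Z w y ((s - \<tau>) + t)) \<partial>Om)"
    proof (rule nn_integral_cong_AE, use AE_good in eventually_elim)
      case (elim w)
      have "Z w y (s + t - \<tau>) = Z w y (s - \<tau> + t)" by (rule arg_cong[of _ _ "Z w y"]) simp
      then show ?case using \<tau>s t s by (simp add: path[OF elim] cnt Zv[OF elim] indicator_def)
    qed
    also have "\<dots> = (\<integral>\<^sup>+w. \<Phi>' (\<lambda>r\<in>{0..s - \<tau>}. Z w y r) * indicator {v. count k v y (s - \<tau>)} w * Pn t f (Z w y (s - \<tau>)) \<partial>Om)"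
      using y \<tau>s by (intro Suc.IH) auto
    also have "\<dots> = ?R"
    proof (rule nn_integral_cong_AE, use AE_good in eventually_elim)
      case (elim w)
      show ?case using \<tau>s t s by (simp add: path[OF elim] cnt Zv[OF elim] indicator_def)
    qed
    finally show ?thesis .
  qed
  have [measurable]: "(\<lambda>v. \<Phi> (\<lambda>r\<in>{0..s}. Z v x r)) \<in> borel_measurable Om"
    by (rule measurable_compose[OF path_measurable]) measurable
  have m: "(\<lambda>v. \<Phi> (\<lambda>r\<in>{0..s}. Z v x r) * indicator {v. count (Suc k) v x s} v * g (Z v x r)) \<in> borel_measurable Om"
    if "g \<in> borel_measurable borel" for g :: "real \<Rightarrow> ennreal" and r
    by (intro borel_measurable_times_ennreal borel_measurable_indicator count_Om_sets
        measurable_compose[OF Z_Om_measurable that]) fact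
  show ?case
    unfolding nn_integral_Om_case2[OF m[OF f]] nn_integral_Om_case2[OF m[OF Pn_measurable[OF f]]]
    by (rule nn_integral_cong_AE, rule eventually_mono[OF AE_unif],
        rule nn_integral_cong_AE, rule eventually_mono[OF AE_unif], rule inner) auto
qed

text \<open>The last term is the event of explosion by time \<open>s\<close>, which a general rate
  allows.\<close>

lemma nn_integral_count_split:
  assumes [measurable]: "g \<in> borel_measurable Om"
  shows "(\<integral>\<^sup>+v. g v \<partial>Om) = (\<Sum>k. \<integral>\<^sup>+v. g v * indicator {v. count k v x s} v \<partial>Om)
    + (\<integral>\<^sup>+v. g v * indicator {v. \<forall>k. \<not> count k v x s} v \<partial>Om)"
proof -
  have s: "(\<Sum>k. g v * indicator {v. count k v x s} v) = g v * indicator {v. \<exists>k. count k v x s} v" for v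
  proof (cases "\<exists>k. count k v x s")
    case True
    then obtain k where k: "count k v x s" by blast
    then have "(\<lambda>j. g v * indicator {v. count j v x s} v) = (\<lambda>j. if j = k then g v else 0)"
      by (auto simp: fun_eq_iff indicator_def dest: count_unique)
    then show ?thesis using True sums_single[of k "\<lambda>_. g v"] by (simp add: sums_iff)
  qed simp
  have "(\<Sum>k. \<integral>\<^sup>+v. g v * indicator {v. count k v x s} v \<partial>Om)
      = (\<integral>\<^sup>+v. g v * indicator {v. \<exists>k. count k v x s} v \<partial>Om)"
    by (subst nn_integral_suminf[symmetric]) (simp_all add: s del: ennreal_suminf_cmult)
  moreover have [measurable]: "{v. \<exists>k. count k v x s} \<in> sets Om" "{v. \<forall>k. \<not> count k v x s} \<in> sets Om"
    using measurable_sets_Collect[of "\<lambda>v. \<exists>k. count k v x s" Om]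
      measurable_sets_Collect[of "\<lambda>v. \<forall>k. \<not> count k v x s" Om] by simp_all
  moreover have "(\<integral>\<^sup>+v. g v \<partial>Om) = (\<integral>\<^sup>+v. g v * indicator {v. \<exists>k. count k v x s} v
      + g v * indicator {v. \<forall>k. \<not> count k v x s} v \<partial>Om)"
    by (intro nn_integral_cong) (auto simp: indicator_def)
  ultimately show ?thesis
    by (simp add: nn_integral_add)
qed

lemma markov:
  assumes f [measurable]: "f \<in> borel_measurable borel" and t: "0 \<le> t" and s: "0 \<le> s"
    and [measurable]: "\<Phi> \<in> borel_measurable (PiM {0..s} (\<lambda>_. borel))"
  shows "(\<integral>\<^sup>+v. \<Phi> (\<lambda>r\<in>{0..s}. Z v x r) * f (Z v x (s + t)) \<partial>Om)
    = (\<integral>\<^sup>+v. \<Phi> (\<lambda>r\<in>{0..s}. Z v x r) * Pn t f (Z v x s) \<partial>Om)"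
proof (cases "0 < x")
  case False
  then show ?thesis by (simp add: Z_nonpos Pn_nonpos)
next
  case True
  have [measurable]: "(\<lambda>v. \<Phi> (\<lambda>r\<in>{0..s}. Z v x r)) \<in> borel_measurable Om"
    by (rule measurable_compose[OF path_measurable]) measurable
  \<comment> \<open>After an explosion the path rests at 0, from where \<open>Pn\<close> returns
    \<open>f 0\<close>.\<close>
  have dead: "(\<integral>\<^sup>+v. \<Phi> (\<lambda>r\<in>{0..s}. Z v x r) * f (Z v x (s + t)) * indicator {v. \<forall>k. \<not> count k v x s} v \<partial>Om)
      = (\<integral>\<^sup>+v. \<Phi> (\<lambda>r\<in>{0..s}. Z v x r) * Pn t f (Z v x s) * indicator {v. \<forall>k. \<not> count k v x s} v \<partial>Om)"
  proof (rule nn_integral_cong_AE, use AE_good in eventually_elim)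
    case (elim v)
    show ?case
    proof (cases "\<forall>k. \<not> count k v x s")
      case True
      then have "Z v x s = 0" by (intro Z_dead) auto
      then show ?thesis using Z_absorbed[OF elim, of s "s + t" x] t by (simp add: Pn_nonpos)
    qed simp
  qed
  show ?thesis
    unfolding nn_integral_count_split[of "\<lambda>v. \<Phi> (\<lambda>r\<in>{0..s}. Z v x r) * f (Z v x (s + t))" x s, simplified]
      nn_integral_count_split[of "\<lambda>v. \<Phi> (\<lambda>r\<in>{0..s}. Z v x r) * Pn t f (Z v x s)" x s, simplified]
      dead
    using markov_count[OF f t True s, of \<Phi>] by (simp add: mult_ac)
qed

end

section \<open>Regularity of the semigroup\<close>

lemma measure_Om [simp]: "measure Om UNIV = 1"
  using canon.emeasure_space_1 by (simp add: measure_def)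

context rate
begin

lemma Z_right_seq:
  assumes "good v" "0 \<le> t" "s \<longlonglongrightarrow> t" "\<And>n. t \<le> s n"
  shows "(\<lambda>n. Z v x (s n)) \<longlonglongrightarrow> Z v x t"
proof -
  have "continuous (at t within {t..}) (Z v x)"
    using Z_right_continuous[OF assms(1,2)] by (simp add: continuous_within at_within_Ici_at_right)
  from continuous_within_tendsto_compose'[OF this _ assms(3)] show ?thesis
    using assms(4) by simp
qed

text \<open>The signed counterpart of \<open>Pn\<close> for bounded functions. \<open>Pn\<close>
  serves where sums and integrals are exchanged without integrability conditions.\<close>

definition Pr :: "real \<Rightarrow> (real \<Rightarrow> real) \<Rightarrow> real \<Rightarrow> real" where
  "Pr t f x = (\<integral>v. f (Z v x t) \<partial>Om)"

lemma Pr_measurable [measurable]: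
  assumes [measurable]: "f \<in> borel_measurable borel"
  shows "Pr t f \<in> borel_measurable borel"
proof -
  have "(\<lambda>(x, v). f (Z v x t)) \<in> borel_measurable (borel \<Otimes>\<^sub>M Om)"
    by measurable
  then show ?thesis
    unfolding Pr_def by (rule canon.borel_measurable_lebesgue_integral)
qed

lemma integrable_Z:
  fixes f :: "real \<Rightarrow> real"
  assumes [measurable]: "f \<in> borel_measurable borel" and "\<And>x. \<bar>f x\<bar> \<le> C"
  shows "integrable Om (\<lambda>v. f (Z v x t))"
  by (rule canon.integrable_const_bound[where B = C]) (auto simp: assms)

lemma Pr_bound:
  assumes "f \<in> borel_measurable borel" "\<And>x. \<bar>f x\<bar> \<le> C"
  shows "\<bar>Pr t f x\<bar> \<le> C"
proof -
  have "\<bar>Pr t f x\<bar> \<le> (\<integral>v. \<bar>f (Z v x t)\<bar> \<partial>Om)" unfolding Pr_def by (rule integral_abs_bound)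
  also have "\<dots> \<le> (\<integral>v. C \<partial>Om)"
    using integrable_Z[OF assms] by (intro integral_mono) (auto simp: assms)
  finally show ?thesis by simp
qed

lemma Pn_eq_Pr:
  assumes "f \<in> borel_measurable borel" "\<And>x. 0 \<le> f x" "\<And>x. f x \<le> C"
  shows "Pn t (\<lambda>x. ennreal (f x)) x = ennreal (Pr t f x)"
  unfolding Pn_def Pr_def
  using assms by (intro nn_integral_eq_integral integrable_Z[where C = C]) auto

lemma measure_first:
  assumes "0 \<le> h"
  shows "measure Om {v. first v y \<le> ennreal h} = 1 - exp (H y - H (y * exp h))"
proof -
  let ?c = "exp (H y - H (y * exp h))"
  have m: "{v. v 0 < ?c} \<in> sets Om"
    using measurable_sets_Collect[of "\<lambda>v. v 0 < ?c" Om] by (simp add: pred_def[symmetric])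
  have "emeasure Om {v. v 0 < ?c} = ennreal ?c"
    using nn_integral_Om_scale[of "\<lambda>_. 1" ?c] survival_le_1[OF assms, of y] m
    by (simp add: canon.emeasure_space_1[simplified])
  then have "measure Om {v. v 0 < ?c} = ?c" by (simp add: measure_def)
  moreover have "{v. first v y \<le> ennreal h} = space Om - {v. v 0 < ?c}"
    using assms by (auto simp: first_def survival_inv_le_iff)
  ultimately show ?thesis using canon.prob_compl[OF m] by simp
qed

lemma Pr_right_seq:
  assumes f: "continuous_on UNIV f" and f01: "\<And>x. 0 \<le> f x" "\<And>x. f x \<le> 1"
    and y: "0 < y" and t: "0 \<le> t" and h: "h \<longlonglongrightarrow> 0" "\<And>n. 0 \<le> h n"
  shows "(\<lambda>n. Pr t f (y * exp (h n))) \<longlonglongrightarrow> Pr t f y"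
proof -
  have [measurable]: "f \<in> borel_measurable borel" by (rule borel_measurable_continuous_onI[OF f])
  have b: "\<bar>f x\<bar> \<le> 1" for x using f01[of x] by simp
  have p01: "0 \<le> Pr t f x" "Pr t f x \<le> 1" for x
    using Pr_bound[of f 1 t x] b f01 by (auto simp: Pr_def intro!: integral_nonneg_AE)
  \<comment> \<open>The comparison quantity: the expectation of \<open>f\<close> at time
    \<open>t + h n\<close> from \<open>y\<close>. It converges by right continuity of the paths and
    dominated convergence.\<close>
  define a where "a n = (\<integral>v. f (Z v y (h n + t)) \<partial>Om)" for n
  have a: "a \<longlonglongrightarrow> Pr t f y"
    unfolding a_def Pr_def
  proof (rule integral_dominated_convergence[where w = "\<lambda>_. 1"])
    show "AE v in Om. (\<lambda>n. f (Z v y (h n + t))) \<longlonglongrightarrow> f (Z v y t)"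
      using AE_good
    proof eventually_elim
      case (elim v)
      have "(\<lambda>n. h n + t) \<longlonglongrightarrow> 0 + t" by (intro tendsto_intros h)
      then have "(\<lambda>n. Z v y (h n + t)) \<longlonglongrightarrow> Z v y t"
        using h t by (intro Z_right_seq elim) auto
      then show ?case
        using f by (intro isCont_tendsto_compose[of _ f]) (auto simp: continuous_on_eq_continuous_at)
    qed
  qed (auto simp: b)
  \<comment> \<open>The Markov property at time \<open>h n\<close> with the trivial
    functional.\<close>
  have ma: "a n = (\<integral>v. Pr t f (Z v y (h n)) \<partial>Om)" for n
  proof -
    have "ennreal (a n) = (\<integral>\<^sup>+v. ennreal (f (Z v y (h n + t))) \<partial>Om)"
      unfolding a_def using f01 b by (intro nn_integral_eq_integral[symmetric] integrable_Z[where C = 1]) auto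
    also have "\<dots> = (\<integral>\<^sup>+v. Pn t (\<lambda>x. ennreal (f x)) (Z v y (h n)) \<partial>Om)"
      using markov[of "\<lambda>x. ennreal (f x)" t "h n" "\<lambda>_. 1" y] t h by simp
    also have "\<dots> = (\<integral>\<^sup>+v. ennreal (Pr t f (Z v y (h n))) \<partial>Om)"
      using f01 by (simp add: Pn_eq_Pr[where C = 1])
    also have "\<dots> = ennreal (\<integral>v. Pr t f (Z v y (h n)) \<partial>Om)"
      using p01 Pr_bound[of f 1 t] b by (intro nn_integral_eq_integral integrable_Z[where C = 1]) auto
    finally show ?thesis
      using f01 p01 by (subst (asm) ennreal_inj) (auto simp: a_def intro!: integral_nonneg_AE)
  qed
  \<comment> \<open>Both values of \<open>Pr t f\<close> lie in [0,1] and coincide unless a jump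
    occurs by time \<open>h n\<close>, so the error is at most the probability of that jump.\<close>
  have diff: "\<bar>a n - Pr t f (y * exp (h n))\<bar> \<le> 1 - exp (H y - H (y * exp (h n)))" for n
  proof -
    have [measurable]: "{v. first v y \<le> ennreal (h n)} \<in> sets Om"
      using measurable_sets_Collect[of "\<lambda>v. first v y \<le> ennreal (h n)" Om] by (simp add: pred_def[symmetric])
    have i: "integrable Om (\<lambda>v. Pr t f (Z v y (h n)))"
      using Pr_bound[of f 1 t] b by (intro integrable_Z[where C = 1]) auto
    have "a n - Pr t f (y * exp (h n)) = (\<integral>v. Pr t f (Z v y (h n)) - Pr t f (y * exp (h n)) \<partial>Om)"
      unfolding ma using i by simp
    then have "\<bar>a n - Pr t f (y * exp (h n))\<bar> \<le> (\<integral>v. \<bar>Pr t f (Z v y (h n)) - Pr t f (y * exp (h n))\<bar> \<partial>Om)"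
      by (simp only: integral_abs_bound)
    also have "\<dots> \<le> (\<integral>v. indicator {v. first v y \<le> ennreal (h n)} v \<partial>Om)"
    proof (rule integral_mono)
      show "integrable Om (\<lambda>v. \<bar>Pr t f (Z v y (h n)) - Pr t f (y * exp (h n))\<bar>)"
        by (intro integrable_abs Bochner_Integration.integrable_diff i canon.integrable_const)
      show "integrable Om (indicator {v. first v y \<le> ennreal (h n)} :: _ \<Rightarrow> real)"
        by (rule canon.integrable_const_bound[where B = 1]) (auto simp: indicator_def)
      fix v
      show "\<bar>Pr t f (Z v y (h n)) - Pr t f (y * exp (h n))\<bar> \<le> indicator {v. first v y \<le> ennreal (h n)} v"
      proof (cases "first v y \<le> ennreal (h n)")
        case True
        then show ?thesis using p01[of "Z v y (h n)"] p01[of "y * exp (h n)"] by (simp add: abs_le_iff)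
      next
        case False
        then have "Z v y (h n) = y * exp (h n)" by (intro Z_before y) simp
        then show ?thesis by simp
      qed
    qed
    also have "\<dots> = 1 - exp (H y - H (y * exp (h n)))"
      by (simp add: measure_first h)
    finally show ?thesis .
  qed
  have "(\<lambda>n. 1 - exp (H y - H (y * exp (h n)))) \<longlonglongrightarrow> 1 - exp (H y - H (y * exp 0))"
    by (intro tendsto_intros H_tendsto h)
  then have "(\<lambda>n. 1 - exp (H y - H (y * exp (h n)))) \<longlonglongrightarrow> 0" by simp
  then have "(\<lambda>n. a n - Pr t f (y * exp (h n))) \<longlonglongrightarrow> 0"
    by (rule Lim_null_comparison[rotated]) (unfold real_norm_def, intro always_eventually allI diff)
  from tendsto_diff[OF a this] show ?thesis by simp
qed

end

section \<open>Transfer to the given probability space and its filtration\<close>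

locale cell_setup = rate R + prob_space M
  for R and M :: "'w measure" +
  fixes U :: "nat \<Rightarrow> 'w \<Rightarrow> real"
  assumes driving: "driving_sequence M U"
begin

definition V :: "'w \<Rightarrow> nat \<Rightarrow> real" where "V \<omega> i = U (Suc i) \<omega>"

abbreviation X :: "real \<Rightarrow> real \<Rightarrow> 'w \<Rightarrow> real" where "X x t \<omega> \<equiv> Z (V \<omega>) x t"

lemma cell_process_eq: "cell_process R U x t \<omega> = X x t \<omega>"
  unfolding cell_process_def Z_def
  by (rule cell_path_cong) (auto simp: V_def split: nat.split)

lemma V_good: "\<omega> \<in> space M \<Longrightarrow> good (V \<omega>)"
  using driving by (auto simp: driving_sequence_def good_def V_def)

lemma V_jprod: "\<omega> \<in> space M \<Longrightarrow> jprod (V \<omega>) \<longlonglongrightarrow> 0"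
proof -
  assume "\<omega> \<in> space M"
  moreover have "jump_prod (\<lambda>i. U i \<omega>) = jprod (V \<omega>)"
    by (rule ext, rule jump_prod_cong) (auto simp: V_def split: nat.split)
  moreover have "\<forall>\<omega>\<in>space M. jump_prod (\<lambda>i. U i \<omega>) \<longlonglongrightarrow> 0"
    using driving unfolding driving_sequence_def by blast
  ultimately show ?thesis by metis
qed

lemma V_component [measurable]: "(\<lambda>\<omega>. V \<omega> i) \<in> borel_measurable M"
  using driving unfolding driving_sequence_def V_def
  by (auto simp: indep_vars_def2)

lemma V_measurable [measurable]: "V \<in> measurable M Om"
  by (rule measurable_into_Om) measurable

text \<open>Independence and the marginals give the product law over the indices from 1 on;
  reindexing along \<open>Suc\<close> moves it to all natural numbers.\<close>

lemma distr_V: "distr M Om V = Om"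
proof -
  let ?K = "{1..} :: nat set"
  have rv: "\<And>i. i \<in> ?K \<Longrightarrow> random_variable borel (U i)" and ind: "indep_vars (\<lambda>_. borel) U ?K"
    and d: "\<And>i. i \<in> ?K \<Longrightarrow> distr M borel (U i) = unif"
    using driving unfolding driving_sequence_def unif_def by (auto simp: indep_vars_def2)
  have "distr M (\<Pi>\<^sub>M i\<in>?K. borel) (\<lambda>\<omega>. \<lambda>i\<in>?K. U i \<omega>) = (\<Pi>\<^sub>M i\<in>?K. distr M borel (U i))"
    using ind rv by (subst (asm) indep_vars_iff_distr_eq_PiM') auto
  also have "\<dots> = (\<Pi>\<^sub>M i\<in>?K. unif)" by (rule PiM_cong) (auto simp: d)
  finally have K: "distr M (\<Pi>\<^sub>M i\<in>?K. borel) (\<lambda>\<omega>. \<lambda>i\<in>?K. U i \<omega>) = (\<Pi>\<^sub>M i\<in>?K. unif)" .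
  have m: "(\<lambda>\<omega>. \<lambda>i\<in>?K. U i \<omega>) \<in> measurable M (\<Pi>\<^sub>M i\<in>?K. borel)"
    by (intro measurable_restrict rv)
  have m': "(\<lambda>\<psi>. \<lambda>n\<in>UNIV. \<psi> (Suc n)) \<in> measurable (\<Pi>\<^sub>M i\<in>?K. borel) Om"
  proof (rule measurable_into_Om)
    show "(\<lambda>\<psi>. (\<lambda>n\<in>UNIV. \<psi> (Suc n)) i) \<in> borel_measurable (\<Pi>\<^sub>M i\<in>?K. borel)" for i
      using measurable_component_singleton[of "Suc i" ?K "\<lambda>_. borel"] by simp
  qed
  have "Om = distr (\<Pi>\<^sub>M i\<in>?K. unif) Om (\<lambda>\<psi>. \<lambda>n\<in>UNIV. \<psi> (Suc n))"
    using distr_PiM_reindex[of ?K "\<lambda>_. unif" Suc UNIV] by (simp add: unif.prob_space_axioms)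
  also have "\<dots> = distr M Om ((\<lambda>\<psi>. \<lambda>n\<in>UNIV. \<psi> (Suc n)) \<circ> (\<lambda>\<omega>. \<lambda>i\<in>?K. U i \<omega>))"
    unfolding K[symmetric] by (rule distr_distr[OF m' m])
  also have "(\<lambda>\<psi>. \<lambda>n\<in>UNIV. \<psi> (Suc n)) \<circ> (\<lambda>\<omega>. \<lambda>i\<in>?K. U i \<omega>) = V"
    by (auto simp: fun_eq_iff V_def)
  finally show ?thesis by simp
qed

lemma nn_integral_V: "g \<in> borel_measurable Om \<Longrightarrow> (\<integral>\<^sup>+\<omega>. g (V \<omega>) \<partial>M) = (\<integral>\<^sup>+v. g v \<partial>Om)"
  using nn_integral_distr[OF V_measurable, of g] by (simp add: distr_V)

lemma integral_V:
  fixes g :: "_ \<Rightarrow> real"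
  shows "g \<in> borel_measurable Om \<Longrightarrow> (\<integral>\<omega>. g (V \<omega>) \<partial>M) = (\<integral>v. g v \<partial>Om)"
  using integral_distr[OF V_measurable, of g] by (simp add: distr_V)

lemma Pr_eq_X:
  assumes [measurable]: "f \<in> borel_measurable borel"
  shows "(\<integral>\<omega>. f (X x t \<omega>) \<partial>M) = Pr t f x"
  unfolding Pr_def by (rule integral_V) measurable

abbreviation F :: "real \<Rightarrow> ennreal \<Rightarrow> 'w measure" where "F x \<equiv> natural_filtration M (X x)"

lemma space_F [simp]: "space (F x t) = space M"
  unfolding natural_filtration_def by (rule space_measure_of) auto

lemma sets_F: "sets (F x t) = sigma_sets (space M) {X x s -` B \<inter> space M | s B. 0 \<le> s \<and> ennreal s \<le> t \<and> B \<in> sets borel}"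
  unfolding natural_filtration_def by (rule sets_measure_of) auto

lemma X_measurable [measurable]: "X x t \<in> borel_measurable M"
  by measurable

lemma sets_F_subset: "sets (F x t) \<subseteq> sets M"
  unfolding sets_F by (intro sets.sigma_sets_subset) auto

lemma X_adapted: "0 \<le> s \<Longrightarrow> ennreal s \<le> t \<Longrightarrow> X x s \<in> borel_measurable (F x t)"
  by (rule measurableI) (auto simp: sets_F intro!: sigma_sets.Basic)

lemma sets_F_mono: "s \<le> t \<Longrightarrow> sets (F x s) \<subseteq> sets (F x t)"
  using filtration_natural_filtration[of M "X x"] unfolding filtration_def by blast

text \<open>The generators of the filtration at time \<open>s\<close> are preimages of sets of paths
  under the restricted path map, hence so is every event. This gives the indicator of
  \<open>A\<close> the form of a functional \<open>\<Phi>\<close> in \<open>markov\<close>.\<close>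

lemma F_path:
  assumes s: "0 \<le> s" and A: "A \<in> sets (F x (ennreal s))"
  obtains \<Gamma> where "\<Gamma> \<in> sets (PiM {0..s} (\<lambda>_. borel))" "A = {\<omega> \<in> space M. (\<lambda>r\<in>{0..s}. X x r \<omega>) \<in> \<Gamma>}"
proof -
  let ?N = "PiM {0..s} (\<lambda>_. borel :: real measure)" and ?p = "\<lambda>\<omega>. \<lambda>r\<in>{0..s}. X x r \<omega>"
  let ?W = "vimage_algebra (space M) ?p ?N"
  have p: "?p \<in> space M \<rightarrow> space ?N" by (auto simp: space_PiM)
  have "sigma_sets (space ?W) {X x r -` B \<inter> space M | r B. 0 \<le> r \<and> ennreal r \<le> ennreal s \<and> B \<in> sets borel} \<subseteq> sets ?W"
  proof (intro sets.sigma_sets_subset subsetI)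
    fix C assume "C \<in> {X x r -` B \<inter> space M | r B. 0 \<le> r \<and> ennreal r \<le> ennreal s \<and> B \<in> sets borel}"
    then obtain r B where C: "C = X x r -` B \<inter> space M" "r \<in> {0..s}" "B \<in> sets borel"
      using s by (auto simp: ennreal_le_iff)
    have "(\<lambda>\<psi>. \<psi> r) \<in> borel_measurable ?N" using C by measurable
    from measurable_sets[OF this C(3)] have "(\<lambda>\<psi>. \<psi> r) -` B \<inter> space ?N \<in> sets ?N" .
    then have "?p -` ((\<lambda>\<psi>. \<psi> r) -` B \<inter> space ?N) \<inter> space M \<in> sets ?W"
      by (rule in_vimage_algebra)
    moreover have "?p -` ((\<lambda>\<psi>. \<psi> r) -` B \<inter> space ?N) \<inter> space M = C"
      using C(2) p by (auto simp: C(1))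
    ultimately show "C \<in> sets ?W" by simp
  qed
  then have "A \<in> sets ?W" using A by (auto simp: sets_F)
  then obtain \<Gamma> where "\<Gamma> \<in> sets ?N" "A = ?p -` \<Gamma> \<inter> space M"
    unfolding sets_vimage_algebra2[OF p] by blast
  then show ?thesis by (intro that[of \<Gamma>]) auto
qed

lemma markov_F:
  assumes f [measurable]: "f \<in> borel_measurable borel" and t: "0 \<le> t" and s: "0 \<le> s"
    and A: "A \<in> sets (F x (ennreal s))"
  shows "(\<integral>\<^sup>+\<omega>. indicator A \<omega> * f (X x (s + t) \<omega>) \<partial>M) = (\<integral>\<^sup>+\<omega>. indicator A \<omega> * Pn t f (X x s \<omega>) \<partial>M)"
proof -
  obtain \<Gamma> where [measurable]: "\<Gamma> \<in> sets (PiM {0..s} (\<lambda>_. borel))"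
    and eq: "A = {\<omega> \<in> space M. (\<lambda>r\<in>{0..s}. X x r \<omega>) \<in> \<Gamma>}"
    using F_path[OF s A] .
  have ind: "indicator A \<omega> = (indicator \<Gamma> (\<lambda>r\<in>{0..s}. X x r \<omega>) :: ennreal)" if "\<omega> \<in> space M" for \<omega>
    using that by (auto simp: eq indicator_def)
  have m: "(\<lambda>v. indicator \<Gamma> (\<lambda>r\<in>{0..s}. Z v x r) * g (Z v x r')) \<in> borel_measurable Om"
    if "g \<in> borel_measurable borel" for g :: "real \<Rightarrow> ennreal" and r'
    by (intro borel_measurable_times_ennreal measurable_compose[OF path_measurable]
        measurable_compose[OF Z_Om_measurable that]) measurable
  have "(\<integral>\<^sup>+\<omega>. indicator A \<omega> * f (X x (s + t) \<omega>) \<partial>M)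
      = (\<integral>\<^sup>+\<omega>. indicator \<Gamma> (\<lambda>r\<in>{0..s}. X x r \<omega>) * f (X x (s + t) \<omega>) \<partial>M)"
    by (intro nn_integral_cong) (simp add: ind)
  also have "\<dots> = (\<integral>\<^sup>+v. indicator \<Gamma> (\<lambda>r\<in>{0..s}. Z v x r) * f (Z v x (s + t)) \<partial>Om)"
    by (rule nn_integral_V[OF m[OF f]])
  also have "\<dots> = (\<integral>\<^sup>+v. indicator \<Gamma> (\<lambda>r\<in>{0..s}. Z v x r) * Pn t f (Z v x s) \<partial>Om)"
    by (rule markov[OF f t s]) measurable
  also have "\<dots> = (\<integral>\<^sup>+\<omega>. indicator \<Gamma> (\<lambda>r\<in>{0..s}. X x r \<omega>) * Pn t f (X x s \<omega>) \<partial>M)"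
    by (rule nn_integral_V[symmetric, OF m[OF Pn_measurable[OF f]]])
  also have "\<dots> = (\<integral>\<^sup>+\<omega>. indicator A \<omega> * Pn t f (X x s \<omega>) \<partial>M)"
    by (intro nn_integral_cong) (simp add: ind)
  finally show ?thesis .
qed

end

section \<open>The strong Markov property\<close>

text \<open>Only the values on the half-line are prescribed. The extension by 0 is Borel on the
  whole line, and composing with the nonnegative process gives the same result.\<close>

definition half_ext :: "(real \<Rightarrow> real) \<Rightarrow> real \<Rightarrow> real" where
  "half_ext f x = (if 0 \<le> x then f x else 0)"

lemma half_ext_measurable:
  assumes "f \<in> borel_measurable (restrict_space borel {0..})"
  shows "half_ext f \<in> borel_measurable borel"
proof -
  have "(\<lambda>x. indicator {0..} x *\<^sub>R f x) \<in> borel_measurable borel"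
    using assms by (subst (asm) borel_measurable_restrict_space_iff) auto
  moreover have "half_ext f = (\<lambda>x. indicator {0..} x *\<^sub>R f x)"
    by (auto simp: half_ext_def fun_eq_iff)
  ultimately show ?thesis by simp
qed

lemma bounded_borel_half_line_ext: "bounded_borel_half_line f \<Longrightarrow> half_ext f \<in> borel_measurable borel"
  by (rule half_ext_measurable) (simp add: bounded_borel_half_line_def)

lemma half_ext_bound:
  assumes "bounded_borel_half_line f"
  obtains C where "\<And>x. \<bar>half_ext f x\<bar> \<le> C"
proof -
  obtain C where "\<forall>y\<in>f ` {0..}. norm y \<le> C"
    using assms by (auto simp: bounded_borel_half_line_def bounded_iff)
  then have "\<bar>half_ext f x\<bar> \<le> max C 0" for x
    by (auto simp: half_ext_def le_max_iff_disj)
  then show ?thesis by (rule that)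
qed

text \<open>The smallest multiple of 2^(-n) strictly above \<open>a\<close>, also when
  \<open>a\<close> is itself such a multiple: the approximations then converge along
  \<open>at_right a\<close>.\<close>

definition dyadic_up :: "nat \<Rightarrow> real \<Rightarrow> real" where
  "dyadic_up n a = (real_of_int \<lfloor>2 ^ n * a\<rfloor> + 1) / 2 ^ n"

lemma dyadic_up_gt: "a < dyadic_up n a"
  by (simp add: dyadic_up_def pos_less_divide_eq mult.commute)

lemma dyadic_up_le: "dyadic_up n a \<le> a + (1 / 2) ^ n"
proof -
  have "real_of_int \<lfloor>2 ^ n * a\<rfloor> + 1 \<le> 2 ^ n * (a + (1 / 2) ^ n)"
    by (simp add: distrib_left power_one_over)
  then show ?thesis by (simp add: dyadic_up_def pos_divide_le_eq mult.commute)
qed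

lemma dyadic_up_tendsto: "(\<lambda>n. dyadic_up n a) \<longlonglongrightarrow> a"
proof (rule tendsto_sandwich[of "\<lambda>_. a" _ _ "\<lambda>n. a + (1 / 2) ^ n"])
  show "(\<lambda>n. a + (1 / 2) ^ n) \<longlonglongrightarrow> a"
    using tendsto_add[OF tendsto_const LIMSEQ_realpow_zero[of "1 / 2 :: real"], of a] by simp
qed (auto intro!: always_eventually dyadic_up_le less_imp_le[OF dyadic_up_gt])

context cell_setup
begin

context
  fixes x :: real and \<tau> :: "'w \<Rightarrow> ennreal"
  assumes x: "0 \<le> x" and \<tau>: "stopping_time (F x) \<tau>"
begin

interpretation filtration "space M" "F x"
  by (rule filtration_natural_filtration)

abbreviation "T \<omega> \<equiv> enn2real (\<tau> \<omega>)"

lemma \<tau>_measurable [measurable]: "\<tau> \<in> borel_measurable M"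
  by (rule measurable_stopping_time[OF \<tau> sets_F_subset]) simp

lemma sets_\<tau>_le: "{\<omega> \<in> space M. \<tau> \<omega> \<le> t} \<in> sets (F x t)"
  using stopping_timeD[OF \<tau>, of t] by (simp add: pred_def)

lemma sets_\<tau>_less: "{\<omega> \<in> space M. \<tau> \<omega> < t} \<in> sets (F x t)"
  using stopping_time_less_const[OF \<tau>, of t] by (simp add: pred_def)

lemma pre_sigma_subset: "sets (pre_sigma \<tau>) \<subseteq> sets (F x top)"
proof
  fix A assume "A \<in> sets (pre_sigma \<tau>)"
  from sets_pre_sigmaD[OF \<tau> this, of top] show "A \<in> sets (F x top)" by simp
qed

text \<open>The approximated time takes countably many values \<open>q j\<close>. On the piece
  \<open>C j\<close> it is the constant \<open>q j\<close>, and \<open>C j\<close> is known at that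
  time, so the Markov property at fixed times applies piece by piece.\<close>

lemma markov_dyadic:
  assumes A: "A \<in> sets (pre_sigma \<tau>)" and f [measurable]: "f \<in> borel_measurable borel" and t: "0 \<le> t"
  shows "(\<integral>\<^sup>+\<omega>. indicator {\<omega>\<in>A. \<tau> \<omega> < \<infinity>} \<omega> * f (X x (dyadic_up n (T \<omega>) + t) \<omega>) \<partial>M)
    = (\<integral>\<^sup>+\<omega>. indicator {\<omega>\<in>A. \<tau> \<omega> < \<infinity>} \<omega> * Pn t f (X x (dyadic_up n (T \<omega>)) \<omega>) \<partial>M)"
proof -
  have AM: "A \<in> sets M" using A pre_sigma_subset sets_F_subset by blast
  define q where "q j = real (Suc j) / 2 ^ n" for j :: nat
  define C where "C j = {\<omega>\<in>A. \<lfloor>2 ^ n * T \<omega>\<rfloor> = int j \<and> \<tau> \<omega> < \<infinity>}" for j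
  have q0: "0 \<le> q j" for j by (simp add: q_def)
  have dq: "dyadic_up n (T \<omega>) = q j" if "\<omega> \<in> C j" for \<omega> j
    using that by (simp add: C_def dyadic_up_def q_def add.commute)
  \<comment> \<open>Expressed by comparisons of \<open>\<tau>\<close> with constants, the piece is
    seen to belong to the filtration at \<open>q j\<close>.\<close>
  have Ceq: "C j = {\<omega>\<in>A. \<tau> \<omega> \<le> ennreal (q j)} \<inter> {\<omega>\<in>space M. \<tau> \<omega> < ennreal (q j)}
      - {\<omega>\<in>space M. \<tau> \<omega> < ennreal (real j / 2 ^ n)}" for j
  proof (rule set_eqI)
    fix \<omega>
    have *: "(\<lfloor>2 ^ n * T \<omega>\<rfloor> = int j) = (real j / 2 ^ n \<le> T \<omega> \<and> T \<omega> < q j)"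
      by (simp add: floor_eq_iff q_def pos_divide_le_eq pos_less_divide_eq mult.commute add.commute)
    show "\<omega> \<in> C j \<longleftrightarrow> \<omega> \<in> {\<omega>\<in>A. \<tau> \<omega> \<le> ennreal (q j)} \<inter> {\<omega>\<in>space M. \<tau> \<omega> < ennreal (q j)}
      - {\<omega>\<in>space M. \<tau> \<omega> < ennreal (real j / 2 ^ n)}"
    proof (cases "\<tau> \<omega>")
      case (real r)
      then show ?thesis using * q0[of j] sets.sets_into_space[OF AM]
        by (auto simp: C_def ennreal_less_iff ennreal_le_iff)
    next
      case top
      then show ?thesis by (auto simp: C_def)
    qed
  qed
  have CF: "C j \<in> sets (F x (ennreal (q j)))" for j
  proof -
    have "real j / 2 ^ n \<le> q j" by (simp add: q_def divide_right_mono)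
    then have "{\<omega>\<in>space M. \<tau> \<omega> < ennreal (real j / 2 ^ n)} \<in> sets (F x (ennreal (q j)))"
      using sets_\<tau>_less sets_F_mono[OF ennreal_leI] by blast
    then show ?thesis
      unfolding Ceq using sets_pre_sigmaD[OF \<tau> A] sets_\<tau>_less by (intro sets.Diff sets.Int) auto
  qed
  have CM [measurable]: "C j \<in> sets M" for j using CF sets_F_subset by blast
  have sumC: "(\<Sum>j. indicator (C j) \<omega> * g (q j)) = indicator {\<omega>\<in>A. \<tau> \<omega> < \<infinity>} \<omega> * g (dyadic_up n (T \<omega>))"
    for g :: "real \<Rightarrow> ennreal" and \<omega>
  proof (cases "\<omega> \<in> {\<omega>\<in>A. \<tau> \<omega> < \<infinity>}")
    case True
    define k where "k = nat \<lfloor>2 ^ n * T \<omega>\<rfloor>"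
    have k: "\<omega> \<in> C k" using True by (simp add: C_def k_def)
    have "(\<lambda>j. indicator (C j) \<omega> * g (q j)) = (\<lambda>j. if j = k then g (q j) else 0)"
      using k by (auto simp: C_def fun_eq_iff indicator_def)
    then have "(\<Sum>j. indicator (C j) \<omega> * g (q j)) = g (q k)"
      using sums_single[of k "\<lambda>j. g (q j)"] by (simp add: sums_iff)
    then show ?thesis using True dq[OF k] by simp
  next
    case False
    then have "\<omega> \<notin> C j" for j by (auto simp: C_def)
    then show ?thesis using False by simp
  qed
  have "(\<integral>\<^sup>+\<omega>. indicator {\<omega>\<in>A. \<tau> \<omega> < \<infinity>} \<omega> * f (X x (dyadic_up n (T \<omega>) + t) \<omega>) \<partial>M)
      = (\<integral>\<^sup>+\<omega>. (\<Sum>j. indicator (C j) \<omega> * f (X x (q j + t) \<omega>)) \<partial>M)"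
    using sumC[of _ "\<lambda>r. f (X x (r + t) _)"] by simp
  also have "\<dots> = (\<Sum>j. \<integral>\<^sup>+\<omega>. indicator (C j) \<omega> * f (X x (q j + t) \<omega>) \<partial>M)"
    by (rule nn_integral_suminf) measurable
  also have "\<dots> = (\<Sum>j. \<integral>\<^sup>+\<omega>. indicator (C j) \<omega> * Pn t f (X x (q j) \<omega>) \<partial>M)"
    by (intro suminf_cong markov_F f t q0 CF)
  also have "\<dots> = (\<integral>\<^sup>+\<omega>. (\<Sum>j. indicator (C j) \<omega> * Pn t f (X x (q j) \<omega>)) \<partial>M)"
    by (rule nn_integral_suminf[symmetric]) measurable
  also have "\<dots> = (\<integral>\<^sup>+\<omega>. indicator {\<omega>\<in>A. \<tau> \<omega> < \<infinity>} \<omega> * Pn t f (X x (dyadic_up n (T \<omega>)) \<omega>) \<partial>M)"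
    using sumC[of _ "\<lambda>r. Pn t f (X x r _)"] by simp
  finally show ?thesis .
qed

text \<open>Right after \<open>a\<close> the path either rests at 0 or grows exponentially without a
  jump, so right continuity of \<open>Pr t f\<close> along the flow suffices.\<close>

lemma Pr_path_right:
  assumes f: "continuous_on UNIV f" and f01: "\<And>x. 0 \<le> f x" "\<And>x. f x \<le> 1"
    and t: "0 \<le> t" and \<omega>: "\<omega> \<in> space M" and a: "0 \<le> a"
  shows "(\<lambda>n. Pr t f (X x (dyadic_up n a) \<omega>)) \<longlonglongrightarrow> Pr t f (X x a \<omega>)"
proof (cases "X x a \<omega> = 0")
  case True
  then have "X x (dyadic_up n a) \<omega> = 0" for n
    using Z_absorbed[OF V_good[OF \<omega>], of a "dyadic_up n a" x] dyadic_up_gt[of a n] by simp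
  then show ?thesis using True by simp
next
  case False
  then have pos: "0 < X x a \<omega>" using Z_nonneg[OF V_good[OF \<omega>], of x a] by simp
  then have "0 < x" using Z_nonpos by (metis less_irrefl not_less)
  from Z_right_exp[OF V_good[OF \<omega>] this a pos]
  have "eventually (\<lambda>s. X x s \<omega> = X x a \<omega> * exp (s - a)) (at_right a)" .
  moreover have "filterlim (\<lambda>n. dyadic_up n a) (at_right a) sequentially"
    using dyadic_up_tendsto[of a] dyadic_up_gt[of a]
    by (auto simp: filterlim_at less_imp_neq[THEN not_sym] intro!: always_eventually)
  ultimately have "eventually (\<lambda>n. X x (dyadic_up n a) \<omega> = X x a \<omega> * exp (dyadic_up n a - a)) sequentially"
    by (rule eventually_compose_filterlim)
  then have ev: "eventually (\<lambda>n. Pr t f (X x a \<omega> * exp (dyadic_up n a - a)) = Pr t f (X x (dyadic_up n a) \<omega>)) sequentially"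
    by eventually_elim simp
  have "(\<lambda>n. dyadic_up n a - a) \<longlonglongrightarrow> a - a" by (intro tendsto_intros dyadic_up_tendsto)
  then have "(\<lambda>n. Pr t f (X x a \<omega> * exp (dyadic_up n a - a))) \<longlonglongrightarrow> Pr t f (X x a \<omega>)"
    using dyadic_up_gt[of a] by (intro Pr_right_seq f f01 pos t) (auto simp: less_imp_le)
  then show ?thesis using ev by (rule Lim_transform_eventually)
qed

text \<open>Both sides of \<open>markov_dyadic\<close> pass to the limit by dominated convergence:
  the left one by continuity of \<open>f\<close> and right continuity of the path, the right one by
  \<open>Pr_path_right\<close>.\<close>

lemma markov_stopping_continuous:
  assumes A: "A \<in> sets (pre_sigma \<tau>)" and t: "0 \<le> t"
    and f: "continuous_on UNIV f" and f01: "\<And>x. 0 \<le> f x" "\<And>x. f x \<le> (1::real)"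
  shows "(\<integral>\<^sup>+\<omega>. indicator {\<omega>\<in>A. \<tau> \<omega> < \<infinity>} \<omega> * ennreal (f (X x (T \<omega> + t) \<omega>)) \<partial>M)
    = (\<integral>\<^sup>+\<omega>. indicator {\<omega>\<in>A. \<tau> \<omega> < \<infinity>} \<omega> * ennreal (Pr t f (X x (T \<omega>) \<omega>)) \<partial>M)"
proof -
  have [measurable]: "f \<in> borel_measurable borel" by (rule borel_measurable_continuous_onI[OF f])
  have [measurable]: "A \<in> sets M" using A pre_sigma_subset sets_F_subset by blast
  have b: "\<bar>f x\<bar> \<le> 1" for x using f01[of x] by simp
  have p1: "Pr t f x \<le> 1" for x using Pr_bound[of f 1 t x] b by simp
  let ?I = "\<lambda>\<omega>. indicator {\<omega>\<in>A. \<tau> \<omega> < \<infinity>} \<omega> :: ennreal"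
  have [measurable]: "(\<lambda>\<omega>. dyadic_up n (T \<omega>)) \<in> borel_measurable M" for n
    unfolding dyadic_up_def by measurable
  have "(\<lambda>n. \<integral>\<^sup>+\<omega>. ?I \<omega> * ennreal (f (X x (dyadic_up n (T \<omega>) + t) \<omega>)) \<partial>M)
      \<longlonglongrightarrow> (\<integral>\<^sup>+\<omega>. ?I \<omega> * ennreal (f (X x (T \<omega> + t) \<omega>)) \<partial>M)"
  proof (rule nn_integral_dominated_convergence[where w = "\<lambda>_. 1"])
    show "AE \<omega> in M. ?I \<omega> * ennreal (f (X x (dyadic_up n (T \<omega>) + t) \<omega>)) \<le> 1" for n
      using f01 by (auto simp: indicator_def)
    show "AE \<omega> in M. (\<lambda>n. ?I \<omega> * ennreal (f (X x (dyadic_up n (T \<omega>) + t) \<omega>))) \<longlonglongrightarrow> ?I \<omega> * ennreal (f (X x (T \<omega> + t) \<omega>))"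
    proof (rule AE_I2)
      fix \<omega> assume \<omega>: "\<omega> \<in> space M"
      have "(\<lambda>n. X x (dyadic_up n (T \<omega>) + t) \<omega>) \<longlonglongrightarrow> X x (T \<omega> + t) \<omega>"
        using t dyadic_up_gt[of "T \<omega>"]
        by (intro Z_right_seq V_good \<omega> tendsto_intros dyadic_up_tendsto) (auto simp: less_imp_le)
      then have "(\<lambda>n. f (X x (dyadic_up n (T \<omega>) + t) \<omega>)) \<longlonglongrightarrow> f (X x (T \<omega> + t) \<omega>)"
        using f by (intro isCont_tendsto_compose[of _ f]) (auto simp: continuous_on_eq_continuous_at)
      then show "(\<lambda>n. ?I \<omega> * ennreal (f (X x (dyadic_up n (T \<omega>) + t) \<omega>))) \<longlonglongrightarrow> ?I \<omega> * ennreal (f (X x (T \<omega> + t) \<omega>))"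
        by (cases "\<omega> \<in> A \<and> \<tau> \<omega> < \<infinity>") (auto intro: tendsto_ennrealI)
    qed
  qed (auto simp: emeasure_space_1)
  moreover have "(\<lambda>n. \<integral>\<^sup>+\<omega>. ?I \<omega> * ennreal (Pr t f (X x (dyadic_up n (T \<omega>)) \<omega>)) \<partial>M)
      \<longlonglongrightarrow> (\<integral>\<^sup>+\<omega>. ?I \<omega> * ennreal (Pr t f (X x (T \<omega>) \<omega>)) \<partial>M)"
  proof (rule nn_integral_dominated_convergence[where w = "\<lambda>_. 1"])
    show "AE \<omega> in M. ?I \<omega> * ennreal (Pr t f (X x (dyadic_up n (T \<omega>)) \<omega>)) \<le> 1" for n
      using p1 by (auto simp: indicator_def)
    show "AE \<omega> in M. (\<lambda>n. ?I \<omega> * ennreal (Pr t f (X x (dyadic_up n (T \<omega>)) \<omega>))) \<longlonglongrightarrow> ?I \<omega> * ennreal (Pr t f (X x (T \<omega>) \<omega>))"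
    proof (rule AE_I2)
      fix \<omega> assume \<omega>: "\<omega> \<in> space M"
      have "(\<lambda>n. Pr t f (X x (dyadic_up n (T \<omega>)) \<omega>)) \<longlonglongrightarrow> Pr t f (X x (T \<omega>) \<omega>)"
        by (intro Pr_path_right f f01 t \<omega>) simp
      then show "(\<lambda>n. ?I \<omega> * ennreal (Pr t f (X x (dyadic_up n (T \<omega>)) \<omega>))) \<longlonglongrightarrow> ?I \<omega> * ennreal (Pr t f (X x (T \<omega>) \<omega>))"
        by (cases "\<omega> \<in> A \<and> \<tau> \<omega> < \<infinity>") (auto intro: tendsto_ennrealI)
    qed
  qed (auto simp: emeasure_space_1)
  moreover have "(\<integral>\<^sup>+\<omega>. ?I \<omega> * ennreal (f (X x (dyadic_up n (T \<omega>) + t) \<omega>)) \<partial>M)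
      = (\<integral>\<^sup>+\<omega>. ?I \<omega> * ennreal (Pr t f (X x (dyadic_up n (T \<omega>)) \<omega>)) \<partial>M)" for n
    using markov_dyadic[OF A, of "\<lambda>x. ennreal (f x)" t n] t f01 by (simp add: Pn_eq_Pr[where C = 1])
  ultimately show ?thesis using LIMSEQ_unique by simp
qed

text \<open>Passage from continuous to bounded Borel functions. On \<open>A\<close> with
  \<open>\<tau>\<close> finite both sides are integrals of \<open>f\<close> against finite measures
  on the line, and these agree on rays because the indicator of an open ray is a limit of continuous
  functions with values in [0,1].\<close>

lemma markov_stopping:
  assumes A: "A \<in> sets (pre_sigma \<tau>)" and t: "0 \<le> t"
    and f [measurable]: "f \<in> borel_measurable borel" and fb: "\<And>x. \<bar>f x\<bar> \<le> (C::real)"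
  shows "(\<integral>\<omega>. indicator {\<omega>\<in>A. \<tau> \<omega> < \<infinity>} \<omega> * f (X x (T \<omega> + t) \<omega>) \<partial>M)
    = (\<integral>\<omega>. indicator {\<omega>\<in>A. \<tau> \<omega> < \<infinity>} \<omega> * Pr t f (X x (T \<omega>) \<omega>) \<partial>M)"
proof -
  have [measurable]: "A \<in> sets M" using A pre_sigma_subset sets_F_subset by blast
  let ?A = "{\<omega>\<in>A. \<tau> \<omega> < \<infinity>}"
  have A_eq: "?A = {\<omega>\<in>space M. \<omega> \<in> A \<and> \<tau> \<omega> < \<infinity>}"
    using sets.sets_into_space[OF \<open>A \<in> sets M\<close>] by auto
  have [measurable]: "?A \<in> sets M" unfolding A_eq by measurable
  define MA where "MA = density M (indicator ?A)"
  have MA_real: "MA = density M (\<lambda>\<omega>. ennreal (indicator ?A \<omega>))"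
    by (simp add: MA_def ennreal_indicator)
  have [measurable_cong]: "sets MA = sets M" by (simp add: MA_def)
  have "emeasure MA (space MA) = emeasure M ?A"
    unfolding MA_def by (simp add: emeasure_restricted A_eq[symmetric])
  then interpret MA: finite_measure MA
    by (intro finite_measureI) (simp add: emeasure_eq_measure)
  interpret prodm: pair_sigma_finite MA Om ..
  interpret prodf: finite_measure "MA \<Otimes>\<^sub>M Om"
    by (rule finite_measure_pair_measure) unfold_locales
  define N1 where "N1 = distr MA borel (\<lambda>\<omega>. X x (T \<omega> + t) \<omega>)"
  \<comment> \<open>The state at time \<open>t\<close> of a copy started at the stopped position and
    driven by a fresh sequence \<open>v\<close> independent of \<open>MA\<close>.\<close>
  define N2 where "N2 = distr (MA \<Otimes>\<^sub>M Om) borel (\<lambda>(\<omega>, v). Z v (X x (T \<omega>) \<omega>) t)"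
  have m1 [measurable]: "(\<lambda>\<omega>. X x (T \<omega> + t) \<omega>) \<in> borel_measurable M" by measurable
  have m2 [measurable]: "(\<lambda>(\<omega>, v). Z v (X x (T \<omega>) \<omega>) t) \<in> borel_measurable (MA \<Otimes>\<^sub>M Om)" by measurable
  have nn1: "(\<integral>\<^sup>+y. g y \<partial>N1) = (\<integral>\<^sup>+\<omega>. indicator ?A \<omega> * g (X x (T \<omega> + t) \<omega>) \<partial>M)"
    if [measurable]: "g \<in> borel_measurable borel" for g
    unfolding N1_def MA_def by (subst nn_integral_distr) (simp_all add: nn_integral_density)
  have nn2: "(\<integral>\<^sup>+y. g y \<partial>N2) = (\<integral>\<^sup>+\<omega>. indicator ?A \<omega> * Pn t g (X x (T \<omega>) \<omega>) \<partial>M)"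
    if [measurable]: "g \<in> borel_measurable borel" for g
  proof -
    have "(\<integral>\<^sup>+y. g y \<partial>N2) = (\<integral>\<^sup>+p. g (case p of (\<omega>, v) \<Rightarrow> Z v (X x (T \<omega>) \<omega>) t) \<partial>(MA \<Otimes>\<^sub>M Om))"
      unfolding N2_def by (rule nn_integral_distr) simp_all
    also have "\<dots> = (\<integral>\<^sup>+\<omega>. Pn t g (X x (T \<omega>) \<omega>) \<partial>MA)"
      by (subst canon.nn_integral_fst[symmetric]) (simp_all add: Pn_def split_beta')
    also have "\<dots> = (\<integral>\<^sup>+\<omega>. indicator ?A \<omega> * Pn t g (X x (T \<omega>) \<omega>) \<partial>M)"
      unfolding MA_def by (subst nn_integral_density) simp_all
    finally show ?thesis .
  qed
  have "N1 = N2"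
  proof (rule measure_eqI_lessThan)
    show "sets N1 = sets borel" "sets N2 = sets borel" by (simp_all add: N1_def N2_def)
    interpret N1: finite_measure N1 unfolding N1_def by (rule MA.finite_measure_distr) measurable
    interpret N2: finite_measure N2 unfolding N2_def by (rule prodf.finite_measure_distr) measurable
    fix a :: real
    show "emeasure N1 {a<..} < \<infinity>" by (simp add: N1.emeasure_eq_measure)
    \<comment> \<open>Ramps of slope \<open>n\<close> that increase to the indicator of the
      ray.\<close>
    define g where "g n y = min 1 (real n * max 0 (y - a))" for n y
    have g: "continuous_on UNIV (g n)" "\<And>y. 0 \<le> g n y" "\<And>y. g n y \<le> 1" for n
      unfolding g_def by (intro continuous_intros) auto
    have [measurable]: "g n \<in> borel_measurable borel" for n
      by (rule borel_measurable_continuous_onI[OF g(1)])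
    have lim: "(\<lambda>n. ennreal (g n y)) \<longlonglongrightarrow> indicator {a<..} y" for y
    proof (cases "a < y")
      case True
      have "eventually (\<lambda>n. 1 / (y - a) \<le> real n) sequentially"
        using eventually_ge_at_top[of "nat \<lceil>1 / (y - a)\<rceil>"] by eventually_elim linarith
      then have "eventually (\<lambda>n. 1 = ennreal (g n y)) sequentially"
      proof eventually_elim
        case (elim n)
        then have "1 \<le> real n * (y - a)" using True by (simp add: pos_divide_le_eq)
        then have "g n y = 1" using True by (simp add: g_def)
        then show ?case by simp
      qed
      then have "(\<lambda>n. ennreal (g n y)) \<longlonglongrightarrow> 1" by (rule Lim_transform_eventually[OF tendsto_const])
      then show ?thesis using True by simp
    qed (simp add: g_def)
    have L: "(\<lambda>n. \<integral>\<^sup>+y. ennreal (g n y) \<partial>N) \<longlonglongrightarrow> emeasure N {a<..}"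
      if "finite_measure N" "sets N = sets borel" for N :: "real measure"
    proof -
      interpret finite_measure N by fact
      have [measurable]: "g n \<in> borel_measurable N" "indicator {a<..} \<in> borel_measurable N" for n
        using that(2) by (simp_all cong: measurable_cong_sets)
      have "(\<lambda>n. \<integral>\<^sup>+y. ennreal (g n y) \<partial>N) \<longlonglongrightarrow> (\<integral>\<^sup>+y. indicator {a<..} y \<partial>N)"
        by (rule nn_integral_dominated_convergence[where w = "\<lambda>_. 1"])
           (use g lim in \<open>auto simp: emeasure_eq_measure\<close>)
      then show ?thesis using that(2) by (simp add: nn_integral_indicator)
    qed
    have "(\<integral>\<^sup>+y. ennreal (g n y) \<partial>N1) = (\<integral>\<^sup>+y. ennreal (g n y) \<partial>N2)" for n
      using markov_stopping_continuous[OF A t g, of n] g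
      by (simp add: nn1 nn2 Pn_eq_Pr[where C = 1])
    then show "emeasure N1 {a<..} = emeasure N2 {a<..}"
      using L[OF N1.finite_measure_axioms] L[OF N2.finite_measure_axioms] LIMSEQ_unique
      by (simp add: N1_def N2_def)
  qed
  then have "(\<integral>y. f y \<partial>N1) = (\<integral>y. f y \<partial>N2)" by simp
  moreover have "(\<integral>y. f y \<partial>N1) = (\<integral>\<omega>. indicator ?A \<omega> * f (X x (T \<omega> + t) \<omega>) \<partial>M)"
  proof -
    have "(\<integral>y. f y \<partial>N1) = (\<integral>\<omega>. f (X x (T \<omega> + t) \<omega>) \<partial>MA)"
      unfolding N1_def by (rule integral_distr) measurable
    also have "\<dots> = (\<integral>\<omega>. indicator ?A \<omega> * f (X x (T \<omega> + t) \<omega>) \<partial>M)"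
      unfolding MA_real by (subst integral_density) simp_all
    finally show ?thesis .
  qed
  moreover have "(\<integral>y. f y \<partial>N2) = (\<integral>\<omega>. indicator ?A \<omega> * Pr t f (X x (T \<omega>) \<omega>) \<partial>M)"
  proof -
    have "(\<integral>y. f y \<partial>N2) = (\<integral>p. f (case p of (\<omega>, v) \<Rightarrow> Z v (X x (T \<omega>) \<omega>) t) \<partial>(MA \<Otimes>\<^sub>M Om))"
      unfolding N2_def by (rule integral_distr) simp_all
    also have "\<dots> = (\<integral>\<omega>. Pr t f (X x (T \<omega>) \<omega>) \<partial>MA)"
    proof (subst prodm.integral_fst'[symmetric])
      show "integrable (MA \<Otimes>\<^sub>M Om) (\<lambda>p. f (case p of (\<omega>, v) \<Rightarrow> Z v (X x (T \<omega>) \<omega>) t))"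
        by (rule prodf.integrable_const_bound[where B = C]) (auto simp: fb)
    qed (simp add: Pr_def)
    also have "\<dots> = (\<integral>\<omega>. indicator ?A \<omega> * Pr t f (X x (T \<omega>) \<omega>) \<partial>M)"
      unfolding MA_real by (subst integral_density) simp_all
    finally show ?thesis .
  qed
  ultimately show ?thesis by simp
qed

text \<open>On \<open>{\<tau> \<le> u}\<close>, cutting the dyadic approximations of \<open>\<tau>\<close> off at \<open>u\<close> keeps them adapted at time \<open>u\<close>.\<close>

lemma X_stopped_measurable:
  "(\<lambda>\<omega>. if \<tau> \<omega> < \<infinity> then X x (T \<omega>) \<omega> else 0) \<in> borel_measurable (pre_sigma \<tau>)"
proof (rule measurableI)
  let ?Y = "\<lambda>\<omega>. if \<tau> \<omega> < \<infinity> then X x (T \<omega>) \<omega> else 0"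
  have fin: "(\<lambda>\<omega>. if \<tau> \<omega> \<le> ennreal u then X x (T \<omega>) \<omega> else 0) \<in> borel_measurable (F x (ennreal u))"
    if u: "0 \<le> u" for u
  proof -
    have le [measurable]: "Measurable.pred (F x (ennreal u)) (\<lambda>\<omega>. \<tau> \<omega> \<le> ennreal u)"
      by (rule stopping_timeD[OF \<tau>])
    have min_m: "(\<lambda>\<omega>. min (\<tau> \<omega>) (ennreal u)) \<in> borel_measurable (F x (ennreal u))"
    proof (rule borel_measurableI_le)
      fix c :: ennreal
      show "{\<omega> \<in> space (F x (ennreal u)). min (\<tau> \<omega>) (ennreal u) \<le> c} \<in> sets (F x (ennreal u))"
      proof (cases "ennreal u \<le> c")
        case True
        then have "{\<omega> \<in> space (F x (ennreal u)). min (\<tau> \<omega>) (ennreal u) \<le> c} = space (F x (ennreal u))"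
          by (auto simp: min_le_iff_disj)
        then show ?thesis by (simp only: sets.top)
      next
        case False
        then have "{\<omega> \<in> space (F x (ennreal u)). min (\<tau> \<omega>) (ennreal u) \<le> c} = {\<omega> \<in> space M. \<tau> \<omega> \<le> c}"
          by (auto simp: min_le_iff_disj)
        moreover have "c \<le> ennreal u" using False by simp
        ultimately show ?thesis using sets_\<tau>_le[of c] sets_F_mono[of c "ennreal u"] by auto
      qed
    qed
    define W where "W n \<omega> = (if \<tau> \<omega> \<le> ennreal u
      then X x (min (dyadic_up n (enn2real (min (\<tau> \<omega>) (ennreal u)))) u) \<omega> else 0)" for n \<omega>
    have "W n \<in> borel_measurable (F x (ennreal u))" for n
    proof -
      define k where "k \<omega> = nat \<lfloor>2 ^ n * enn2real (min (\<tau> \<omega>) (ennreal u))\<rfloor>" for \<omega>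
      have "(\<lambda>\<omega>. 2 ^ n * enn2real (min (\<tau> \<omega>) (ennreal u))) \<in> borel_measurable (F x (ennreal u))"
        using min_m by measurable
      then have k [measurable]: "k \<in> measurable (F x (ennreal u)) (count_space UNIV)"
        unfolding k_def by measurable
      have "(\<lambda>\<omega>. X x (min ((real (k \<omega>) + 1) / 2 ^ n) u) \<omega>) \<in> borel_measurable (F x (ennreal u))"
      proof (rule measurable_compose_countable[where f = "\<lambda>k \<omega>. X x (min ((real k + 1) / 2 ^ n) u) \<omega>" and g = k])
        show "X x (min ((real j + 1) / 2 ^ n) u) \<in> borel_measurable (F x (ennreal u))" for j
          using u by (intro X_adapted) (auto intro!: ennreal_leI)
      qed (rule k)
      moreover have "W n = (\<lambda>\<omega>. if \<tau> \<omega> \<le> ennreal u then X x (min ((real (k \<omega>) + 1) / 2 ^ n) u) \<omega> else 0)"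
        by (simp add: W_def k_def dyadic_up_def fun_eq_iff)
      ultimately show ?thesis by simp
    qed
    moreover have "(\<lambda>n. W n \<omega>) \<longlonglongrightarrow> (if \<tau> \<omega> \<le> ennreal u then X x (T \<omega>) \<omega> else 0)"
      if "\<omega> \<in> space (F x (ennreal u))" for \<omega>
    proof (cases "\<tau> \<omega> \<le> ennreal u")
      case True
      then have min: "min (\<tau> \<omega>) (ennreal u) = \<tau> \<omega>" by simp
      have T: "T \<omega> \<le> u" using True u by (simp add: enn2real_leI)
      have "(\<lambda>n. min (dyadic_up n (T \<omega>)) u) \<longlonglongrightarrow> min (T \<omega>) u"
        by (intro tendsto_intros dyadic_up_tendsto)
      then have "(\<lambda>n. X x (min (dyadic_up n (T \<omega>)) u) \<omega>) \<longlonglongrightarrow> X x (T \<omega>) \<omega>"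
        using T that dyadic_up_gt[of "T \<omega>"] by (intro Z_right_seq V_good) (auto simp: less_imp_le min_def)
      then show ?thesis using True by (simp add: W_def min)
    qed (simp add: W_def)
    ultimately show ?thesis by (rule borel_measurable_LIMSEQ_real[rotated])
  qed
  fix B :: "real set" assume B [measurable]: "B \<in> sets borel"
  have finB: "{\<omega> \<in> space M. ?Y \<omega> \<in> B \<and> \<tau> \<omega> \<le> ennreal u} \<in> sets (F x (ennreal u))" if "0 \<le> u" for u
  proof -
    note [measurable] = fin[OF that] stopping_timeD[OF \<tau>, of "ennreal u"]
    have "{\<omega> \<in> space (F x (ennreal u)). (if \<tau> \<omega> \<le> ennreal u then X x (T \<omega>) \<omega> else 0) \<in> B \<and> \<tau> \<omega> \<le> ennreal u} \<in> sets (F x (ennreal u))"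
      by measurable
    also have "{\<omega> \<in> space (F x (ennreal u)). (if \<tau> \<omega> \<le> ennreal u then X x (T \<omega>) \<omega> else 0) \<in> B \<and> \<tau> \<omega> \<le> ennreal u}
        = {\<omega> \<in> space M. ?Y \<omega> \<in> B \<and> \<tau> \<omega> \<le> ennreal u}"
      by (auto intro: order_le_less_trans split: if_splits)
    finally show ?thesis .
  qed
  have topB: "{\<omega> \<in> space M. ?Y \<omega> \<in> B} \<in> sets (F x top)"
  proof -
    \<comment> \<open>The time \<infinity> needs its own argument: a finite \<open>\<tau>\<close>
      lies below some integer, and for \<open>\<tau> = \<infinity>\<close> the value is the default
      0.\<close>
    have "{\<omega> \<in> space M. ?Y \<omega> \<in> B} = (\<Union>k. {\<omega> \<in> space M. ?Y \<omega> \<in> B \<and> \<tau> \<omega> \<le> ennreal (real k)})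
        \<union> (if 0 \<in> B then space M - {\<omega> \<in> space M. \<tau> \<omega> < top} else {})"
    proof (intro set_eqI)
      fix \<omega>
      have "\<exists>k. \<tau> \<omega> \<le> ennreal (real k)" if fin: "\<tau> \<omega> < top"
      proof -
        obtain r where "\<tau> \<omega> = ennreal r" "0 \<le> r" using fin by (cases "\<tau> \<omega>") auto
        then show ?thesis using real_nat_ceiling_ge[of r] by (auto intro!: exI[of _ "nat \<lceil>r\<rceil>"] ennreal_leI)
      qed
      then show "\<omega> \<in> {\<omega> \<in> space M. ?Y \<omega> \<in> B} \<longleftrightarrow> \<omega> \<in> (\<Union>k. {\<omega> \<in> space M. ?Y \<omega> \<in> B \<and> \<tau> \<omega> \<le> ennreal (real k)})
        \<union> (if 0 \<in> B then space M - {\<omega> \<in> space M. \<tau> \<omega> < top} else {})"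
        by (cases "\<tau> \<omega> < top") auto
    qed
    moreover have "{\<omega> \<in> space M. ?Y \<omega> \<in> B \<and> \<tau> \<omega> \<le> ennreal (real k)} \<in> sets (F x top)" for k
      by (rule subsetD[OF sets_F_mono finB]) simp_all
    moreover have "space M - {\<omega> \<in> space M. \<tau> \<omega> < top} \<in> sets (F x top)"
      using sets.compl_sets[OF sets_\<tau>_less[of top]] by simp
    ultimately show ?thesis by auto
  qed
  show "?Y -` B \<inter> space (pre_sigma \<tau>) \<in> sets (pre_sigma \<tau>)"
  proof (rule sets_pre_sigmaI[OF \<tau>])
    fix u :: ennreal
    have "{\<omega> \<in> ?Y -` B \<inter> space (pre_sigma \<tau>). \<tau> \<omega> \<le> u} = {\<omega> \<in> space M. ?Y \<omega> \<in> B \<and> \<tau> \<omega> \<le> u}"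
      by (auto simp: space_pre_sigma)
    then show "{\<omega> \<in> ?Y -` B \<inter> space (pre_sigma \<tau>). \<tau> \<omega> \<le> u} \<in> sets (F x u)"
      using finB topB by (cases u) simp_all
  qed
qed simp

text \<open>The variable \<open>h\<close> is tied to \<open>f\<close> only on the sample space. This
  lets a function on the half-line be exchanged for its extension by 0.\<close>

lemma cond_exp_stopping:
  assumes t: "0 \<le> t" and f [measurable]: "f \<in> borel_measurable borel" and fb: "\<And>x. \<bar>f x\<bar> \<le> (C::real)"
    and h: "\<And>\<omega>. \<omega> \<in> space M \<Longrightarrow> h \<omega> = (if \<tau> \<omega> < \<infinity> then f (X x (T \<omega> + t) \<omega>) else 0)"
  shows "AE \<omega> in M. real_cond_exp M (pre_sigma \<tau>) h \<omega>
    = (if \<tau> \<omega> < \<infinity> then Pr t f (X x (T \<omega>) \<omega>) else 0)"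
proof -
  interpret sub: finite_measure_subalgebra M "pre_sigma \<tau>"
    using pre_sigma_subset sets_F_subset[of x top]
    by unfold_locales (auto simp: subalgebra_def space_pre_sigma)
  have C: "0 \<le> C" using fb[of 0] by simp
  show ?thesis
  proof (rule sub.real_cond_exp_charact)
    fix A assume A: "A \<in> sets (pre_sigma \<tau>)"
    have i: "indicator A \<omega> *\<^sub>R (if \<tau> \<omega> < \<infinity> then a else 0) = indicator {\<omega>\<in>A. \<tau> \<omega> < \<infinity>} \<omega> * a" for a :: real and \<omega>
      by (auto simp: indicator_def)
    have "(LINT \<omega>:A|M. h \<omega>) = (LINT \<omega>:A|M. if \<tau> \<omega> < \<infinity> then f (X x (T \<omega> + t) \<omega>) else 0)"
      unfolding set_lebesgue_integral_def by (rule Bochner_Integration.integral_cong) (simp_all add: h)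
    also have "\<dots> =
         (LINT \<omega>:A|M. if \<tau> \<omega> < \<infinity> then Pr t f (X x (T \<omega>) \<omega>) else 0)"
      unfolding set_lebesgue_integral_def i by (rule markov_stopping[OF A t f fb])
    finally show "(LINT \<omega>:A|M. h \<omega>) = (LINT \<omega>:A|M. if \<tau> \<omega> < \<infinity> then Pr t f (X x (T \<omega>) \<omega>) else 0)" .
  next
    have "integrable M (\<lambda>\<omega>. if \<tau> \<omega> < \<infinity> then f (X x (T \<omega> + t) \<omega>) else 0)"
      by (rule integrable_const_bound[where B = C]) (auto simp: fb C)
    then show "integrable M h"
      by (subst Bochner_Integration.integrable_cong[OF refl h])
    show "integrable M (\<lambda>\<omega>. if \<tau> \<omega> < \<infinity> then Pr t f (X x (T \<omega>) \<omega>) else 0)"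
      by (rule integrable_const_bound[where B = C]) (auto simp: Pr_bound[OF f fb] C)
    have [measurable]: "\<tau> \<in> borel_measurable (pre_sigma \<tau>)"
      by (rule measurable_stopping_time_pre_sigma[OF \<tau>])
    \<comment> \<open>The inner conditional turns the stopped position into the variable of
      \<open>X_stopped_measurable\<close>; it disappears again in the next step.\<close>
    have "(\<lambda>\<omega>. if \<tau> \<omega> < \<infinity> then Pr t f (if \<tau> \<omega> < \<infinity> then X x (T \<omega>) \<omega> else 0) else 0) \<in> borel_measurable (pre_sigma \<tau>)"
      using X_stopped_measurable by measurable
    also have "(\<lambda>\<omega>. if \<tau> \<omega> < \<infinity> then Pr t f (if \<tau> \<omega> < \<infinity> then X x (T \<omega>) \<omega> else 0) else 0)
        = (\<lambda>\<omega>. if \<tau> \<omega> < \<infinity> then Pr t f (X x (T \<omega>) \<omega>) else 0)"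
      by (simp add: fun_eq_iff)
    finally show "(\<lambda>\<omega>. if \<tau> \<omega> < \<infinity> then Pr t f (X x (T \<omega>) \<omega>) else 0) \<in> borel_measurable (pre_sigma \<tau>)" .
  qed
qed

end

section \<open>Semigroup property and the strong Markov process\<close>

lemma Pr_semigroup:
  assumes x: "0 \<le> x" and s: "0 \<le> s" and t: "0 \<le> t"
    and f [measurable]: "f \<in> borel_measurable borel" and fb: "\<And>x. \<bar>f x\<bar> \<le> (C::real)"
  shows "Pr (s + t) f x = Pr s (Pr t f) x"
proof -
  \<comment> \<open>The semigroup property is the strong Markov property at the constant time
    \<open>s\<close>, tested on the whole sample space.\<close>
  have st: "stopping_time (F x) (\<lambda>_. ennreal s)" by (rule stopping_time_const)
  have "space M \<in> sets (filtration.pre_sigma (space M) (F x) (\<lambda>_. ennreal s))"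
    using sets.top[of "filtration.pre_sigma (space M) (F x) (\<lambda>_. ennreal s)"]
    by (simp add: filtration.space_pre_sigma[OF filtration_natural_filtration])
  from markov_stopping[OF x st this t f fb]
  have "(\<integral>\<omega>. f (X x (s + t) \<omega>) \<partial>M) = (\<integral>\<omega>. Pr t f (X x s \<omega>) \<partial>M)"
    using s by (simp add: indicator_def cong: Bochner_Integration.integral_cong)
  then show ?thesis by (simp add: Pr_eq_X)
qed

lemma transition_op_eq:
  assumes "bounded_borel_half_line f"
  shows "transition_op M X t f x = Pr t (half_ext f) x"
proof -
  have "transition_op M X t f x = (\<integral>\<omega>. half_ext f (X x t \<omega>) \<partial>M)"
    unfolding transition_op_def
    by (rule Bochner_Integration.integral_cong) (auto simp: half_ext_def Z_nonneg[OF V_good])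
  then show ?thesis using bounded_borel_half_line_ext[OF assms] by (simp add: Pr_eq_X)
qed

lemma bounded_borel_Pr:
  assumes "f \<in> borel_measurable borel" "\<And>x. \<bar>f x\<bar> \<le> C"
  shows "bounded_borel_half_line (Pr t f)"
  unfolding bounded_borel_half_line_def
proof
  show "Pr t f \<in> borel_measurable (restrict_space borel {0..})"
    using Pr_measurable[OF assms(1)] by (rule measurable_restrict_space1)
  show "bounded (Pr t f ` {0..})"
    using Pr_bound[OF assms] by (auto simp: bounded_iff)
qed

lemma transition_semigroup_X: "transition_semigroup (transition_op M X)"
  unfolding transition_semigroup_def
proof (intro allI impI conjI)
  fix f assume f: "bounded_borel_half_line f"
  note m = bounded_borel_half_line_ext[OF f]
  obtain C where C: "\<And>x. \<bar>half_ext f x\<bar> \<le> C" using half_ext_bound[OF f] by blast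
  have eq: "transition_op M X t f = Pr t (half_ext f)" for t
    using transition_op_eq[OF f] by (simp add: fun_eq_iff)
  show bb: "bounded_borel_half_line (transition_op M X t f)" for t
    unfolding eq by (rule bounded_borel_Pr[OF m C])
  fix x :: real assume x: "0 \<le> x"
  have "transition_op M X 0 f x = (\<integral>\<omega>. f x \<partial>M)"
    unfolding transition_op_def using x
    by (intro Bochner_Integration.integral_cong) (auto simp: Z_zero V_good)
  then show "transition_op M X 0 f x = f x" by (simp add: prob_space)
next
  fix f and s t x :: real assume f: "bounded_borel_half_line f" and st: "0 \<le> s" "0 \<le> t" "0 \<le> x"
  note m = bounded_borel_half_line_ext[OF f]
  obtain C where C: "\<And>x. \<bar>half_ext f x\<bar> \<le> C" using half_ext_bound[OF f] by blast
  have eq: "transition_op M X t f = Pr t (half_ext f)" for t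
    using transition_op_eq[OF f] by (simp add: fun_eq_iff)
  \<comment> \<open>Iterating \<open>transition_op\<close> inserts a second extension by 0, which
    only changes values at negative points, and almost every path avoids those.\<close>
  have "Pr s (half_ext (Pr t (half_ext f))) x = Pr s (Pr t (half_ext f)) x"
    unfolding Pr_def[of s]
  proof (rule integral_cong_AE)
    show "(\<lambda>v. half_ext (Pr t (half_ext f)) (Z v x s)) \<in> borel_measurable Om"
      using bounded_borel_half_line_ext[OF bounded_borel_Pr[OF m C]] by (rule measurable_compose[OF Z_Om_measurable])
    show "(\<lambda>v. Pr t (half_ext f) (Z v x s)) \<in> borel_measurable Om"
      using Pr_measurable[OF m] by (rule measurable_compose[OF Z_Om_measurable])
    show "AE v in Om. half_ext (Pr t (half_ext f)) (Z v x s) = Pr t (half_ext f) (Z v x s)"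
      using AE_good by eventually_elim (simp add: half_ext_def Z_nonneg)
  qed
  then show "transition_op M X (s + t) f x = transition_op M X s (transition_op M X t f) x"
    unfolding eq transition_op_eq[OF bounded_borel_Pr[OF m C]]
    using Pr_semigroup[OF st(3,1,2) m C] by simp
qed

theorem strong_Markov_X: "strong_Markov_process M X (transition_op M X)"
  unfolding strong_Markov_process_def
proof (intro conjI allI impI ballI)
  fix x :: real assume x: "0 \<le> x"
  show "X x 0 \<omega> = x" if "\<omega> \<in> space M" for \<omega> by (rule Z_zero[OF V_good[OF that] x])
  show "0 \<le> X x t \<omega>" if "\<omega> \<in> space M" for \<omega> t by (rule Z_nonneg[OF V_good[OF that]])
  show "cadlag_on {0..} (\<lambda>t. X x t \<omega>)" if "\<omega> \<in> space M" for \<omega>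
    using Z_cadlag[OF V_good[OF that] V_jprod[OF that] x] by (simp add: eta_contract_eq)
  fix t :: real and \<tau> f
  assume t: "0 \<le> t" and \<tau>: "stopping_time (F x) \<tau>" and f: "bounded_borel_half_line f"
  note m = bounded_borel_half_line_ext[OF f]
  obtain C where C: "\<And>x. \<bar>half_ext f x\<bar> \<le> C" using half_ext_bound[OF f] by blast
  let ?G = "filtration.pre_sigma (space M) (F x) \<tau>"
  have ext: "f (X x s \<omega>) = half_ext f (X x s \<omega>)" if "\<omega> \<in> space M" for s \<omega>
    using Z_nonneg[OF V_good[OF that]] by (simp add: half_ext_def)
  show "AE \<omega> in M. real_cond_exp M ?G (\<lambda>\<omega>'. if \<tau> \<omega>' < \<infinity> then f (X x (enn2real (\<tau> \<omega>') + t) \<omega>') else 0) \<omega>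
             * indicator {\<omega>'. \<tau> \<omega>' < \<infinity>} \<omega>
           = transition_op M X t f (X x (enn2real (\<tau> \<omega>)) \<omega>) * indicator {\<omega>'. \<tau> \<omega>' < \<infinity>} \<omega>"
  proof -
    let ?h = "\<lambda>\<omega>'. if \<tau> \<omega>' < \<infinity> then f (X x (enn2real (\<tau> \<omega>') + t) \<omega>') else 0"
    have "AE \<omega> in M. real_cond_exp M ?G ?h \<omega>
        = (if \<tau> \<omega> < \<infinity> then Pr t (half_ext f) (X x (enn2real (\<tau> \<omega>)) \<omega>) else 0)"
      by (rule cond_exp_stopping[OF x \<tau> t m C]) (simp add: ext)
    then show ?thesis
      by eventually_elim (auto simp: transition_op_eq[OF f] indicator_def)
  qed
qed (auto intro: transition_semigroup_X)

end

section \<open>The stationary density\<close>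

text \<open>As a default rule, \<open>Om_component\<close> matches every goal by higher-order unification.\<close>

declare Om_component [measurable del]

lemma nn_integral_swap:
  fixes f :: "real \<Rightarrow> real \<Rightarrow> ennreal"
  assumes "(\<lambda>(x, y). f x y) \<in> borel_measurable (borel \<Otimes>\<^sub>M borel)"
  shows "(\<integral>\<^sup>+x. (\<integral>\<^sup>+y. f x y \<partial>lborel) \<partial>lborel) = (\<integral>\<^sup>+y. (\<integral>\<^sup>+x. f x y \<partial>lborel) \<partial>lborel)"
proof -
  have "(\<lambda>(x, y). f x y) \<in> borel_measurable (lborel \<Otimes>\<^sub>M lborel)"
    using assms by (simp cong: measurable_cong_sets)
  then show ?thesis by (rule lborel_pair.Fubini'[symmetric])
qed

context rate
begin

context
  fixes Fd :: "ennreal \<Rightarrow> real"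
  assumes st: "stationary_distr R Fd"
begin

section \<open>The stationary law as a Lebesgue-Stieltjes measure\<close>

abbreviation df :: "real \<Rightarrow> real" where "df x \<equiv> if 0 \<le> x then Fd (ennreal x) else 0"

text \<open>This is hidden in the measurability condition: a measurable map takes its values in the
  space of its target, and that of \<open>L1loc_borel\<close> is
  \<open>distr_functions\<close>.\<close>

lemma Fd_distr: "Fd \<in> distr_functions"
proof -
  have "(\<lambda>t::real. Fd) \<in> measurable (restrict_space borel {0..}) L1loc_borel"
    using st unfolding stationary_distr_def solutions_def mem_Collect_eq by (rule conjunct1)
  from measurable_space[OF this, of "0::real"] have "Fd \<in> space L1loc_borel"
    by (simp add: space_restrict_space)
  moreover have "space L1loc_borel = distr_functions"
    unfolding L1loc_borel_def by (rule space_measure_of) (auto simp: L1loc_open_def)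
  ultimately show ?thesis by simp
qed

lemma Fd_values: "Fd \<infinity> = 1" "Fd 0 = 0"
  using st by (auto simp: stationary_distr_def solutions_def)

lemma df_mono: "x \<le> y \<Longrightarrow> df x \<le> df y"
proof -
  assume xy: "x \<le> y"
  have "mono Fd" "range Fd \<subseteq> {0..1}" using Fd_distr by (auto simp: distr_functions_def)
  moreover have "0 \<le> Fd z" for z using \<open>range Fd \<subseteq> {0..1}\<close> by (simp add: image_subset_iff)
  ultimately show ?thesis using xy by (auto simp: mono_def intro: ennreal_leI)
qed

lemma df_right_continuous: "continuous (at_right a) df"
proof (cases "0 \<le> a")
  case True
  have c: "(Fd \<longlongrightarrow> Fd (ennreal a)) (at (ennreal a) within {ennreal a<..})"
    using Fd_distr by (auto simp: distr_functions_def cadlag_on_def)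
  have "filterlim ennreal (at (ennreal a) within {ennreal a<..}) (at_right a)"
    unfolding filterlim_at
  proof
    have "eventually (\<lambda>x. a < x) (at_right a)" by (rule eventually_at_right_less)
    then show "\<forall>\<^sub>F x in at_right a. ennreal x \<in> {ennreal a<..} \<and> ennreal x \<noteq> ennreal a"
      by eventually_elim (use True in \<open>auto simp: ennreal_less_iff\<close>)
  qed (intro tendsto_intros)
  from filterlim_compose[OF c this] have "((\<lambda>x. Fd (ennreal x)) \<longlongrightarrow> df a) (at_right a)" using True by simp
  moreover have "eventually (\<lambda>x. Fd (ennreal x) = df x) (at_right a)"
    using eventually_at_right_less[of a] by eventually_elim (use True in auto)
  ultimately show ?thesis unfolding continuous_within by (rule Lim_transform_eventually)
next
  case False
  then have "eventually (\<lambda>x. x < 0) (at_right a)" by (intro eventually_at_rightI[of a 0]) auto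
  then have "eventually (\<lambda>x. 0 = df x) (at_right a)" by eventually_elim simp
  then show ?thesis unfolding continuous_within using False
    by (auto intro: Lim_transform_eventually[OF tendsto_const])
qed

lemma df_bot: "(df \<longlongrightarrow> 0) at_bot"
proof -
  have "eventually (\<lambda>x::real. 0 = df x) at_bot"
    using eventually_le_at_bot[of "-1::real"] by eventually_elim simp
  then show ?thesis by (rule Lim_transform_eventually[OF tendsto_const])
qed

lemma df_top: "(df \<longlongrightarrow> 1) at_top"
proof -
  have c: "(Fd \<longlongrightarrow> 1) (at_left \<infinity>)"
    using Fd_distr Fd_values by (auto simp: distr_functions_def)
  have "filterlim (\<lambda>x::real. ennreal x) (at_left \<infinity>) at_top"
    unfolding filterlim_at by (auto simp: ennreal_tendsto_top_eq_at_top filterlim_ident intro!: always_eventually)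
  from filterlim_compose[OF c this] have "((\<lambda>x. Fd (ennreal x)) \<longlongrightarrow> 1) at_top" .
  moreover have "eventually (\<lambda>x. Fd (ennreal x) = df x) at_top"
    using eventually_ge_at_top[of "0::real"] by eventually_elim simp
  ultimately show ?thesis by (rule Lim_transform_eventually)
qed

abbreviation \<mu> :: "real measure" where "\<mu> \<equiv> stieltjes Fd"

lemma real_distribution_\<mu>: "real_distribution \<mu>"
  unfolding stieltjes_def by (rule real_distribution_interval_measure) (fact df_mono df_right_continuous df_bot df_top)+

lemma sets_\<mu> [measurable_cong, simp]: "sets \<mu> = sets borel" and space_\<mu> [simp]: "space \<mu> = UNIV"
  by (simp_all add: stieltjes_def)

lemma emeasure_\<mu>_Ioc: "a \<le> b \<Longrightarrow> emeasure \<mu> {a<..b} = ennreal (df b - df a)"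
  unfolding stieltjes_def by (rule emeasure_interval_measure_Ioc[OF _ df_mono df_right_continuous])

lemma emeasure_\<mu>_nonpos: "emeasure \<mu> {..0} = 0"
proof -
  interpret real_distribution \<mu> by (rule real_distribution_\<mu>)
  have "cdf \<mu> = df" unfolding stieltjes_def by (rule cdf_interval_measure) (fact df_mono df_right_continuous df_bot)+
  then have "measure \<mu> {..0} = 0" using Fd_values by (simp add: cdf_def fun_eq_iff)
  then show ?thesis by (simp add: emeasure_eq_measure)
qed

text \<open>The inner integral of the evolution equation. It turns out that \<open>y * G y\<close>
  is the density of \<open>\<mu>\<close> on (0,\<infinity>).\<close>

definition G :: "real \<Rightarrow> ennreal" where
  "G y = (\<integral>\<^sup>+z\<in>{y..}. ennreal (R z / z) \<partial>\<mu>)"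

lemma G_antimono: "y \<le> y' \<Longrightarrow> G y' \<le> G y"
  unfolding G_def by (intro nn_integral_mono) (auto simp: indicator_def)

lemma G_measurable [measurable]: "G \<in> borel_measurable borel"
proof -
  interpret real_distribution \<mu> by (rule real_distribution_\<mu>)
  have "(\<lambda>y. \<integral>\<^sup>+z. (if y \<le> z then ennreal (R z / z) else 0) \<partial>\<mu>) \<in> borel_measurable borel"
    by measurable
  moreover have "(\<lambda>y. \<integral>\<^sup>+z. (if y \<le> z then ennreal (R z / z) else 0) \<partial>\<mu>) = G"
    unfolding G_def by (intro ext nn_integral_cong) (auto simp: indicator_def)
  ultimately show ?thesis by simp
qed

text \<open>For a constant family the time is a free parameter. With \<open>t = ln (b / a)\<close>
  the initial term becomes the value at \<open>a\<close>, and the substitution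
  \<open>y = e^(s-t) b\<close> uses up one of the two factors of the square as Jacobian.\<close>

lemma df_increment:
  assumes a: "0 < a" "a < b"
  shows "ennreal (df b) = ennreal (df a) + (\<integral>\<^sup>+y\<in>{a..b}. ennreal y * G y \<partial>lborel)"
proof -
  define t where "t = ln (b / a)"
  have t: "0 < t" using a by (simp add: t_def)
  have et: "exp (- t) * b = a" using a by (simp add: t_def exp_minus)
  have "ennreal (Fd (ennreal b)) =
          ennreal (Fd (ennreal (exp (- t) * b))) +
          (\<integral>\<^sup>+s\<in>{0..t}. ennreal ((exp (s - t) * b)\<^sup>2) * G (exp (s - t) * b) \<partial>lborel)"
    using st t a unfolding stationary_distr_def solutions_def G_def by simp
  moreover have "(\<integral>\<^sup>+s\<in>{0..t}. ennreal ((exp (s - t) * b)\<^sup>2) * G (exp (s - t) * b) \<partial>lborel)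
      = (\<integral>\<^sup>+y\<in>{a..b}. ennreal y * G y \<partial>lborel)"
  proof -
    let ?g = "\<lambda>s. exp (s - t) * b"
    have ab: "?g 0 = a" "?g t = b" using et by simp_all
    have "(\<integral>\<^sup>+y. (ennreal y * G y) * indicator {?g 0..?g t} y \<partial>lborel)
        = (\<integral>\<^sup>+s. (ennreal (?g s) * G (?g s)) * ennreal (?g s) * indicator {0..t} s \<partial>lborel)"
      using t a by (intro nn_integral_substitution_aux) (auto intro!: derivative_eq_intros continuous_intros)
    then show ?thesis unfolding ab
      using a by (simp add: power2_eq_square ennreal_mult mult_ac)
  qed
  ultimately show ?thesis using a et by simp
qed

lemma \<mu>_Ioc:
  assumes a: "0 < a" "a < b"
  shows "emeasure \<mu> {a<..b} = (\<integral>\<^sup>+y\<in>{a..b}. ennreal y * G y \<partial>lborel)"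
proof -
  have "0 \<le> df a" "df a \<le> df b" using df_mono[of "-1" a] df_mono[of a b] a by auto
  then have "ennreal (df a) + emeasure \<mu> {a<..b} = ennreal (df b)"
    using a by (simp add: emeasure_\<mu>_Ioc ennreal_plus[symmetric] del: ennreal_plus)
  then have "ennreal (df a) + emeasure \<mu> {a<..b} = ennreal (df a) + (\<integral>\<^sup>+y\<in>{a..b}. ennreal y * G y \<partial>lborel)"
    using df_increment[OF a] by simp
  then show ?thesis by (simp add: ennreal_add_left_cancel)
qed

text \<open>\<open>G\<close> is nonincreasing, so its value at \<open>b\<close>, multiplied by a
  positive constant, is at most the mass of (b/2, b].\<close>

lemma G_finite: "0 < b \<Longrightarrow> G b < top"
proof -
  assume b: "0 < b"
  let ?a = "b / 2"
  have "ennreal ?a * ennreal (b - ?a) * G b = (\<integral>\<^sup>+y. (ennreal ?a * G b) * indicator {?a..b} y \<partial>lborel)"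
    using b by (subst nn_integral_cmult_indicator) (simp_all add: mult_ac)
  also have "\<dots> \<le> (\<integral>\<^sup>+y\<in>{?a..b}. ennreal y * G y \<partial>lborel)"
    using b by (intro nn_integral_mono) (auto simp: indicator_def intro!: mult_mono ennreal_leI G_antimono)
  also have "\<dots> = emeasure \<mu> {?a<..b}" using b by (simp add: \<mu>_Ioc)
  also have "\<dots> < top" using b by (simp add: emeasure_\<mu>_Ioc)
  finally have "ennreal ?a * ennreal (b - ?a) * G b < top" .
  then show ?thesis using b by (auto simp: ennreal_mult_less_top)
qed

text \<open>The identity on intervals reaches only down to positive endpoints. It is carried to rays
  by exhaustion, and an atom at 0 is excluded by \<open>F 0 = 0\<close>.\<close>

lemma \<mu>_density: "\<mu> = density lborel (\<lambda>y. ennreal y * G y * indicator {0<..} y)"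
proof (rule measure_eqI_lessThan)
  interpret real_distribution \<mu> by (rule real_distribution_\<mu>)
  let ?\<nu> = "density lborel (\<lambda>y. ennreal y * G y * indicator {0<..} y)"
  fix x :: real
  show "emeasure \<mu> {x<..} < \<infinity>" by (simp add: emeasure_eq_measure)
  have Ioc: "emeasure \<mu> {a<..b} = emeasure ?\<nu> {a<..b}" if a: "0 < a" "a < b" for a b
  proof -
    have "emeasure ?\<nu> {a<..b} = (\<integral>\<^sup>+y. ennreal y * G y * indicator {0<..} y * indicator {a<..b} y \<partial>lborel)"
      by (rule emeasure_density) measurable
    also have "\<dots> = (\<integral>\<^sup>+y\<in>{a..b}. ennreal y * G y \<partial>lborel)"
      by (intro nn_integral_cong_AE, use AE_lborel_singleton[of a] in eventually_elim)
         (use a in \<open>auto simp: indicator_def\<close>)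
    finally show ?thesis using \<mu>_Ioc[OF a] by simp
  qed
  have pos: "emeasure \<mu> {a<..} = emeasure ?\<nu> {a<..}" if a: "0 < a" for a
  proof -
    have U: "(\<Union>n. {a<..a + real (Suc n)}) = {a<..}"
    proof (intro set_eqI iffI)
      fix y assume "y \<in> {a<..}"
      then show "y \<in> (\<Union>n. {a<..a + real (Suc n)})"
        using real_nat_ceiling_ge[of "y - a"] by (auto intro!: exI[of _ "nat \<lceil>y - a\<rceil>"]) (linarith)
    qed auto
    have L: "(\<lambda>n. emeasure N {a<..a + real (Suc n)}) \<longlonglongrightarrow> emeasure N {a<..}"
      if "sets N = sets borel" for N :: "real measure"
    proof -
      have "range (\<lambda>n. {a<..a + real (Suc n)}) \<subseteq> sets N" unfolding that by (simp add: image_subset_iff)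
      moreover have "incseq (\<lambda>n. {a<..a + real (Suc n)})" by (intro monoI) auto
      ultimately have "(\<lambda>n. emeasure N {a<..a + real (Suc n)}) \<longlonglongrightarrow> emeasure N (\<Union>n. {a<..a + real (Suc n)})"
        by (rule Lim_emeasure_incseq)
      then show ?thesis by (simp only: U)
    qed
    show ?thesis
      using L[of \<mu>] L[of ?\<nu>] Ioc[OF a] LIMSEQ_unique by simp
  qed
  have "emeasure \<mu> {0<..} = emeasure ?\<nu> {0<..}"
  proof -
    have U: "(\<Union>n. {1 / real (Suc n)<..}) = {0<..}"
    proof (intro set_eqI iffI)
      fix y :: real assume "y \<in> {0<..}"
      then obtain n where "inverse (real (Suc n)) < y" using reals_Archimedean by auto
      then show "y \<in> (\<Union>n. {1 / real (Suc n)<..})" by (auto simp: inverse_eq_divide)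
    next
      fix y :: real assume "y \<in> (\<Union>n. {1 / real (Suc n)<..})"
      then obtain n where "1 / real (Suc n) < y" by auto
      moreover have "0 < 1 / real (Suc n)" by simp
      ultimately have "0 < y" by (rule order_less_trans[rotated])
      then show "y \<in> {0<..}" by simp
    qed
    have L: "(\<lambda>n. emeasure N {1 / real (Suc n)<..}) \<longlonglongrightarrow> emeasure N {0<..}"
      if "sets N = sets borel" for N :: "real measure"
    proof -
      have "range (\<lambda>n. {1 / real (Suc n)<..}) \<subseteq> sets N" unfolding that by (simp add: image_subset_iff)
      moreover have "incseq (\<lambda>n. {1 / real (Suc n)<..})"
      proof (intro monoI)
        fix m n :: nat assume "m \<le> n"
        then have "1 / real (Suc n) \<le> 1 / real (Suc m)" by (intro divide_left_mono) auto
        then show "{1 / real (Suc m)<..} \<subseteq> {1 / real (Suc n)<..}" by auto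
      qed
      ultimately have "(\<lambda>n. emeasure N {1 / real (Suc n)<..}) \<longlonglongrightarrow> emeasure N (\<Union>n. {1 / real (Suc n)<..})"
        by (rule Lim_emeasure_incseq)
      then show ?thesis by (simp only: U)
    qed
    show ?thesis
      using L[of \<mu>] L[of ?\<nu>] pos LIMSEQ_unique by simp
  qed
  moreover have "emeasure \<mu> {x<..} = emeasure \<mu> {0<..}" if "x \<le> 0"
  proof (rule emeasure_eq_AE)
    show "AE y in \<mu>. (y \<in> {x<..}) = (y \<in> {0<..})"
      by (rule AE_I[of _ _ "{..0}"]) (use that in \<open>auto simp: emeasure_\<mu>_nonpos\<close>)
  qed auto
  moreover have "emeasure ?\<nu> {x<..} = emeasure ?\<nu> {0<..}" if "x \<le> 0"
    using that by (subst (1 2) emeasure_density) (auto intro!: nn_integral_cong simp: indicator_def)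
  ultimately show "emeasure \<mu> {x<..} = emeasure ?\<nu> {x<..}"
    using pos[of x] by (cases "x \<le> 0") simp_all
qed simp_all

text \<open>Inserting the density into the definition of \<open>G\<close> cancels the factor
  \<open>z\<close>. The result is the integrated form of the linear equation
  \<open>G' = - R G\<close>.\<close>

lemma G_eq: "0 < y \<Longrightarrow> G y = (\<integral>\<^sup>+z\<in>{y..}. ennreal (R z) * G z \<partial>lborel)"
proof -
  assume y: "0 < y"
  have "G y = (\<integral>\<^sup>+z. ennreal z * G z * indicator {0<..} z * (ennreal (R z / z) * indicator {y..} z) \<partial>lborel)"
    unfolding G_def[of y] by (subst \<mu>_density, subst nn_integral_density) simp_all
  also have "\<dots> = (\<integral>\<^sup>+z\<in>{y..}. ennreal (R z) * G z \<partial>lborel)"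
  proof (intro nn_integral_cong)
    fix z
    have "ennreal z * ennreal (R z / z) = ennreal (R z)" if "0 < z"
      using that R_nonneg[of z] by (subst ennreal_mult[symmetric]) auto
    moreover have "ennreal z * G z * indicator {0<..} z * (ennreal (R z / z) * indicator {y..} z)
        = ennreal z * ennreal (R z / z) * G z * (indicator {0<..} z * indicator {y..} z)"
      by (simp only: mult_ac)
    ultimately show "ennreal z * G z * indicator {0<..} z * (ennreal (R z / z) * indicator {y..} z) = ennreal (R z) * G z * indicator {y..} z"
      using y by (cases "y \<le> z") simp_all
  qed
  finally show ?thesis .
qed

lemma G_split: "0 < a \<Longrightarrow> a \<le> b \<Longrightarrow> G a = G b + (\<integral>\<^sup>+z\<in>{a..b}. ennreal (R z) * G z \<partial>lborel)"
proof -
  assume a: "0 < a" "a \<le> b"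
  have "G a = (\<integral>\<^sup>+z. ennreal (R z) * G z * indicator {b..} z + ennreal (R z) * G z * indicator {a..b} z \<partial>lborel)"
    unfolding G_eq[OF a(1)]
    by (intro nn_integral_cong_AE, use AE_lborel_singleton[of b] in eventually_elim) (use a in \<open>auto simp: indicator_def\<close>)
  also have "\<dots> = (\<integral>\<^sup>+z. ennreal (R z) * G z * indicator {b..} z \<partial>lborel) + (\<integral>\<^sup>+z. ennreal (R z) * G z * indicator {a..b} z \<partial>lborel)"
    by (rule nn_integral_add) measurable
  finally show ?thesis using G_eq[of b] a by simp
qed

text \<open>Evaluating \<open>\<integral> R e\<^sup>H G\<close> over \<open>[a, b]\<close> in two ways by Fubini avoids differentiating \<open>e\<^sup>H G\<close>.\<close>

lemma G_exp_eq:
  assumes a: "0 < a" "a \<le> b"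
  shows "ennreal (exp (H a)) * G a = ennreal (exp (H b)) * G b"
proof -
  let ?I = "\<integral>\<^sup>+z\<in>{a..b}. ennreal (R z) * G z \<partial>lborel"
  define J where "J = (\<integral>\<^sup>+z\<in>{a..b}. ennreal (R z) * ennreal (exp (H z)) * G z \<partial>lborel)"
  have expm: "exp (H a) \<le> exp (H b)" using H_mono[OF a(2)] by simp
  have Re: "(\<integral>\<^sup>+z\<in>{p..q}. ennreal (R z) * ennreal (exp (H z)) \<partial>lborel) = ennreal (exp (H q) - exp (H p))" if "a \<le> p" "p \<le> q" for p q
    using nn_R_exp[of p q] that a by simp
  have "J \<le> (\<integral>\<^sup>+z. G a * (ennreal (R z) * ennreal (exp (H z)) * indicator {a..b} z) \<partial>lborel)"
    unfolding J_def by (intro nn_integral_mono) (auto simp: indicator_def mult_ac intro!: mult_right_mono mult_left_mono G_antimono)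
  also have "\<dots> = G a * ennreal (exp (H b) - exp (H a))"
    using Re[of a b] a by (subst nn_integral_cmult) auto
  also have "\<dots> < top" using G_finite[OF a(1)] by (simp add: ennreal_mult_less_top)
  \<comment> \<open>Finiteness permits cancelling the common double integral \<open>?K\<close> at
    the end.\<close>
  finally have J_fin: "J \<noteq> top" by simp
  \<comment> \<open>First evaluation: replace \<open>G z\<close> by \<open>G b\<close> plus the
    integral of \<open>R G\<close> over [z, b] and integrate in \<open>z\<close> first.\<close>
  have "J = (\<integral>\<^sup>+z. G b * (ennreal (R z) * ennreal (exp (H z)) * indicator {a..b} z)
      + (\<integral>\<^sup>+w. ennreal (R z) * ennreal (exp (H z)) * (ennreal (R w) * G w) * (if a \<le> z \<and> z \<le> w \<and> w \<le> b then 1 else 0) \<partial>lborel) \<partial>lborel)"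
    unfolding J_def
  proof (intro nn_integral_cong)
    fix z
    show "ennreal (R z) * ennreal (exp (H z)) * G z * indicator {a..b} z = G b * (ennreal (R z) * ennreal (exp (H z)) * indicator {a..b} z)
      + (\<integral>\<^sup>+w. ennreal (R z) * ennreal (exp (H z)) * (ennreal (R w) * G w) * (if a \<le> z \<and> z \<le> w \<and> w \<le> b then 1 else 0) \<partial>lborel)"
    proof (cases "z \<in> {a..b}")
      case True
      have "(\<integral>\<^sup>+w. ennreal (R z) * ennreal (exp (H z)) * (ennreal (R w) * G w) * (if a \<le> z \<and> z \<le> w \<and> w \<le> b then 1 else 0) \<partial>lborel)
        = (\<integral>\<^sup>+w. (ennreal (R z) * ennreal (exp (H z))) * (ennreal (R w) * G w * indicator {z..b} w) \<partial>lborel)"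
        using True by (intro nn_integral_cong) (auto simp: indicator_def mult_ac)
      also have "\<dots> = (ennreal (R z) * ennreal (exp (H z))) * (\<integral>\<^sup>+w\<in>{z..b}. ennreal (R w) * G w \<partial>lborel)"
        by (rule nn_integral_cmult) measurable
      finally show ?thesis using True a G_split[of z b] by (simp add: distrib_left mult_ac)
    next
      case False
      then have "(if a \<le> z \<and> z \<le> w \<and> w \<le> b then 1 else 0) = (0::ennreal)" for w by auto
      then show ?thesis using False by (simp only:) simp
    qed
  qed
  also have "\<dots> = (\<integral>\<^sup>+z. G b * (ennreal (R z) * ennreal (exp (H z)) * indicator {a..b} z) \<partial>lborel)
      + (\<integral>\<^sup>+z. (\<integral>\<^sup>+w. ennreal (R z) * ennreal (exp (H z)) * (ennreal (R w) * G w) * (if a \<le> z \<and> z \<le> w \<and> w \<le> b then 1 else 0) \<partial>lborel) \<partial>lborel)"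
    by (rule nn_integral_add) measurable
  also have "(\<integral>\<^sup>+z. G b * (ennreal (R z) * ennreal (exp (H z)) * indicator {a..b} z) \<partial>lborel) = G b * ennreal (exp (H b) - exp (H a))"
    using Re[of a b] a by (subst nn_integral_cmult) auto
  also have "(\<integral>\<^sup>+z. (\<integral>\<^sup>+w. ennreal (R z) * ennreal (exp (H z)) * (ennreal (R w) * G w) * (if a \<le> z \<and> z \<le> w \<and> w \<le> b then 1 else 0) \<partial>lborel) \<partial>lborel)
     = (\<integral>\<^sup>+w. (\<integral>\<^sup>+z. ennreal (R z) * ennreal (exp (H z)) * (ennreal (R w) * G w) * (if a \<le> z \<and> z \<le> w \<and> w \<le> b then 1 else 0) \<partial>lborel) \<partial>lborel)"
    by (rule nn_integral_swap) measurable
  also have "\<dots> = (\<integral>\<^sup>+w. (ennreal (R w) * G w) * ennreal (exp (H w) - exp (H a)) * indicator {a..b} w \<partial>lborel)"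
  proof (intro nn_integral_cong)
    fix w
    show "(\<integral>\<^sup>+z. ennreal (R z) * ennreal (exp (H z)) * (ennreal (R w) * G w) * (if a \<le> z \<and> z \<le> w \<and> w \<le> b then 1 else 0) \<partial>lborel)
      = (ennreal (R w) * G w) * ennreal (exp (H w) - exp (H a)) * indicator {a..b} w"
    proof (cases "w \<in> {a..b}")
      case True
      have "(\<integral>\<^sup>+z. ennreal (R z) * ennreal (exp (H z)) * (ennreal (R w) * G w) * (if a \<le> z \<and> z \<le> w \<and> w \<le> b then 1 else 0) \<partial>lborel)
        = (\<integral>\<^sup>+z. (ennreal (R w) * G w) * (ennreal (R z) * ennreal (exp (H z)) * indicator {a..w} z) \<partial>lborel)"
        using True by (intro nn_integral_cong) (auto simp: indicator_def mult_ac)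
      also have "\<dots> = (ennreal (R w) * G w) * (\<integral>\<^sup>+z\<in>{a..w}. ennreal (R z) * ennreal (exp (H z)) \<partial>lborel)"
        by (rule nn_integral_cmult) measurable
      finally show ?thesis using True Re[of a w] by simp
    next
      case False
      then have "(if a \<le> z \<and> z \<le> w \<and> w \<le> b then 1 else 0) = (0::ennreal)" for z by auto
      then show ?thesis using False by (simp only:) simp
    qed
  qed
  finally have J1: "J = G b * ennreal (exp (H b) - exp (H a))
    + (\<integral>\<^sup>+w. (ennreal (R w) * G w) * ennreal (exp (H w) - exp (H a)) * indicator {a..b} w \<partial>lborel)" .
  \<comment> \<open>Second evaluation: split \<open>e^(H w)\<close> into its increment from
    \<open>a\<close> and the constant \<open>e^(H a)\<close>.\<close>
  have "J = (\<integral>\<^sup>+w. (ennreal (R w) * G w) * ennreal (exp (H w) - exp (H a)) * indicator {a..b} w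
      + ennreal (exp (H a)) * (ennreal (R w) * G w * indicator {a..b} w) \<partial>lborel)"
    unfolding J_def
  proof (intro nn_integral_cong)
    fix w
    have "ennreal (exp (H w)) = ennreal (exp (H w) - exp (H a)) + ennreal (exp (H a))" if "a \<le> w"
      using H_mono[OF that] by (simp add: ennreal_plus[symmetric] del: ennreal_plus)
    then show "ennreal (R w) * ennreal (exp (H w)) * G w * indicator {a..b} w
      = (ennreal (R w) * G w) * ennreal (exp (H w) - exp (H a)) * indicator {a..b} w
      + ennreal (exp (H a)) * (ennreal (R w) * G w * indicator {a..b} w)"
      by (cases "w \<in> {a..b}") (simp_all add: distrib_left distrib_right mult_ac)
  qed
  also have "\<dots> = (\<integral>\<^sup>+w. (ennreal (R w) * G w) * ennreal (exp (H w) - exp (H a)) * indicator {a..b} w \<partial>lborel)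
      + ennreal (exp (H a)) * ?I"
    by (subst nn_integral_add) (simp_all add: nn_integral_cmult)
  finally have J2: "J = (\<integral>\<^sup>+w. (ennreal (R w) * G w) * ennreal (exp (H w) - exp (H a)) * indicator {a..b} w \<partial>lborel)
      + ennreal (exp (H a)) * ?I" .
  let ?K = "\<integral>\<^sup>+w. (ennreal (R w) * G w) * ennreal (exp (H w) - exp (H a)) * indicator {a..b} w \<partial>lborel"
  have "?K \<noteq> top" using J_fin J2 by auto
  moreover have "?K + G b * ennreal (exp (H b) - exp (H a)) = ?K + ennreal (exp (H a)) * ?I"
    unfolding J2[symmetric] unfolding J1 by (rule add.commute)
  ultimately have "G b * ennreal (exp (H b) - exp (H a)) = ennreal (exp (H a)) * ?I"
    by (simp add: ennreal_add_left_cancel)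
  then have "ennreal (exp (H a)) * G a = ennreal (exp (H a)) * G b + G b * ennreal (exp (H b) - exp (H a))"
    using G_split[OF a] by (simp add: distrib_left)
  also have "\<dots> = G b * (ennreal (exp (H a)) + ennreal (exp (H b) - exp (H a)))"
    by (simp add: distrib_left mult.commute)
  also have "ennreal (exp (H a)) + ennreal (exp (H b) - exp (H a)) = ennreal (exp (H b))"
    using expm by (simp add: ennreal_plus[symmetric] del: ennreal_plus)
  finally show ?thesis by (simp add: mult.commute)
qed

lemma G_explicit:
  obtains c where "0 < c" "\<And>y. 0 < y \<Longrightarrow> G y = ennreal (c * exp (- H y))"
proof -
  \<comment> \<open>The product \<open>e^H G\<close> is constant on (0,\<infinity>); the point 1 is
    an arbitrary place to read off its value.\<close>
  have "ennreal (exp (H 1)) * G 1 < top" using G_finite[of 1] by (simp add: ennreal_mult_less_top)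
  then obtain c where c: "ennreal (exp (H 1)) * G 1 = ennreal c" "0 \<le> c"
    by (cases "ennreal (exp (H 1)) * G 1") auto
  have G: "G y = ennreal (c * exp (- H y))" if "0 < y" for y
  proof -
    have "ennreal (exp (H y)) * G y = ennreal c"
      using G_exp_eq[of y 1] G_exp_eq[of 1 y] that c(1) by (cases "y \<le> 1") auto
    then have "ennreal (exp (- H y)) * (ennreal (exp (H y)) * G y) = ennreal (c * exp (- H y))"
      using c(2) by (simp add: ennreal_mult mult.commute)
    moreover have "ennreal (exp (- H y)) * ennreal (exp (H y)) = 1"
      by (subst ennreal_mult[symmetric]) (simp_all add: exp_minus)
    ultimately show ?thesis by (simp add: mult.assoc[symmetric])
  qed
  \<comment> \<open>For \<open>c = 0\<close> the density would vanish, against total mass 1.\<close>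
  have "c \<noteq> 0"
  proof
    assume "c = 0"
    then have "emeasure \<mu> UNIV = 0"
      by (subst \<mu>_density, subst emeasure_density)
         (auto intro!: nn_integral_zero' AE_I2 simp: G indicator_def)
    moreover interpret real_distribution \<mu> by (rule real_distribution_\<mu>)
    have "emeasure \<mu> UNIV = 1" using emeasure_space_1 by simp
    ultimately show False by simp
  qed
  then show ?thesis using that[of c] c(2) G by simp
qed

text \<open>Everything that is used later of the Stationarity Assumption. The tail identity is
  \<open>G_eq\<close> divided by \<open>c\<close>.\<close>

lemma stationary_density:
  obtains c where "0 < c"
    "\<And>g. g \<in> borel_measurable borel \<Longrightarrow>
      (\<integral>\<^sup>+x. g x \<partial>stationary_measure Fd) = (\<integral>\<^sup>+x\<in>{0<..}. g x * ennreal (c * x * exp (- H x)) \<partial>lborel)"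
    "\<And>v. 0 < v \<Longrightarrow> (\<integral>\<^sup>+z\<in>{v..}. ennreal (R z) * ennreal (exp (- H z)) \<partial>lborel) = ennreal (exp (- H v))"
    "prob_space (stationary_measure Fd)"
proof -
  obtain c where c: "0 < c" "\<And>y. 0 < y \<Longrightarrow> G y = ennreal (c * exp (- H y))" using G_explicit by blast
  show ?thesis
  proof (rule that[OF c(1)])
    fix g :: "real \<Rightarrow> ennreal" assume [measurable]: "g \<in> borel_measurable borel"
    have "(\<integral>\<^sup>+x. g x \<partial>stationary_measure Fd) = (\<integral>\<^sup>+x\<in>{0<..}. g x \<partial>\<mu>)"
      unfolding stationary_measure_def by (rule nn_integral_restrict_space) simp
    also have "\<dots> = (\<integral>\<^sup>+x. ennreal x * G x * indicator {0<..} x * (g x * indicator {0<..} x) \<partial>lborel)"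
      by (subst \<mu>_density, subst nn_integral_density) simp_all
    also have "\<dots> = (\<integral>\<^sup>+x\<in>{0<..}. g x * ennreal (c * x * exp (- H x)) \<partial>lborel)"
      using c by (intro nn_integral_cong) (auto simp: indicator_def ennreal_mult mult_ac)
    finally show "(\<integral>\<^sup>+x. g x \<partial>stationary_measure Fd) = (\<integral>\<^sup>+x\<in>{0<..}. g x * ennreal (c * x * exp (- H x)) \<partial>lborel)" .
  next
    fix v :: real assume v: "0 < v"
    have "ennreal c * (\<integral>\<^sup>+z\<in>{v..}. ennreal (R z) * ennreal (exp (- H z)) \<partial>lborel)
        = (\<integral>\<^sup>+z. ennreal c * (ennreal (R z) * ennreal (exp (- H z)) * indicator {v..} z) \<partial>lborel)"
      by (rule nn_integral_cmult[symmetric]) measurable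
    also have "\<dots> = (\<integral>\<^sup>+z\<in>{v..}. ennreal (R z) * G z \<partial>lborel)"
      using c v by (intro nn_integral_cong) (auto simp: indicator_def ennreal_mult mult_ac)
    also have "\<dots> = ennreal c * ennreal (exp (- H v))"
      using G_eq[OF v] c v by (simp add: ennreal_mult)
    finally show "(\<integral>\<^sup>+z\<in>{v..}. ennreal (R z) * ennreal (exp (- H z)) \<partial>lborel) = ennreal (exp (- H v))"
      using c(1) by (subst (asm) ennreal_mult_cancel_left) auto
  next
    interpret real_distribution \<mu> by (rule real_distribution_\<mu>)
    have "emeasure \<mu> {0<..} = emeasure \<mu> UNIV"
      by (rule emeasure_eq_AE, rule AE_I[of _ _ "{..0}"]) (auto simp: emeasure_\<mu>_nonpos)
    then have "emeasure \<mu> {0<..} = 1" using emeasure_space_1 by simp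
    then show "prob_space (stationary_measure Fd)"
      unfolding stationary_measure_def
      by (intro prob_spaceI) (simp add: emeasure_restrict_space space_restrict_space)
  qed
qed

end
end

section \<open>Invariance\<close>

text \<open>The square root of a uniform variable has density 2w on [0,1]; hence the kernel of the
  generator.\<close>

lemma nn_integral_unif_sqrt:
  assumes [measurable]: "\<phi> \<in> borel_measurable borel"
  shows "(\<integral>\<^sup>+b. \<phi> (sqrt b) \<partial>unif) = (\<integral>\<^sup>+w\<in>{0..1}. ennreal (2 * w) * \<phi> w \<partial>lborel)"
proof -
  have "(\<integral>\<^sup>+b. \<phi> (sqrt b) \<partial>unif) = (\<integral>\<^sup>+b\<in>{0<..<1}. \<phi> (sqrt b) \<partial>lborel)"
    by (rule nn_integral_unif) measurable
  also have "\<dots> = (\<integral>\<^sup>+b. \<phi> (sqrt b) * indicator {0\<^sup>2..1\<^sup>2} b \<partial>lborel)"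
  proof (rule nn_integral_cong_AE)
    show "AE b in lborel. \<phi> (sqrt b) * indicator {0<..<1} b = \<phi> (sqrt b) * indicator {0\<^sup>2..1\<^sup>2} b"
      using AE_lborel_singleton[of "0::real"] AE_lborel_singleton[of "1::real"]
      by eventually_elim (auto simp: indicator_def)
  qed
  also have "\<dots> = (\<integral>\<^sup>+w. \<phi> (sqrt (w\<^sup>2)) * ennreal (2 * w) * indicator {0..1} w \<partial>lborel)"
    by (rule nn_integral_substitution_aux) (auto intro!: derivative_eq_intros continuous_intros)
  also have "\<dots> = (\<integral>\<^sup>+w\<in>{0..1}. ennreal (2 * w) * \<phi> w \<partial>lborel)"
    by (intro nn_integral_cong) (auto simp: indicator_def mult_ac)
  finally show ?thesis .
qed

lemma emeasure_unif_Ico: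
  assumes "0 < p" "q \<le> 1"
  shows "emeasure unif {p..<q} = ennreal (q - p)"
proof -
  have "emeasure unif {p..<q} = (\<integral>\<^sup>+a. indicator {p..<q} a \<partial>unif)" by simp
  also have "\<dots> = (\<integral>\<^sup>+a\<in>{0<..<1}. indicator {p..<q} a \<partial>lborel)" by (rule nn_integral_unif) measurable
  also have "\<dots> = (\<integral>\<^sup>+a. indicator {p..<q} a \<partial>lborel)"
    using assms by (intro nn_integral_cong) (auto simp: indicator_def)
  also have "\<dots> = ennreal (q - p)" by (cases "p \<le> q") (simp_all add: ennreal_neg)
  finally show ?thesis .
qed

context rate
begin

section \<open>Law of the first jump\<close>

definition S0 :: "real \<Rightarrow> real \<Rightarrow> real" where "S0 s x = exp (H x - H (x * exp s))"

lemma S0_measurable [measurable (raw)]: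
  assumes [measurable]: "s \<in> borel_measurable N" "x \<in> borel_measurable N"
  shows "(\<lambda>w. S0 (s w) (x w)) \<in> borel_measurable N"
  unfolding S0_def by measurable

lemma S0_bounds: "0 < S0 s x" "0 \<le> s \<Longrightarrow> S0 s x \<le> 1"
  using survival_le_1[of s x] by (simp_all add: S0_def)

lemma S0_antimono: "s \<le> t \<Longrightarrow> S0 t x \<le> S0 s x"
  using H_growth_mono[of s t x] by (simp add: S0_def)

lemma S0_zero [simp]: "S0 0 x = 1"
  by (simp add: S0_def)

text \<open>\<open>R\<close> is a rate per unit of size. Along \<open>x e^s\<close> the size grows
  at speed \<open>x e^s\<close>, which makes this product the rate per unit of time.\<close>

definition jrate :: "real \<Rightarrow> real" where "jrate x = x * R x"

lemma jrate_measurable [measurable]: "jrate \<in> borel_measurable borel"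
  unfolding jrate_def by measurable

lemma jrate_nonneg: "0 \<le> x \<Longrightarrow> 0 \<le> jrate x"
  by (simp add: jrate_def R_nonneg)

text \<open>Formally the integrand is minus the derivative of \<open>S0\<close> in \<open>s\<close>.
  Substituting \<open>z = x e^s\<close> reduces the claim to \<open>nn_R_exp_neg\<close>.\<close>

lemma nn_integral_hazard:
  assumes x: "0 < x" and c: "0 \<le> c" "c \<le> T"
  shows "(\<integral>\<^sup>+s\<in>{c..T}. ennreal (jrate (x * exp s) * S0 s x) \<partial>lborel) = ennreal (S0 c x - S0 T x)"
proof (cases "c = T")
  case True
  have "AE s in lborel. ennreal (jrate (x * exp s) * S0 s x) * indicator {c..T} s = 0"
    using AE_lborel_singleton[of c] by eventually_elim (auto simp: indicator_def True)
  then have "(\<integral>\<^sup>+s\<in>{c..T}. ennreal (jrate (x * exp s) * S0 s x) \<partial>lborel) = (\<integral>\<^sup>+s. 0 \<partial>(lborel :: real measure))"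
    by (rule nn_integral_cong_AE)
  then show ?thesis using True by simp
next
  case False
  then have cT: "c < T" using c by simp
  let ?g = "\<lambda>s. x * exp s"
  have "(\<integral>\<^sup>+z. (ennreal (R z) * ennreal (exp (- H z))) * indicator {?g c..?g T} z \<partial>lborel)
      = (\<integral>\<^sup>+s. (ennreal (R (?g s)) * ennreal (exp (- H (?g s)))) * ennreal (?g s) * indicator {c..T} s \<partial>lborel)"
    using cT x by (intro nn_integral_substitution_aux) (auto intro!: derivative_eq_intros continuous_intros)
  then have "ennreal (exp (H x)) * ennreal (exp (- H (?g c)) - exp (- H (?g T)))
      = ennreal (exp (H x)) * (\<integral>\<^sup>+s. (ennreal (R (?g s)) * ennreal (exp (- H (?g s)))) * ennreal (?g s) * indicator {c..T} s \<partial>lborel)"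
    using x c by (subst (asm) nn_R_exp_neg) auto
  also have "\<dots> = (\<integral>\<^sup>+s. ennreal (exp (H x)) * ((ennreal (R (?g s)) * ennreal (exp (- H (?g s)))) * ennreal (?g s) * indicator {c..T} s) \<partial>lborel)"
    by (rule nn_integral_cmult[symmetric]) measurable
  also have "\<dots> = (\<integral>\<^sup>+s\<in>{c..T}. ennreal (jrate (x * exp s) * S0 s x) \<partial>lborel)"
  proof (intro nn_integral_cong)
    fix s
    have "ennreal (jrate (?g s) * S0 s x) = ennreal (exp (H x)) * (ennreal (R (?g s)) * ennreal (exp (- H (?g s))) * ennreal (?g s))"
      using x R_nonneg by (simp add: jrate_def S0_def exp_diff exp_minus ennreal_mult[symmetric] field_simps)
    then show "ennreal (exp (H x)) * ((ennreal (R (?g s)) * ennreal (exp (- H (?g s)))) * ennreal (?g s) * indicator {c..T} s)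
      = ennreal (jrate (x * exp s) * S0 s x) * indicator {c..T} s"
      by (simp add: mult_ac)
  qed
  finally have "(\<integral>\<^sup>+s\<in>{c..T}. ennreal (jrate (x * exp s) * S0 s x) \<partial>lborel)
      = ennreal (exp (H x)) * ennreal (exp (- H (?g c)) - exp (- H (?g T)))" by simp
  also have "\<dots> = ennreal (exp (H x) * (exp (- H (?g c)) - exp (- H (?g T))))"
    using H_growth_mono[of c T x] c by (intro ennreal_mult[symmetric]) auto
  also have "exp (H x) * (exp (- H (?g c)) - exp (- H (?g T))) = S0 c x - S0 T x"
    by (simp add: S0_def right_diff_distrib exp_add[symmetric])
  finally show ?thesis .
qed

text \<open>Both measures are compared on rays: the waiting time exceeds \<open>c\<close> and is at
  most \<open>T\<close> exactly when the uniform variable lies between the survival probabilities at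
  \<open>T\<close> and at \<open>c\<close>.\<close>

lemma first_law_measure:
  assumes x: "0 < x" and T: "0 \<le> T"
  shows "distr (density unif (indicator {a. survival_inv R x a \<le> ennreal T})) borel (\<lambda>a. enn2real (survival_inv R x a))
    = density lborel (\<lambda>s. ennreal (jrate (x * exp s) * S0 s x) * indicator {0..T} s)" (is "?\<nu>1 = ?\<nu>2")
proof (rule measure_eqI_lessThan)
  fix c :: real
  have A: "{a. survival_inv R x a \<le> ennreal T} \<in> sets borel"
    using T by (simp add: survival_inv_le_iff atLeast_def[symmetric])
  note [measurable] = A
  \<comment> \<open>Waiting times are positive, so a negative threshold acts like 0.\<close>
  define c' where "c' = max 0 c"
  have c': "0 \<le> c'" by (simp add: c'_def)
  have meas: "{a. c < enn2real (survival_inv R x a)} \<in> sets borel"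
    using measurable_sets_Collect[of "\<lambda>a. c < enn2real (survival_inv R x a)" borel] by simp
  have set_eq: "AE a in unif. a \<in> {a. survival_inv R x a \<le> ennreal T} \<inter> {a. c < enn2real (survival_inv R x a)}
      \<longleftrightarrow> a \<in> {S0 T x..<S0 c' x}"
    using AE_unif
  proof eventually_elim
    case (elim a)
    have "c < enn2real (survival_inv R x a) \<longleftrightarrow> a < S0 c' x" if le: "survival_inv R x a \<le> ennreal T"
    proof -
      have "survival_inv R x a < top" using le by (auto intro: order_le_less_trans)
      then obtain r where r: "survival_inv R x a = ennreal r" "0 \<le> r" by (cases "survival_inv R x a") auto
      have "0 < survival_inv R x a" using elim by (intro survival_inv_pos) simp
      then have "0 < r" using r by simp
      then show ?thesis
        using less_survival_inv_iff[OF c', of x a] r c' by (auto simp: S0_def c'_def ennreal_less_iff max_def split: if_splits)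
    qed
    then show ?case using T by (auto simp: survival_inv_le_iff S0_def)
  qed
  have "emeasure ?\<nu>1 {c<..} = emeasure (density unif (indicator {a. survival_inv R x a \<le> ennreal T})) {a. c < enn2real (survival_inv R x a)}"
    by (subst emeasure_distr) (auto simp: vimage_def)
  also have "\<dots> = (\<integral>\<^sup>+a. indicator {a. survival_inv R x a \<le> ennreal T} a * indicator {a. c < enn2real (survival_inv R x a)} a \<partial>unif)"
    using meas by (intro emeasure_density) auto
  also have "\<dots> = (\<integral>\<^sup>+a. indicator {S0 T x..<S0 c' x} a \<partial>unif)"
    using set_eq by (intro nn_integral_cong_AE) (auto elim!: eventually_mono simp: indicator_def)
  also have "\<dots> = ennreal (S0 c' x - S0 T x)"
    using S0_bounds(1)[of T x] S0_bounds(2)[of c' x] c' by (simp add: emeasure_unif_Ico)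
  finally have e1: "emeasure ?\<nu>1 {c<..} = ennreal (S0 c' x - S0 T x)" .
  then show "emeasure ?\<nu>1 {c<..} < \<infinity>" by simp
  have "emeasure ?\<nu>2 {c<..} = (\<integral>\<^sup>+s. ennreal (jrate (x * exp s) * S0 s x) * indicator {0..T} s * indicator {c<..} s \<partial>lborel)"
    by (rule emeasure_density) measurable
  also have "\<dots> = (\<integral>\<^sup>+s\<in>{c'..T}. ennreal (jrate (x * exp s) * S0 s x) \<partial>lborel)"
  proof (rule nn_integral_cong_AE)
    show "AE s in lborel. ennreal (jrate (x * exp s) * S0 s x) * indicator {0..T} s * indicator {c<..} s
        = ennreal (jrate (x * exp s) * S0 s x) * indicator {c'..T} s"
      using AE_lborel_singleton[of c] AE_lborel_singleton[of "0::real"]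
      by eventually_elim (auto simp: indicator_def c'_def max_def split: if_splits)
  qed
  also have "\<dots> = ennreal (S0 c' x - S0 T x)"
  proof (cases "c' \<le> T")
    case True
    then show ?thesis using nn_integral_hazard[OF x c'] by simp
  next
    case False
    then have "S0 c' x \<le> S0 T x" by (intro S0_antimono) simp
    then show ?thesis using False by (simp add: ennreal_neg)
  qed
  finally show "emeasure ?\<nu>1 {c<..} = emeasure ?\<nu>2 {c<..}" using e1 by simp
qed simp_all

lemma first_law:
  assumes x: "0 < x" and T: "0 \<le> T" and \<phi> [measurable]: "\<phi> \<in> borel_measurable borel"
  shows "(\<integral>\<^sup>+a. indicator {a. survival_inv R x a \<le> ennreal T} a * \<phi> (enn2real (survival_inv R x a)) \<partial>unif)
    = (\<integral>\<^sup>+s\<in>{0..T}. ennreal (jrate (x * exp s) * S0 s x) * \<phi> s \<partial>lborel)"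
proof -
  have [measurable]: "{a. survival_inv R x a \<le> ennreal T} \<in> sets borel"
    using T by (simp add: survival_inv_le_iff atLeast_def[symmetric])
  have "(\<integral>\<^sup>+a. indicator {a. survival_inv R x a \<le> ennreal T} a * \<phi> (enn2real (survival_inv R x a)) \<partial>unif)
      = (\<integral>\<^sup>+s. \<phi> s \<partial>distr (density unif (indicator {a. survival_inv R x a \<le> ennreal T})) borel (\<lambda>a. enn2real (survival_inv R x a)))"
    by (subst nn_integral_distr) (simp_all add: nn_integral_density)
  also have "\<dots> = (\<integral>\<^sup>+s. ennreal (jrate (x * exp s) * S0 s x) * indicator {0..T} s * \<phi> s \<partial>lborel)"
    unfolding first_law_measure[OF x T] by (rule nn_integral_density) measurable
  finally show ?thesis by (simp add: mult_ac)
qed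

section \<open>Decomposition of the semigroup by the number of jumps\<close>

definition Tn :: "nat \<Rightarrow> real \<Rightarrow> (real \<Rightarrow> ennreal) \<Rightarrow> real \<Rightarrow> ennreal" where
  "Tn n t f x = (\<integral>\<^sup>+v. indicator {v. count n v x t} v * f (Z v x t) \<partial>Om)"

text \<open>The expectation of \<open>h (z J)\<close> for a jump ratio \<open>J\<close>.\<close>

definition avg :: "(real \<Rightarrow> ennreal) \<Rightarrow> real \<Rightarrow> ennreal" where
  "avg h z = (\<integral>\<^sup>+u\<in>{0..1}. ennreal (2 * u) * h (z * u) \<partial>lborel)"

lemma Tn_measurable [measurable (raw)]:
  assumes [measurable]: "f \<in> borel_measurable borel" "t \<in> borel_measurable N" "x \<in> borel_measurable N"
  shows "(\<lambda>w. Tn n (t w) f (x w)) \<in> borel_measurable N"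
proof -
  note [measurable] = Om_component
  have "(\<lambda>(w, v). if count n v (x w) (t w) then f (Z v (x w) (t w)) else 0) \<in> borel_measurable (N \<Otimes>\<^sub>M Om)"
    by measurable
  then have "(\<lambda>w. \<integral>\<^sup>+v. (if count n v (x w) (t w) then f (Z v (x w) (t w)) else 0) \<partial>Om) \<in> borel_measurable N"
    by (rule canon.borel_measurable_nn_integral)
  moreover have "(\<lambda>w. \<integral>\<^sup>+v. (if count n v (x w) (t w) then f (Z v (x w) (t w)) else 0) \<partial>Om) = (\<lambda>w. Tn n (t w) f (x w))"
    unfolding Tn_def by (intro ext nn_integral_cong) (auto simp: indicator_def)
  ultimately show ?thesis by simp
qed

lemma Tn_0: "0 < x \<Longrightarrow> 0 \<le> t \<Longrightarrow> Tn 0 t f x = ennreal (S0 t x) * f (x * exp t)"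
proof -
  assume x: "0 < x" and t: "0 \<le> t"
  have "Tn 0 t f x = (\<integral>\<^sup>+v. f (x * exp t) * (indicator {v. v 0 < S0 t x} v * 1) \<partial>Om)"
    unfolding Tn_def
  proof (intro nn_integral_cong)
    fix v
    show "indicator {v. count 0 v x t} v * f (Z v x t) = f (x * exp t) * (indicator {v. v 0 < S0 t x} v * 1)"
      using Z_before[OF x, of t v] less_survival_inv_iff[OF t, of x "v 0"]
      by (auto simp: indicator_def count_0_iff first_def S0_def)
  qed
  also have "\<dots> = f (x * exp t) * (\<integral>\<^sup>+v. indicator {v. v 0 < S0 t x} v * 1 \<partial>Om)"
  proof (rule nn_integral_cmult)
    note [measurable] = Om_component
    have A: "{v. v 0 < S0 t x} \<in> sets Om"
      using measurable_sets_Collect[of "\<lambda>v. v 0 < S0 t x" Om] by (simp add: pred_def[symmetric])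
    show "(\<lambda>v. indicator {v. v 0 < S0 t x} v * (1::ennreal)) \<in> borel_measurable Om"
      by (intro borel_measurable_times_ennreal borel_measurable_indicator A) simp
  qed
  also have "(\<integral>\<^sup>+v. indicator {v. v 0 < S0 t x} v * 1 \<partial>Om) = ennreal (S0 t x)"
    using nn_integral_Om_scale[of "\<lambda>_. 1" "S0 t x"] S0_bounds[of t x] t by (simp add: canon.emeasure_space_1[simplified])
  finally show ?thesis by (simp add: mult.commute)
qed

text \<open>Integrate out the two variables of the first jump: one gives its time \<open>s\<close>,
  the other its ratio. What remains is the contribution of one jump fewer during
  \<open>t - s\<close>.\<close>

lemma Tn_Suc:
  assumes x: "0 < x" and t: "0 \<le> t" and f [measurable]: "f \<in> borel_measurable borel"
  shows "Tn (Suc n) t f x = (\<integral>\<^sup>+s\<in>{0..t}. ennreal (jrate (x * exp s) * S0 s x) * avg (Tn n (t - s) f) (x * exp s) \<partial>lborel)"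
proof -
  have m: "(\<lambda>v. indicator {v. count (Suc n) v x t} v * f (Z v x t)) \<in> borel_measurable Om"
    by (intro borel_measurable_times_ennreal borel_measurable_indicator count_Om_sets measurable_compose[OF Z_Om_measurable f])
  have inner: "(\<integral>\<^sup>+v. indicator {v. count (Suc n) v x t} (case_nat a (case_nat b v)) * f (Z (case_nat a (case_nat b v)) x t) \<partial>Om)
      = indicator {a. survival_inv R x a \<le> ennreal t} a *
        Tn n (t - enn2real (survival_inv R x a)) f (x * exp (enn2real (survival_inv R x a)) * sqrt b)"
    if ab: "0 < a" "a < 1" "0 < b" "b < 1" for a b
  proof (cases "survival_inv R x a \<le> ennreal t")
    case False
    then have "\<not> count (Suc n) (case_nat a (case_nat b w)) x t" for w
      by (intro not_count_Suc) (simp add: first_def not_le)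
    then show ?thesis using False by simp
  next
    case True
    let ?v = "\<lambda>w. case_nat a (case_nat b w)"
    have fv: "first (?v w) x = survival_inv R x a" "shift (?v w) = w"
      "after (?v w) x = x * exp (enn2real (survival_inv R x a)) * sqrt b" for w
      by (auto simp: first_def after_def shift_def fun_eq_iff)
    have gv: "good (?v w)" if "good w" for w
      using that ab by (auto simp: good_def split: nat.split)
    have "(\<integral>\<^sup>+v. indicator {v. count (Suc n) v x t} (?v v) * f (Z (?v v) x t) \<partial>Om)
      = Tn n (t - enn2real (survival_inv R x a)) f (x * exp (enn2real (survival_inv R x a)) * sqrt b)"
      unfolding Tn_def
    proof (rule nn_integral_cong_AE, use AE_good in eventually_elim)
      case (elim w)
      show ?case
        using count_Suc_iff[OF t, of "?v w" x n] Z_after[OF t _ x gv[OF elim]] True by (simp add: fv indicator_def)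
    qed
    then show ?thesis using True by simp
  qed
  have "Tn (Suc n) t f x = (\<integral>\<^sup>+a. (\<integral>\<^sup>+b. indicator {a. survival_inv R x a \<le> ennreal t} a *
        Tn n (t - enn2real (survival_inv R x a)) f (x * exp (enn2real (survival_inv R x a)) * sqrt b) \<partial>unif) \<partial>unif)"
    unfolding Tn_def[of "Suc n"] nn_integral_Om_case2[OF m]
    by (rule nn_integral_cong_AE, rule eventually_mono[OF AE_unif],
        rule nn_integral_cong_AE, rule eventually_mono[OF AE_unif], rule inner) auto
  also have "\<dots> = (\<integral>\<^sup>+a. indicator {a. survival_inv R x a \<le> ennreal t} a *
        avg (Tn n (t - enn2real (survival_inv R x a)) f) (x * exp (enn2real (survival_inv R x a))) \<partial>unif)"
  proof (intro nn_integral_cong)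
    fix a
    have "(\<integral>\<^sup>+b. Tn n s f (z * sqrt b) \<partial>unif) = avg (Tn n s f) z" for s z
      unfolding avg_def by (rule nn_integral_unif_sqrt[of "\<lambda>w. Tn n s f (z * w)"]) measurable
    moreover have "(\<integral>\<^sup>+b. indicator {a. survival_inv R x a \<le> ennreal t} a * Tn n s f (z * sqrt b) \<partial>unif)
      = indicator {a. survival_inv R x a \<le> ennreal t} a * (\<integral>\<^sup>+b. Tn n s f (z * sqrt b) \<partial>unif)" for s z
      by (rule nn_integral_cmult) measurable
    ultimately show "(\<integral>\<^sup>+b. indicator {a. survival_inv R x a \<le> ennreal t} a *
        Tn n (t - enn2real (survival_inv R x a)) f (x * exp (enn2real (survival_inv R x a)) * sqrt b) \<partial>unif)
      = indicator {a. survival_inv R x a \<le> ennreal t} a *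
        avg (Tn n (t - enn2real (survival_inv R x a)) f) (x * exp (enn2real (survival_inv R x a)))"
      by simp
  qed
  also have "\<dots> = (\<integral>\<^sup>+s\<in>{0..t}. ennreal (jrate (x * exp s) * S0 s x) * avg (Tn n (t - s) f) (x * exp s) \<partial>lborel)"
    using x t by (rule first_law) (unfold avg_def, measurable)
  finally show ?thesis .
qed

end

text \<open>By \<open>nn_R_exp_neg\<close>, \<open>tail\<close> expresses that \<open>e^(-H)\<close>
  tends to 0 at \<infinity>, so from a positive start the first waiting time is almost surely
  finite. \<open>mass\<close> fixes the normalisation.\<close>

locale stationary_rate = rate +
  fixes c :: real
  assumes c_pos: "0 < c"
    and tail: "\<And>v. 0 < v \<Longrightarrow> (\<integral>\<^sup>+z\<in>{v..}. ennreal (R z) * ennreal (exp (- H z)) \<partial>lborel) = ennreal (exp (- H v))"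
    and mass: "(\<integral>\<^sup>+x\<in>{0<..}. ennreal (c * x * exp (- H x)) \<partial>lborel) = 1"
begin

definition dens :: "real \<Rightarrow> ennreal" where
  "dens x = ennreal (c * x * exp (- H x)) * indicator {0<..} x"

lemma dens_measurable [measurable]: "dens \<in> borel_measurable borel"
  unfolding dens_def by measurable

lemma dens_nonpos: "x \<le> 0 \<Longrightarrow> dens x = 0"
  by (simp add: dens_def)

text \<open>The survival factor changes \<open>e^(-H(x))\<close> into \<open>e^(-H(x e^s))\<close>.
  Substituting for \<open>x e^s\<close> then costs one factor \<open>e^(-s)\<close> from the
  Jacobian and one from the weight x.\<close>

lemma dens_flow:
  assumes [measurable]: "g \<in> borel_measurable borel"
  shows "(\<integral>\<^sup>+x. dens x * (ennreal (S0 s x) * g (x * exp s)) \<partial>lborel) = ennreal (exp (- 2 * s)) * (\<integral>\<^sup>+x. dens x * g x \<partial>lborel)"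
proof -
  have "(\<integral>\<^sup>+x. dens x * g x \<partial>lborel) = ennreal (exp s) * (\<integral>\<^sup>+x. dens (exp s * x) * g (exp s * x) \<partial>lborel)"
    by (subst nn_integral_real_affine[where t = 0 and c = "exp s"]) simp_all
  then have "ennreal (exp (- 2 * s)) * (\<integral>\<^sup>+x. dens x * g x \<partial>lborel)
      = ennreal (exp (- s)) * (\<integral>\<^sup>+x. dens (exp s * x) * g (exp s * x) \<partial>lborel)"
    by (simp add: mult.assoc[symmetric] ennreal_mult[symmetric] exp_add[symmetric])
  also have "\<dots> = (\<integral>\<^sup>+x. ennreal (exp (- s)) * (dens (exp s * x) * g (exp s * x)) \<partial>lborel)"
    by (rule nn_integral_cmult[symmetric]) measurable
  also have "\<dots> = (\<integral>\<^sup>+x. dens x * (ennreal (S0 s x) * g (x * exp s)) \<partial>lborel)"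
  proof (intro nn_integral_cong)
    fix x
    have "ennreal (exp (- s)) * dens (exp s * x) = dens x * ennreal (S0 s x)"
    proof (cases "0 < x")
      case True
      have "exp (- s) * (c * (exp s * x) * exp (- H (exp s * x))) = (c * x * exp (- H x)) * S0 s x"
        by (simp add: S0_def exp_diff exp_minus field_simps)
      then show ?thesis using True c_pos
        by (simp add: dens_def zero_less_mult_iff ennreal_mult[symmetric] S0_bounds less_imp_le)
    next
      case False
      then show ?thesis by (simp add: dens_def zero_less_mult_iff)
    qed
    then show "ennreal (exp (- s)) * (dens (exp s * x) * g (exp s * x)) = dens x * (ennreal (S0 s x) * g (x * exp s))"
      by (simp add: mult.assoc[symmetric] mult.commute[of "exp s" x])
  qed
  finally show ?thesis by simp
qed

text \<open>The substitution \<open>v = z u\<close> yields the kernel \<open>2v / z^2\<close>; the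
  square is kept on the left to avoid division in [0,\<infinity>].\<close>

lemma avg_eq:
  assumes [measurable]: "h \<in> borel_measurable borel" and z: "0 < z"
  shows "ennreal (z\<^sup>2) * avg h z = (\<integral>\<^sup>+v\<in>{0..z}. ennreal (2 * v) * h v \<partial>lborel)"
proof -
  have "(\<integral>\<^sup>+v\<in>{0..z}. ennreal (2 * v) * h v \<partial>lborel)
      = ennreal z * (\<integral>\<^sup>+u. ennreal (2 * (z * u)) * h (z * u) * indicator {0..z} (z * u) \<partial>lborel)"
    using z by (subst nn_integral_real_affine[where t = 0 and c = z]) simp_all
  also have "(\<integral>\<^sup>+u. ennreal (2 * (z * u)) * h (z * u) * indicator {0..z} (z * u) \<partial>lborel)
      = (\<integral>\<^sup>+u. ennreal z * (ennreal (2 * u) * h (z * u) * indicator {0..1} u) \<partial>lborel)"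
  proof (intro nn_integral_cong)
    fix u
    have "indicator {0..z} (z * u) = (indicator {0..1} u :: ennreal)"
      using z by (auto simp: indicator_def zero_le_mult_iff mult_le_cancel_left1)
    moreover have "ennreal (2 * (z * u)) = ennreal z * ennreal (2 * u)" if "0 \<le> u"
      using z that by (simp add: ennreal_mult[symmetric] mult_ac)
    ultimately show "ennreal (2 * (z * u)) * h (z * u) * indicator {0..z} (z * u) = ennreal z * (ennreal (2 * u) * h (z * u) * indicator {0..1} u)"
      by (cases "u \<in> {0..1}") (auto simp: mult_ac)
  qed
  also have "\<dots> = ennreal z * avg h z"
    unfolding avg_def by (rule nn_integral_cmult) measurable
  finally show ?thesis using z by (simp add: power2_eq_square ennreal_mult mult.assoc)
qed

lemma avg_measurable [measurable]:
  assumes [measurable]: "h \<in> borel_measurable borel"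
  shows "avg h \<in> borel_measurable borel"
  unfolding avg_def by measurable

text \<open>The weight and the jump rate contribute \<open>z^2\<close>, which cancels against the
  kernel \<open>2v / z^2\<close>. After Fubini, \<open>tail\<close> evaluates the integral over
  \<open>z \<ge> v\<close> to \<open>e^(-H(v))\<close>, and \<open>2 c v e^(-H(v))\<close> is twice
  the density.\<close>

lemma dens_jump:
  assumes [measurable]: "h \<in> borel_measurable borel"
  shows "(\<integral>\<^sup>+z. dens z * (ennreal (jrate z) * avg h z) \<partial>lborel) = 2 * (\<integral>\<^sup>+x. dens x * h x \<partial>lborel)"
proof -
  let ?K = "\<lambda>z v. ennreal c * (ennreal (R z) * ennreal (exp (- H z))) * (ennreal (2 * v) * h v) * (if 0 < v \<and> v \<le> z then 1 else 0)"
  have "(\<integral>\<^sup>+z. dens z * (ennreal (jrate z) * avg h z) \<partial>lborel) = (\<integral>\<^sup>+z. (\<integral>\<^sup>+v. ?K z v \<partial>lborel) \<partial>lborel)"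
  proof (intro nn_integral_cong)
    fix z
    show "dens z * (ennreal (jrate z) * avg h z) = (\<integral>\<^sup>+v. ?K z v \<partial>lborel)"
    proof (cases "0 < z")
      case True
      have "dens z * (ennreal (jrate z) * avg h z) = ennreal (c * z * exp (- H z)) * ennreal (z * R z) * avg h z"
        using True by (simp add: dens_def jrate_def mult_ac)
      also have "ennreal (c * z * exp (- H z)) * ennreal (z * R z) = ennreal c * (ennreal (R z) * ennreal (exp (- H z))) * ennreal (z\<^sup>2)"
        using True c_pos R_nonneg by (simp add: ennreal_mult[symmetric] power2_eq_square mult_ac)
      also have "\<dots> * avg h z = ennreal c * (ennreal (R z) * ennreal (exp (- H z))) * (ennreal (z\<^sup>2) * avg h z)"
        by (simp only: mult.assoc)
      also have "\<dots> = (\<integral>\<^sup>+v. ennreal c * (ennreal (R z) * ennreal (exp (- H z))) * (ennreal (2 * v) * h v * indicator {0..z} v) \<partial>lborel)"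
        unfolding avg_eq[OF assms True] by (rule nn_integral_cmult[symmetric]) measurable
      also have "\<dots> = (\<integral>\<^sup>+v. ?K z v \<partial>lborel)"
      proof (rule nn_integral_cong_AE)
        show "AE v in lborel. ennreal c * (ennreal (R z) * ennreal (exp (- H z))) * (ennreal (2 * v) * h v * indicator {0..z} v) = ?K z v"
          using AE_lborel_singleton[of "0::real"] by eventually_elim (auto simp: indicator_def mult.assoc)
      qed
      finally show ?thesis .
    next
      case False
      then have "(if 0 < v \<and> v \<le> z then 1 else 0) = (0::ennreal)" for v by auto
      then show ?thesis using False by (simp only:) (simp add: dens_def)
    qed
  qed
  also have "\<dots> = (\<integral>\<^sup>+v. (\<integral>\<^sup>+z. ?K z v \<partial>lborel) \<partial>lborel)"
    by (rule nn_integral_swap) measurable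
  also have "\<dots> = (\<integral>\<^sup>+v. 2 * (dens v * h v) \<partial>lborel)"
  proof (intro nn_integral_cong)
    fix v
    show "(\<integral>\<^sup>+z. ?K z v \<partial>lborel) = 2 * (dens v * h v)"
    proof (cases "0 < v")
      case True
      have "(\<integral>\<^sup>+z. ?K z v \<partial>lborel) = (\<integral>\<^sup>+z. (ennreal c * (ennreal (2 * v) * h v)) * (ennreal (R z) * ennreal (exp (- H z)) * indicator {v..} z) \<partial>lborel)"
        using True by (intro nn_integral_cong) (auto simp: indicator_def mult_ac)
      also have "\<dots> = (ennreal c * (ennreal (2 * v) * h v)) * (\<integral>\<^sup>+z\<in>{v..}. ennreal (R z) * ennreal (exp (- H z)) \<partial>lborel)"
        by (rule nn_integral_cmult) measurable
      also have "\<dots> = (ennreal c * ennreal (2 * v) * ennreal (exp (- H v))) * h v"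
        using tail[OF True] by (simp add: mult_ac)
      also have "ennreal c * ennreal (2 * v) * ennreal (exp (- H v)) = 2 * ennreal (c * v * exp (- H v))"
        using True c_pos by (simp add: ennreal_mult[symmetric] ennreal_numeral[symmetric] mult_ac del: ennreal_numeral)
      finally show ?thesis using True by (simp add: dens_def mult_ac)
    next
      case False
      then have "(if 0 < v \<and> v \<le> z then 1 else 0) = (0::ennreal)" for z by auto
      then show ?thesis using False by (simp only:) (simp add: dens_def)
    qed
  qed
  also have "\<dots> = 2 * (\<integral>\<^sup>+x. dens x * h x \<partial>lborel)"
    by (rule nn_integral_cmult) measurable
  finally show ?thesis .
qed

section \<open>Poisson weights and invariance\<close>

definition pois :: "nat \<Rightarrow> real \<Rightarrow> real" where
  "pois n t = exp (- 2 * t) * (2 * t) ^ n / fact n"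

lemma pois_nonneg: "0 \<le> t \<Longrightarrow> 0 \<le> pois n t"
  by (simp add: pois_def)

text \<open>Conditioning a Poisson process of rate 2 on its first arrival. In \<open>s\<close> the
  integrand is a polynomial times the constant \<open>e^(-2t)\<close>.\<close>

lemma pois_Suc:
  assumes t: "0 \<le> t"
  shows "(\<integral>\<^sup>+s\<in>{0..t}. ennreal (2 * exp (- 2 * s) * pois n (t - s)) \<partial>lborel) = ennreal (pois (Suc n) t)"
proof -
  let ?P = "\<lambda>s. - exp (- 2 * t) * (2 * (t - s)) ^ Suc n / fact (Suc n)"
  have e: "2 * exp (- 2 * s) * pois n (t - s) = exp (- 2 * t) * 2 * (2 * (t - s)) ^ n / fact n" for s
    by (simp add: pois_def exp_add[symmetric] mult_ac)
  have "(\<integral>\<^sup>+s. ennreal (2 * exp (- 2 * s) * pois n (t - s)) * indicator {0..t} s \<partial>lborel) = ennreal (?P t - ?P 0)"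
  proof (rule nn_integral_FTC_Icc)
    show "(\<lambda>s. 2 * exp (- 2 * s) * pois n (t - s)) \<in> borel_measurable borel" unfolding pois_def by measurable
    fix s assume s: "s \<in> {0..t}"
    show "0 \<le> 2 * exp (- 2 * s) * pois n (t - s)" using s by (simp add: pois_nonneg)
    have "(?P has_real_derivative (- exp (- 2 * t) * (of_nat (Suc n) * (2 * (t - s)) ^ n * (2 * (0 - 1))) / fact (Suc n))) (at s)"
      by (rule derivative_eq_intros refl | simp)+
    moreover have "- exp (- 2 * t) * (of_nat (Suc n) * (2 * (t - s)) ^ n * (2 * (0 - 1))) / fact (Suc n) = 2 * exp (- 2 * s) * pois n (t - s)"
      unfolding e by (simp add: fact_Suc field_simps del: of_nat_Suc)
    ultimately show "(?P has_real_derivative 2 * exp (- 2 * s) * pois n (t - s)) (at s)"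
      by simp
  qed (use t in auto)
  also have "?P t - ?P 0 = pois (Suc n) t" by (simp add: pois_def)
  finally show ?thesis .
qed

text \<open>Integrating \<open>Tn_Suc\<close> against \<open>dens\<close>, the flow up to the first
  jump gives \<open>e^(-2s)\<close> and the jump gives 2. Their product is the first-arrival density
  in \<open>pois_Suc\<close>, so the Poisson weights follow by induction.\<close>

lemma dens_Tn:
  assumes t: "0 \<le> t" and f [measurable]: "f \<in> borel_measurable borel"
  shows "(\<integral>\<^sup>+x. dens x * Tn n t f x \<partial>lborel) = ennreal (pois n t) * (\<integral>\<^sup>+x. dens x * f x \<partial>lborel)"
  using t
proof (induction n arbitrary: t)
  case 0
  have "(\<integral>\<^sup>+x. dens x * Tn 0 t f x \<partial>lborel) = (\<integral>\<^sup>+x. dens x * (ennreal (S0 t x) * f (x * exp t)) \<partial>lborel)"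
  proof (intro nn_integral_cong)
    fix x show "dens x * Tn 0 t f x = dens x * (ennreal (S0 t x) * f (x * exp t))"
      using 0 by (cases "0 < x") (simp_all add: Tn_0 dens_nonpos)
  qed
  then show ?case by (simp add: dens_flow pois_def)
next
  case (Suc n)
  let ?I = "\<integral>\<^sup>+x. dens x * f x \<partial>lborel"
  let ?q = "\<lambda>s z. ennreal (jrate z) * avg (Tn n (t - s) f) z"
  have [measurable]: "(\<lambda>w. avg (Tn n (t - fst w) f) (snd w)) \<in> borel_measurable (borel \<Otimes>\<^sub>M borel)"
    unfolding avg_def by measurable
  have [measurable]: "(\<lambda>w. avg (Tn n (t - snd w) f) (fst w * exp (snd w))) \<in> borel_measurable (borel \<Otimes>\<^sub>M borel)"
    unfolding avg_def by measurable
  have "(\<integral>\<^sup>+x. dens x * Tn (Suc n) t f x \<partial>lborel)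
      = (\<integral>\<^sup>+x. (\<integral>\<^sup>+s. dens x * (ennreal (S0 s x) * ?q s (x * exp s)) * indicator {0..t} s \<partial>lborel) \<partial>lborel)"
  proof (intro nn_integral_cong)
    fix x
    show "dens x * Tn (Suc n) t f x = (\<integral>\<^sup>+s. dens x * (ennreal (S0 s x) * ?q s (x * exp s)) * indicator {0..t} s \<partial>lborel)"
    proof (cases "0 < x")
      case True
      have "dens x * Tn (Suc n) t f x = dens x * (\<integral>\<^sup>+s\<in>{0..t}. ennreal (jrate (x * exp s) * S0 s x) * avg (Tn n (t - s) f) (x * exp s) \<partial>lborel)"
        using True Suc.prems by (simp add: Tn_Suc)
      also have "\<dots> = (\<integral>\<^sup>+s. dens x * (ennreal (jrate (x * exp s) * S0 s x) * avg (Tn n (t - s) f) (x * exp s) * indicator {0..t} s) \<partial>lborel)"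
        by (rule nn_integral_cmult[symmetric]) (unfold avg_def, measurable)
      also have "\<dots> = (\<integral>\<^sup>+s. dens x * (ennreal (S0 s x) * ?q s (x * exp s)) * indicator {0..t} s \<partial>lborel)"
        using True by (intro nn_integral_cong) (simp add: ennreal_mult jrate_nonneg S0_bounds less_imp_le mult_ac)
      finally show ?thesis .
    qed (simp add: dens_nonpos)
  qed
  also have "\<dots> = (\<integral>\<^sup>+s. (\<integral>\<^sup>+x. dens x * (ennreal (S0 s x) * ?q s (x * exp s)) * indicator {0..t} s \<partial>lborel) \<partial>lborel)"
    by (rule nn_integral_swap) measurable
  also have "\<dots> = (\<integral>\<^sup>+s. ennreal (2 * exp (- 2 * s) * pois n (t - s)) * indicator {0..t} s * ?I \<partial>lborel)"
  proof (intro nn_integral_cong)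
    fix s
    show "(\<integral>\<^sup>+x. dens x * (ennreal (S0 s x) * ?q s (x * exp s)) * indicator {0..t} s \<partial>lborel)
      = ennreal (2 * exp (- 2 * s) * pois n (t - s)) * indicator {0..t} s * ?I"
    proof (cases "s \<in> {0..t}")
      case True
      have "(\<integral>\<^sup>+x. dens x * (ennreal (S0 s x) * ?q s (x * exp s)) \<partial>lborel) = ennreal (exp (- 2 * s)) * (\<integral>\<^sup>+z. dens z * ?q s z \<partial>lborel)"
        by (rule dens_flow) measurable
      also have "(\<integral>\<^sup>+z. dens z * ?q s z \<partial>lborel) = 2 * (\<integral>\<^sup>+z. dens z * Tn n (t - s) f z \<partial>lborel)"
        by (rule dens_jump) measurable
      also have "(\<integral>\<^sup>+z. dens z * Tn n (t - s) f z \<partial>lborel) = ennreal (pois n (t - s)) * ?I"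
        using True by (intro Suc.IH) auto
      also have "ennreal (exp (- 2 * s)) * (2 * (ennreal (pois n (t - s)) * ?I)) = ennreal (2 * exp (- 2 * s) * pois n (t - s)) * ?I"
        using True pois_nonneg[of "t - s" n] by (simp add: ennreal_mult mult_ac)
      finally show ?thesis using True by simp
    qed simp
  qed
  also have "\<dots> = (\<integral>\<^sup>+s. ennreal (2 * exp (- 2 * s) * pois n (t - s)) * indicator {0..t} s \<partial>lborel) * ?I"
    by (rule nn_integral_multc) (unfold pois_def, measurable)
  also have "\<dots> = ennreal (pois (Suc n) t) * ?I"
    using pois_Suc[OF Suc.prems] by simp
  finally show ?case .
qed

lemma suminf_pois: "0 \<le> t \<Longrightarrow> (\<Sum>n. ennreal (pois n t)) = 1"
proof -
  assume t: "0 \<le> t"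
  have "(\<lambda>n. (2 * t) ^ n /\<^sub>R fact n) sums exp (2 * t)" by (rule exp_converges)
  then have "(\<lambda>n. exp (- 2 * t) * ((2 * t) ^ n /\<^sub>R fact n)) sums (exp (- 2 * t) * exp (2 * t))"
    by (rule sums_mult)
  then have "(\<lambda>n. pois n t) sums 1"
    by (simp add: pois_def exp_add[symmetric] divide_inverse mult_ac)
  then show ?thesis
    using pois_nonneg[OF t] by (subst suminf_ennreal_eq) auto
qed

lemma mass_dens: "(\<integral>\<^sup>+x. dens x \<partial>lborel) = 1"
  using mass by (simp add: dens_def)

text \<open>An exploded path sits at 0, hence the separate term with \<open>f 0\<close>.\<close>

lemma count_split_Tn:
  assumes [measurable]: "f \<in> borel_measurable borel"
  shows "Pn t f x = (\<Sum>n. Tn n t f x) + f 0 * (\<integral>\<^sup>+v. indicator {v. \<forall>k. \<not> count k v x t} v \<partial>Om)"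
proof -
  note [measurable] = Om_component
  have "Pn t f x = (\<Sum>n. Tn n t f x) + (\<integral>\<^sup>+v. f (Z v x t) * indicator {v. \<forall>k. \<not> count k v x t} v \<partial>Om)"
    unfolding Pn_def Tn_def using nn_integral_count_split[of "\<lambda>v. f (Z v x t)" x t] by (simp add: mult_ac)
  also have "(\<integral>\<^sup>+v. f (Z v x t) * indicator {v. \<forall>k. \<not> count k v x t} v \<partial>Om) = (\<integral>\<^sup>+v. f 0 * indicator {v. \<forall>k. \<not> count k v x t} v \<partial>Om)"
    by (intro nn_integral_cong) (auto simp: indicator_def Z_dead)
  also have "\<dots> = f 0 * (\<integral>\<^sup>+v. indicator {v. \<forall>k. \<not> count k v x t} v \<partial>Om)"
  proof (rule nn_integral_cmult)
    have "{v. \<forall>k. \<not> count k v x t} = (\<Inter>k. UNIV - {v. count k v x t})" by auto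
    also have "\<dots> \<in> sets Om"
      using sets.compl_sets[OF count_Om_sets] by (intro sets.countable_INT) auto
    finally show "indicator {v. \<forall>k. \<not> count k v x t} \<in> borel_measurable Om" by (rule borel_measurable_indicator)
  qed
  finally show ?thesis .
qed

lemma dens_suminf_Tn:
  assumes t: "0 \<le> t" and [measurable]: "f \<in> borel_measurable borel"
  shows "(\<integral>\<^sup>+x. dens x * (\<Sum>n. Tn n t f x) \<partial>lborel) = (\<integral>\<^sup>+x. dens x * f x \<partial>lborel)"
proof -
  have "(\<integral>\<^sup>+x. dens x * (\<Sum>n. Tn n t f x) \<partial>lborel) = (\<Sum>n. \<integral>\<^sup>+x. dens x * Tn n t f x \<partial>lborel)"
    by (subst nn_integral_suminf[symmetric]) simp_all
  also have "\<dots> = (\<Sum>n. ennreal (pois n t) * (\<integral>\<^sup>+x. dens x * f x \<partial>lborel))"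
    by (simp add: dens_Tn t)
  also have "\<dots> = (\<Sum>n. ennreal (pois n t)) * (\<integral>\<^sup>+x. dens x * f x \<partial>lborel)" by simp
  finally show ?thesis by (simp add: suminf_pois t)
qed

theorem dens_Pn:
  assumes t: "0 \<le> t" and [measurable]: "f \<in> borel_measurable borel"
  shows "(\<integral>\<^sup>+x. dens x * Pn t f x \<partial>lborel) = (\<integral>\<^sup>+x. dens x * f x \<partial>lborel)"
proof -
  \<comment> \<open>The probability of explosion by time \<open>t\<close>, written as the defect of
    the sum over finite jump numbers.\<close>
  define D where "D x = (\<integral>\<^sup>+v. indicator {v. \<forall>k. \<not> count k v x t} v \<partial>Om)" for x
  have sum1: "(\<Sum>n. Tn n t (\<lambda>_. 1) x) + D x = 1" for x
    using count_split_Tn[of "\<lambda>_. 1" t x] by (simp add: Pn_def D_def canon.emeasure_space_1[simplified])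
  have D: "D x = 1 - (\<Sum>n. Tn n t (\<lambda>_. 1) x)" for x
  proof -
    have "(\<Sum>n. Tn n t (\<lambda>_. 1) x) \<noteq> top" using sum1[of x] by auto
    then have "D x = ((\<Sum>n. Tn n t (\<lambda>_. 1) x) + D x) - (\<Sum>n. Tn n t (\<lambda>_. 1) x)" by simp
    then show ?thesis by (simp only: sum1)
  qed
  have [measurable]: "D \<in> borel_measurable borel" unfolding D by measurable
  have "(\<integral>\<^sup>+x. dens x * 1 \<partial>lborel) = (\<integral>\<^sup>+x. dens x * (\<Sum>n. Tn n t (\<lambda>_. 1) x) + dens x * D x \<partial>lborel)"
    by (intro nn_integral_cong) (simp only: distrib_left[symmetric] sum1)
  also have "\<dots> = (\<integral>\<^sup>+x. dens x * (\<Sum>n. Tn n t (\<lambda>_. 1) x) \<partial>lborel) + (\<integral>\<^sup>+x. dens x * D x \<partial>lborel)"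
    by (rule nn_integral_add) measurable
  also have "(\<integral>\<^sup>+x. dens x * (\<Sum>n. Tn n t (\<lambda>_. 1) x) \<partial>lborel) = (\<integral>\<^sup>+x. dens x * 1 \<partial>lborel)"
    by (rule dens_suminf_Tn) (simp_all add: t)
  \<comment> \<open>Finite jump numbers already account for the whole mass, so \<open>D\<close>
    vanishes for \<pi>-almost every starting point.\<close>
  finally have "1 + 0 = 1 + (\<integral>\<^sup>+x. dens x * D x \<partial>lborel)" by (simp add: mass_dens)
  then have D0: "(\<integral>\<^sup>+x. dens x * D x \<partial>lborel) = 0"
    by (subst (asm) ennreal_add_left_cancel) auto
  have "(\<integral>\<^sup>+x. dens x * Pn t f x \<partial>lborel) = (\<integral>\<^sup>+x. dens x * (\<Sum>n. Tn n t f x) + f 0 * (dens x * D x) \<partial>lborel)"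
    by (intro nn_integral_cong) (simp add: count_split_Tn D_def distrib_left mult_ac)
  also have "\<dots> = (\<integral>\<^sup>+x. dens x * (\<Sum>n. Tn n t f x) \<partial>lborel) + (\<integral>\<^sup>+x. f 0 * (dens x * D x) \<partial>lborel)"
    by (rule nn_integral_add) measurable
  also have "(\<integral>\<^sup>+x. f 0 * (dens x * D x) \<partial>lborel) = f 0 * (\<integral>\<^sup>+x. dens x * D x \<partial>lborel)"
    by (rule nn_integral_cmult) measurable
  \<comment> \<open>\<open>f 0\<close> may be infinite; its product with the integral 0 is still
    0.\<close>
  finally show ?thesis using D0 t by (simp add: dens_suminf_Tn)
qed

end

section \<open>Strong continuity of the flow between jumps\<close>

lemma tendsto_ennreal_0I:
  fixes g :: "'a \<Rightarrow> ennreal"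
  assumes "\<And>e. 0 < e \<Longrightarrow> eventually (\<lambda>x. g x \<le> ennreal e) F"
  shows "(g \<longlongrightarrow> 0) F"
proof (rule order_tendstoI)
  fix a :: ennreal assume "0 < a"
  then obtain b where b: "0 < b" "b < a" using dense by blast
  then have "b < top" by (auto simp: less_top[symmetric])
  then obtain r where r: "b = ennreal r" "0 \<le> r" by (cases b) auto
  with b have "0 < r" by simp
  from assms[OF this] show "eventually (\<lambda>x. g x < a) F"
    by eventually_elim (use b r in auto)
qed simp

lemma tendsto_ennreal_0D:
  fixes g :: "'a \<Rightarrow> ennreal"
  assumes "(g \<longlongrightarrow> 0) F" "0 < e"
  shows "eventually (\<lambda>x. g x \<le> ennreal e) F"
  using order_tendstoD(2)[OF assms(1), of "ennreal e"] assms(2) by (auto elim: eventually_mono)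

lemma tendsto_ennreal_0_le:
  fixes g h :: "'a \<Rightarrow> ennreal"
  assumes "(g \<longlongrightarrow> 0) F" "eventually (\<lambda>x. h x \<le> g x) F"
  shows "(h \<longlongrightarrow> 0) F"
  using assms by (intro tendsto_sandwich[of "\<lambda>_. 0" h F g]) auto

lemma ennreal_le_add:
  assumes "a \<le> b + c" "0 \<le> b" "0 \<le> c" shows "ennreal a \<le> ennreal b + ennreal c"
  using ennreal_leI[OF assms(1)] assms(2,3) by simp

context stationary_rate
begin

text \<open>The L1(\<pi>) distance between \<open>\<psi>\<close> and its image under the flow
  between jumps.\<close>

definition osc :: "(real \<Rightarrow> real) \<Rightarrow> real \<Rightarrow> ennreal" where
  "osc \<psi> s = (\<integral>\<^sup>+x. dens x * ennreal \<bar>S0 s x * \<psi> (x * exp s) - \<psi> x\<bar> \<partial>lborel)"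

abbreviation L1 :: "(real \<Rightarrow> real) \<Rightarrow> ennreal" where
  "L1 \<psi> \<equiv> \<integral>\<^sup>+x. dens x * ennreal \<bar>\<psi> x\<bar> \<partial>lborel"

text \<open>By \<open>dens_flow\<close> the L1(\<pi>) norm shrinks by \<open>e^(-2s)\<close>.
  Contraction makes strong continuity stable under L1 limits.\<close>

lemma L1_flow_le:
  assumes [measurable]: "\<psi> \<in> borel_measurable borel" and s: "0 \<le> s"
  shows "(\<integral>\<^sup>+x. dens x * ennreal \<bar>S0 s x * \<psi> (x * exp s)\<bar> \<partial>lborel) \<le> L1 \<psi>"
proof -
  have "(\<integral>\<^sup>+x. dens x * ennreal \<bar>S0 s x * \<psi> (x * exp s)\<bar> \<partial>lborel)
      = (\<integral>\<^sup>+x. dens x * (ennreal (S0 s x) * ennreal \<bar>\<psi> (x * exp s)\<bar>) \<partial>lborel)"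
    using S0_bounds(1) by (intro nn_integral_cong) (simp add: abs_mult ennreal_mult less_imp_le)
  also have "\<dots> = ennreal (exp (- 2 * s)) * L1 \<psi>"
    by (rule dens_flow) measurable
  also have "\<dots> \<le> 1 * L1 \<psi>"
    using s by (intro mult_right_mono) (auto simp: ennreal_le_1)
  finally show ?thesis by simp
qed

lemma osc_triangle:
  assumes [measurable]: "\<psi> \<in> borel_measurable borel" "\<psi>' \<in> borel_measurable borel"
  shows "osc (\<lambda>x. \<psi> x + \<psi>' x) s \<le> osc \<psi> s + osc \<psi>' s"
proof -
  have "osc (\<lambda>x. \<psi> x + \<psi>' x) s \<le> (\<integral>\<^sup>+x. dens x * ennreal \<bar>S0 s x * \<psi> (x * exp s) - \<psi> x\<bar>
      + dens x * ennreal \<bar>S0 s x * \<psi>' (x * exp s) - \<psi>' x\<bar> \<partial>lborel)"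
    unfolding osc_def
  proof (intro nn_integral_mono)
    fix x
    have "\<bar>S0 s x * (\<psi> (x * exp s) + \<psi>' (x * exp s)) - (\<psi> x + \<psi>' x)\<bar>
        \<le> \<bar>S0 s x * \<psi> (x * exp s) - \<psi> x\<bar> + \<bar>S0 s x * \<psi>' (x * exp s) - \<psi>' x\<bar>"
      by (simp add: distrib_left)
    then have "ennreal \<bar>S0 s x * (\<psi> (x * exp s) + \<psi>' (x * exp s)) - (\<psi> x + \<psi>' x)\<bar>
        \<le> ennreal \<bar>S0 s x * \<psi> (x * exp s) - \<psi> x\<bar> + ennreal \<bar>S0 s x * \<psi>' (x * exp s) - \<psi>' x\<bar>"
      by (rule ennreal_le_add) simp_all
    then show "dens x * ennreal \<bar>S0 s x * (\<psi> (x * exp s) + \<psi>' (x * exp s)) - (\<psi> x + \<psi>' x)\<bar>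
      \<le> dens x * ennreal \<bar>S0 s x * \<psi> (x * exp s) - \<psi> x\<bar> + dens x * ennreal \<bar>S0 s x * \<psi>' (x * exp s) - \<psi>' x\<bar>"
      unfolding distrib_left[symmetric] by (rule mult_left_mono) simp
  qed
  also have "\<dots> = osc \<psi> s + osc \<psi>' s"
    unfolding osc_def by (rule nn_integral_add) measurable
  finally show ?thesis .
qed

lemma osc_le_L1:
  assumes [measurable]: "\<psi> \<in> borel_measurable borel" and s: "0 \<le> s"
  shows "osc \<psi> s \<le> L1 \<psi> + L1 \<psi>"
proof -
  have "osc \<psi> s \<le> (\<integral>\<^sup>+x. dens x * ennreal \<bar>S0 s x * \<psi> (x * exp s)\<bar> + dens x * ennreal \<bar>\<psi> x\<bar> \<partial>lborel)"
    unfolding osc_def distrib_left[symmetric]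
  proof (intro nn_integral_mono mult_left_mono)
    fix x
    have "\<bar>S0 s x * \<psi> (x * exp s) - \<psi> x\<bar> \<le> \<bar>S0 s x * \<psi> (x * exp s)\<bar> + \<bar>\<psi> x\<bar>" by simp
    then show "ennreal \<bar>S0 s x * \<psi> (x * exp s) - \<psi> x\<bar> \<le> ennreal \<bar>S0 s x * \<psi> (x * exp s)\<bar> + ennreal \<bar>\<psi> x\<bar>"
      by (rule ennreal_le_add) simp_all
  qed simp
  also have "\<dots> = (\<integral>\<^sup>+x. dens x * ennreal \<bar>S0 s x * \<psi> (x * exp s)\<bar> \<partial>lborel) + L1 \<psi>"
    by (rule nn_integral_add) measurable
  also have "\<dots> \<le> L1 \<psi> + L1 \<psi>"
    by (intro add_right_mono L1_flow_le s) measurable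
  finally show ?thesis .
qed

text \<open>One third of \<open>e\<close> pays for the oscillation of the approximant; the other two
  bound that of the difference, which is at most twice its L1 norm.\<close>

lemma osc_tendsto_approx:
  assumes [measurable]: "\<psi> \<in> borel_measurable borel"
    and approx: "\<And>e. 0 < e \<Longrightarrow> \<exists>\<psi>'. \<psi>' \<in> borel_measurable borel \<and> (osc \<psi>' \<longlongrightarrow> 0) (at_right 0) \<and> L1 (\<lambda>x. \<psi> x - \<psi>' x) \<le> ennreal e"
  shows "(osc \<psi> \<longlongrightarrow> 0) (at_right 0)"
proof (rule tendsto_ennreal_0I)
  fix e :: real assume e: "0 < e"
  then obtain \<psi>' where [measurable]: "\<psi>' \<in> borel_measurable borel" and o: "(osc \<psi>' \<longlongrightarrow> 0) (at_right 0)"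
    and L: "L1 (\<lambda>x. \<psi> x - \<psi>' x) \<le> ennreal (e / 3)"
    using approx[of "e / 3"] by auto
  have "eventually (\<lambda>s. osc \<psi>' s \<le> ennreal (e / 3)) (at_right 0)"
    using e by (intro tendsto_ennreal_0D[OF o]) simp
  then show "eventually (\<lambda>s. osc \<psi> s \<le> ennreal e) (at_right 0)"
    using eventually_at_right_less[of "0::real"]
  proof eventually_elim
    case (elim s)
    have "osc \<psi> s \<le> osc \<psi>' s + osc (\<lambda>x. \<psi> x - \<psi>' x) s"
      using osc_triangle[of \<psi>' "\<lambda>x. \<psi> x - \<psi>' x" s] by simp
    moreover have "osc (\<lambda>x. \<psi> x - \<psi>' x) s \<le> ennreal (e / 3) + ennreal (e / 3)"
      using elim osc_le_L1[of "\<lambda>x. \<psi> x - \<psi>' x" s] add_mono[OF L L] by (auto intro: order_trans)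
    ultimately have "osc \<psi> s \<le> ennreal (e / 3) + (ennreal (e / 3) + ennreal (e / 3))"
      using elim add_mono by (blast intro: order_trans)
    also have "\<dots> = ennreal e" using e by (simp add: ennreal_plus[symmetric] del: ennreal_plus)
    finally show ?case .
  qed
qed

lemma osc_tendsto_add:
  assumes "\<psi> \<in> borel_measurable borel" "\<psi>' \<in> borel_measurable borel"
    and "(osc \<psi> \<longlongrightarrow> 0) (at_right 0)" "(osc \<psi>' \<longlongrightarrow> 0) (at_right 0)"
  shows "(osc (\<lambda>x. \<psi> x + \<psi>' x) \<longlongrightarrow> 0) (at_right 0)"
proof (rule tendsto_ennreal_0_le)
  show "((\<lambda>s. osc \<psi> s + osc \<psi>' s) \<longlongrightarrow> 0) (at_right 0)"
    using tendsto_add[OF assms(3,4)] by simp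
qed (simp add: osc_triangle[OF assms(1,2)])

lemma osc_tendsto_scale:
  assumes [measurable]: "\<psi> \<in> borel_measurable borel" and o: "(osc \<psi> \<longlongrightarrow> 0) (at_right 0)"
  shows "(osc (\<lambda>x. a * \<psi> x) \<longlongrightarrow> 0) (at_right 0)"
proof -
  have "osc (\<lambda>x. a * \<psi> x) s = ennreal \<bar>a\<bar> * osc \<psi> s" for s
  proof -
    have "osc (\<lambda>x. a * \<psi> x) s = (\<integral>\<^sup>+x. ennreal \<bar>a\<bar> * (dens x * ennreal \<bar>S0 s x * \<psi> (x * exp s) - \<psi> x\<bar>) \<partial>lborel)"
      unfolding osc_def
    proof (intro nn_integral_cong)
      fix x
      have "\<bar>S0 s x * (a * \<psi> (x * exp s)) - a * \<psi> x\<bar> = \<bar>a\<bar> * \<bar>S0 s x * \<psi> (x * exp s) - \<psi> x\<bar>"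
        by (simp add: abs_mult[symmetric] right_diff_distrib mult_ac)
      then show "dens x * ennreal \<bar>S0 s x * (a * \<psi> (x * exp s)) - a * \<psi> x\<bar>
          = ennreal \<bar>a\<bar> * (dens x * ennreal \<bar>S0 s x * \<psi> (x * exp s) - \<psi> x\<bar>)"
        by (simp add: ennreal_mult mult_ac)
    qed
    also have "\<dots> = ennreal \<bar>a\<bar> * osc \<psi> s" unfolding osc_def by (rule nn_integral_cmult) measurable
    finally show ?thesis .
  qed
  moreover have "((\<lambda>s. ennreal \<bar>a\<bar> * osc \<psi> s) \<longlongrightarrow> ennreal \<bar>a\<bar> * 0) (at_right 0)"
    by (rule tendsto_mult_ennreal[OF tendsto_const o]) simp
  moreover have "osc (\<lambda>x. a * \<psi> x) = (\<lambda>s. ennreal \<bar>a\<bar> * osc \<psi> s)" by (rule ext) fact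
  ultimately show ?thesis by simp
qed

lemma S0_tendsto: "((\<lambda>s. S0 s x) \<longlongrightarrow> 1) (at_right 0)"
proof -
  have "((\<lambda>s. S0 s x) \<longlongrightarrow> exp (H x - H (x * exp 0))) (at_right 0)"
    unfolding S0_def by (intro tendsto_intros H_tendsto)
  then show ?thesis by simp
qed

lemma S0_tendsto_0: "((\<lambda>s. S0 s x - 1) \<longlongrightarrow> 0) (at_right 0)"
  using tendsto_diff[OF S0_tendsto[of x] tendsto_const[of 1]] by simp

text \<open>The right limit is tested along sequences, which reduces it to dominated convergence.
  Bound and limit are asked for on (0,\<infinity>) because \<open>dens\<close> vanishes
  elsewhere.\<close>

lemma tendsto_L1_dominated:
  assumes [measurable]: "\<And>s. g s \<in> borel_measurable borel" "w \<in> borel_measurable borel"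
    and w: "(\<integral>\<^sup>+x. dens x * ennreal (w x) \<partial>lborel) < top"
    and bd: "\<And>s x. 0 < s \<Longrightarrow> 0 < x \<Longrightarrow> \<bar>g s x\<bar> \<le> w x"
    and lim: "AE x in lborel. 0 < x \<longrightarrow> ((\<lambda>s. g s x) \<longlongrightarrow> 0) (at_right 0)"
  shows "((\<lambda>s. L1 (g s)) \<longlongrightarrow> 0) (at_right (0::real))"
  unfolding tendsto_at_iff_sequentially
proof (intro allI impI)
  fix S :: "nat \<Rightarrow> real" assume S: "\<forall>i. S i \<in> {0<..} - {0}" and S0: "S \<longlonglongrightarrow> 0"
  have "(\<lambda>i. L1 (g (S i))) \<longlonglongrightarrow> (\<integral>\<^sup>+x. 0 \<partial>(lborel :: real measure))"
  proof (rule nn_integral_dominated_convergence[where w = "\<lambda>x. dens x * ennreal (w x)"])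
    show "AE x in lborel. dens x * ennreal \<bar>g (S i) x\<bar> \<le> dens x * ennreal (w x)" for i
      using S bd by (intro AE_I2) (auto simp: dens_def indicator_def intro!: mult_left_mono ennreal_leI)
    show "AE x in lborel. (\<lambda>i. dens x * ennreal \<bar>g (S i) x\<bar>) \<longlonglongrightarrow> 0"
      using lim
    proof eventually_elim
      case (elim x)
      show ?case
      proof (cases "0 < x")
        case True
        with elim have "(\<lambda>i. g (S i) x) \<longlonglongrightarrow> 0"
          using S S0 unfolding tendsto_at_iff_sequentially by (auto simp: comp_def)
        then have "(\<lambda>i. \<bar>g (S i) x\<bar>) \<longlonglongrightarrow> 0" by (rule tendsto_rabs_zero)
        then have "(\<lambda>i. ennreal \<bar>g (S i) x\<bar>) \<longlonglongrightarrow> ennreal 0" by (rule tendsto_ennrealI)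
        then have "(\<lambda>i. dens x * ennreal \<bar>g (S i) x\<bar>) \<longlonglongrightarrow> dens x * ennreal 0"
          by (intro tendsto_mult_ennreal tendsto_const) (auto simp: dens_def indicator_def)
        then show ?thesis by simp
      qed (simp add: dens_nonpos)
    qed
  qed (use w in \<open>auto simp: less_top\<close>)
  then show "((\<lambda>s. L1 (g s)) \<circ> S) \<longlonglongrightarrow> 0" by (simp add: comp_def)
qed

lemma osc_tendsto_one: "(osc (\<lambda>_. 1) \<longlongrightarrow> 0) (at_right 0)"
  unfolding osc_def
proof (rule tendsto_L1_dominated[where w = "\<lambda>_. 1"])
  show "\<bar>S0 s x * 1 - 1\<bar> \<le> 1" if "0 < s" for s x
    using S0_bounds[of s x] that by simp
  show "AE x in lborel. 0 < x \<longrightarrow> ((\<lambda>s. S0 s x * 1 - 1) \<longlongrightarrow> 0) (at_right 0)"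
    using S0_tendsto_0 by simp
qed (simp_all add: mass_dens)

text \<open>For every \<open>x\<close> other than \<open>a\<close> the indicator is constant along
  the flow for small times, so only the survival factor moves.\<close>

lemma osc_tendsto_atMost: "(osc (indicator {..a}) \<longlongrightarrow> 0) (at_right 0)"
  unfolding osc_def
proof (rule tendsto_L1_dominated[where w = "\<lambda>_. 1"])
  show "\<bar>S0 s x * indicator {..a} (x * exp s) - indicator {..a} x\<bar> \<le> 1" if "0 < s" for s x
    using S0_bounds[of s x] that by (auto simp: indicator_def)
  show "AE x in lborel. 0 < x \<longrightarrow> ((\<lambda>s. S0 s x * indicator {..a} (x * exp s) - indicator {..a} x) \<longlongrightarrow> 0) (at_right 0)"
    using AE_lborel_singleton[of a]
  proof eventually_elim
    case (elim x)
    show ?case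
    proof
      assume x: "0 < x"
      show "((\<lambda>s. S0 s x * indicator {..a} (x * exp s) - indicator {..a} x) \<longlongrightarrow> 0) (at_right 0)"
      proof (cases "x < a")
        case True
        have "((\<lambda>s. x * exp s) \<longlongrightarrow> x * exp 0) (at_right 0)" by (intro tendsto_intros)
        then have "eventually (\<lambda>s. x * exp s < a) (at_right 0)" using True by (intro order_tendstoD) auto
        then have "eventually (\<lambda>s. S0 s x - 1 = S0 s x * indicator {..a} (x * exp s) - indicator {..a} x) (at_right 0)"
          by eventually_elim (use True in auto)
        moreover have "((\<lambda>s. S0 s x - 1) \<longlongrightarrow> 0) (at_right 0)"
          by (rule S0_tendsto_0)
        ultimately show ?thesis by (rule Lim_transform_eventually[rotated])
      next
        case False
        then have xa: "a < x" using elim by simp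
        have "eventually (\<lambda>s. 0 = S0 s x * indicator {..a} (x * exp s) - indicator {..a} x) (at_right 0)"
          using eventually_at_right_less[of "0::real"]
        proof eventually_elim
          case (elim s)
          have "x * 1 \<le> x * exp s" using elim x by (intro mult_left_mono) auto
          then show ?case using xa by (auto simp: indicator_def)
        qed
        then show ?thesis by (rule Lim_transform_eventually[OF tendsto_const])
      qed
    qed
  qed
qed (simp_all add: mass_dens)

text \<open>Rays are closed under intersection and generate the Borel sets. Complements and finite
  disjoint unions are handled by linearity, countable ones by L1 approximation with partial
  unions.\<close>

lemma osc_tendsto_indicator:
  assumes "A \<in> sets borel"
  shows "(osc (indicator A) \<longlongrightarrow> 0) (at_right 0)"
proof -
  have "sets (borel :: real measure) = sigma_sets UNIV (range (\<lambda>a. {..a}))"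
    by (simp add: borel_eq_atMost)
  then have A: "A \<in> sigma_sets UNIV (range (\<lambda>a::real. {..a}))" using assms by simp
  have sb: "B \<in> sets borel" if "B \<in> sigma_sets UNIV (range (\<lambda>a::real. {..a}))" for B
    using that by (simp add: borel_eq_atMost)
  have "Int_stable (range (\<lambda>a::real. {..a}))" by (auto simp: Int_stable_def)
  from this _ A show ?thesis
  proof (rule sigma_sets_induct_disjoint)
    fix B assume "B \<in> range (\<lambda>a::real. {..a})"
    then show "(osc (indicator B) \<longlongrightarrow> 0) (at_right 0)" by (auto simp: osc_tendsto_atMost)
  next
    have "osc (indicator {}) = (\<lambda>_. 0)" by (simp add: osc_def fun_eq_iff)
    then show "(osc (indicator {}) \<longlongrightarrow> 0) (at_right 0)" by (simp only: tendsto_const)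
  next
    fix B assume B: "B \<in> sigma_sets UNIV (range (\<lambda>a::real. {..a}))" "(osc (indicator B) \<longlongrightarrow> 0) (at_right 0)"
    note [measurable] = sb[OF B(1)]
    have "(osc (\<lambda>x. 1 + (- 1) * indicator B x) \<longlongrightarrow> 0) (at_right 0)"
      by (intro osc_tendsto_add osc_tendsto_scale osc_tendsto_one B(2)) measurable
    moreover have "(\<lambda>x. 1 + (- 1) * indicator B x) = (indicator (UNIV - B) :: real \<Rightarrow> real)"
      by (auto simp: indicator_def)
    ultimately show "(osc (indicator (UNIV - B)) \<longlongrightarrow> 0) (at_right 0)" by simp
  next
    fix B :: "nat \<Rightarrow> real set"
    assume B: "disjoint_family B" "range B \<subseteq> sigma_sets UNIV (range (\<lambda>a::real. {..a}))"
      "\<And>i. (osc (indicator (B i)) \<longlongrightarrow> 0) (at_right 0)"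
    have [measurable]: "B i \<in> sets borel" for i using B(2) sb by blast
    have fin: "(osc (indicator (\<Union>i<n. B i)) \<longlongrightarrow> 0) (at_right 0)" for n
    proof (induction n)
      case (Suc n)
      have "B n \<inter> B i = {}" if "i < n" for i
        using B(1) that unfolding disjoint_family_on_def by auto
      then have disj: "(\<Union>i<n. B i) \<inter> B n = {}" by blast
      have "indicator (\<Union>i<Suc n. B i) = (\<lambda>x. indicator (\<Union>i<n. B i) x + indicator (B n) x :: real)"
        unfolding lessThan_Suc UN_insert Un_commute[of "B n"]
        by (rule ext) (rule indicator_add[OF disj, symmetric])
      moreover have "(osc (\<lambda>x. indicator (\<Union>i<n. B i) x + indicator (B n) x) \<longlongrightarrow> 0) (at_right 0)"
        by (rule osc_tendsto_add[OF _ _ Suc B(3)]) measurable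
      ultimately show ?case by (simp only:)
    next
      case 0
      have "osc (indicator {}) = (\<lambda>_. 0)" by (simp add: osc_def fun_eq_iff)
      then show ?case by (simp only: lessThan_0 UN_empty tendsto_const)
    qed
    show "(osc (indicator (\<Union>i. B i)) \<longlongrightarrow> 0) (at_right 0)"
    proof (rule osc_tendsto_approx)
      fix e :: real assume e: "0 < e"
      \<comment> \<open>Each point is eventually in a partial union or in none, and
        \<open>dens\<close> is an integrable bound.\<close>
      have lim: "(\<lambda>n. L1 (\<lambda>x. indicator (\<Union>i. B i) x - indicator (\<Union>i<n. B i) x)) \<longlonglongrightarrow> (\<integral>\<^sup>+x. 0 \<partial>(lborel::real measure))"
      proof (rule nn_integral_dominated_convergence[where w = dens])
        show "AE x in lborel. dens x * ennreal \<bar>indicator (\<Union>i. B i) x - indicator (\<Union>i<n. B i) x\<bar> \<le> dens x" for n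
          by (intro AE_I2) (auto simp: indicator_def)
        show "AE x in lborel. (\<lambda>n. dens x * ennreal \<bar>indicator (\<Union>i. B i) x - indicator (\<Union>i<n. B i) x\<bar>) \<longlonglongrightarrow> 0"
        proof (intro AE_I2)
          fix x
          have "eventually (\<lambda>n. 0 = dens x * ennreal \<bar>indicator (\<Union>i. B i) x - indicator (\<Union>i<n. B i) x\<bar>) sequentially"
          proof (cases "x \<in> (\<Union>i. B i)")
            case True
            then obtain k where "x \<in> B k" by blast
            then have "x \<in> (\<Union>i<n. B i)" if "k < n" for n using that by blast
            then have "0 = dens x * ennreal \<bar>indicator (\<Union>i. B i) x - indicator (\<Union>i<n. B i) x\<bar>" if "k < n" for n
              using True that by (simp only: indicator_simps) simp
            then show ?thesis using eventually_gt_at_top[of k] by (rule eventually_mono[rotated])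
          next
            case False
            then have "x \<notin> (\<Union>i<n. B i)" for n by blast
            then show ?thesis using False by (simp add: indicator_def)
          qed
          then show "(\<lambda>n. dens x * ennreal \<bar>indicator (\<Union>i. B i) x - indicator (\<Union>i<n. B i) x\<bar>) \<longlonglongrightarrow> 0"
            by (rule Lim_transform_eventually[OF tendsto_const])
        qed
      qed (auto simp: mass_dens)
      then have "(\<lambda>n. L1 (\<lambda>x. indicator (\<Union>i. B i) x - indicator (\<Union>i<n. B i) x)) \<longlonglongrightarrow> 0" by simp
      from tendsto_ennreal_0D[OF this e]
      obtain n where "L1 (\<lambda>x. indicator (\<Union>i. B i) x - indicator (\<Union>i<n. B i) x) \<le> ennreal e"
        by (auto simp: eventually_sequentially)
      then show "\<exists>\<psi>'. \<psi>' \<in> borel_measurable borel \<and> (osc \<psi>' \<longlongrightarrow> 0) (at_right 0)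
          \<and> L1 (\<lambda>x. indicator (\<Union>i. B i) x - \<psi>' x) \<le> ennreal e"
        using fin[of n] by (intro exI[of _ "indicator (\<Union>i<n. B i)"]) auto
    qed measurable
  qed simp
qed

text \<open>Strong continuity extends from indicators to all of L1(\<pi>) by linearity and by
  closedness under L1 limits. No continuity of \<open>\<psi>\<close> enters, which suits the merely
  measurable jump rate.\<close>

theorem osc_tendsto:
  assumes [measurable]: "\<psi> \<in> borel_measurable borel" and "L1 \<psi> < top"
  shows "(osc \<psi> \<longlongrightarrow> 0) (at_right 0)"
proof -
  let ?M = "density lborel dens"
  have nn: "(\<integral>\<^sup>+x. ennreal (norm (g x)) \<partial>?M) = L1 g" if [measurable]: "g \<in> borel_measurable borel" for g :: "real \<Rightarrow> real"
    by (subst nn_integral_density) simp_all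
  have "integrable ?M \<psi>"
    using assms(2) by (intro integrableI_bounded) (simp_all add: nn del: real_norm_def)
  then show ?thesis
  proof (induct rule: integrable_induct)
    case (base A c)
    then have "A \<in> sets borel" by simp
    then show ?case
      using osc_tendsto_scale[OF _ osc_tendsto_indicator, of A c] by (simp add: mult.commute)
  next
    case (add f g)
    then have "f \<in> borel_measurable borel" "g \<in> borel_measurable borel"
      by (auto dest!: borel_measurable_integrable)
    then show ?case using add by (intro osc_tendsto_add) auto
  next
    case (lim f s)
    have [measurable]: "f \<in> borel_measurable borel" "\<And>i. s i \<in> borel_measurable borel"
      using borel_measurable_integrable[OF lim(5)] borel_measurable_integrable[OF lim(1)] by simp_all
    have Lf: "L1 f < top" using lim(5) by (simp add: integrable_iff_bounded nn[symmetric] del: real_norm_def)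
    have "(\<lambda>n. L1 (\<lambda>x. f x - s n x)) \<longlonglongrightarrow> (\<integral>\<^sup>+x. 0 \<partial>(lborel::real measure))"
    \<comment> \<open>The induction rule supplies approximants bounded by
      \<open>2 \<bar>f\<bar>\<close>, hence the constant 3.\<close>
    proof (rule nn_integral_dominated_convergence[where w = "\<lambda>x. 3 * (dens x * ennreal \<bar>f x\<bar>)"])
      show "AE x in lborel. dens x * ennreal \<bar>f x - s n x\<bar> \<le> 3 * (dens x * ennreal \<bar>f x\<bar>)" for n
      proof (intro AE_I2)
        fix x
        have "\<bar>s n x\<bar> \<le> 2 * \<bar>f x\<bar>" using lim(4)[of x n] by simp
        then have "\<bar>f x - s n x\<bar> \<le> 3 * \<bar>f x\<bar>" by linarith
        then have "ennreal \<bar>f x - s n x\<bar> \<le> ennreal (3 * \<bar>f x\<bar>)" by (rule ennreal_leI)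
        also have "\<dots> = 3 * ennreal \<bar>f x\<bar>" by (simp add: ennreal_mult)
        finally have "dens x * ennreal \<bar>f x - s n x\<bar> \<le> dens x * (3 * ennreal \<bar>f x\<bar>)" by (rule mult_left_mono) simp
        then show "dens x * ennreal \<bar>f x - s n x\<bar> \<le> 3 * (dens x * ennreal \<bar>f x\<bar>)" by (simp add: mult_ac)
      qed
      show "AE x in lborel. (\<lambda>n. dens x * ennreal \<bar>f x - s n x\<bar>) \<longlonglongrightarrow> 0"
      proof (intro AE_I2)
        fix x
        have "(\<lambda>n. f x - s n x) \<longlonglongrightarrow> f x - f x" by (intro tendsto_intros lim(3)) simp
        then have "(\<lambda>n. \<bar>f x - s n x\<bar>) \<longlonglongrightarrow> 0" by (simp add: tendsto_rabs_zero)
        then have "(\<lambda>n. ennreal \<bar>f x - s n x\<bar>) \<longlonglongrightarrow> ennreal 0" by (rule tendsto_ennrealI)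
        then have "(\<lambda>n. dens x * ennreal \<bar>f x - s n x\<bar>) \<longlonglongrightarrow> dens x * ennreal 0"
          by (intro tendsto_mult_ennreal tendsto_const) (auto simp: dens_def indicator_def)
        then show "(\<lambda>n. dens x * ennreal \<bar>f x - s n x\<bar>) \<longlonglongrightarrow> 0" by simp
      qed
      have "(\<integral>\<^sup>+x. 3 * (dens x * ennreal \<bar>f x\<bar>) \<partial>lborel) = 3 * L1 f" by (rule nn_integral_cmult) measurable
      then show "(\<integral>\<^sup>+x. 3 * (dens x * ennreal \<bar>f x\<bar>) \<partial>lborel) < \<infinity>" using Lf by (simp add: ennreal_mult_less_top)
    qed simp_all
    then have L: "(\<lambda>n. L1 (\<lambda>x. f x - s n x)) \<longlonglongrightarrow> 0" by simp
    show ?case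
    proof (rule osc_tendsto_approx)
      fix e :: real assume "0 < e"
      from tendsto_ennreal_0D[OF L this] obtain n where "L1 (\<lambda>x. f x - s n x) \<le> ennreal e"
        by (auto simp: eventually_sequentially)
      then show "\<exists>\<psi>'. \<psi>' \<in> borel_measurable borel \<and> (osc \<psi>' \<longlongrightarrow> 0) (at_right 0) \<and> L1 (\<lambda>x. f x - \<psi>' x) \<le> ennreal e"
        using lim(2)[of n] by (intro exI[of _ "s n"]) auto
    qed measurable
  qed
qed

section \<open>Time averages along the flow\<close>

definition flow_avg :: "(real \<Rightarrow> real) \<Rightarrow> real \<Rightarrow> real \<Rightarrow> real" where
  "flow_avg \<psi> t x = (LBINT s:{0..t}. S0 s x * \<psi> (x * exp s))"

text \<open>By Fubini the L1 distance between the time average and \<open>\<psi>\<close> is at most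
  the mean of \<open>osc \<psi>\<close> over [0, t].\<close>

lemma flow_avg_tendsto:
  assumes [measurable]: "\<psi> \<in> borel_measurable borel" and L: "L1 \<psi> < top"
    and int: "\<And>t x. 0 < x \<Longrightarrow> 0 < t \<Longrightarrow> set_integrable lborel {0..t} (\<lambda>s. S0 s x * \<psi> (x * exp s))"
  shows "((\<lambda>t. L1 (\<lambda>x. flow_avg \<psi> t x / t - \<psi> x)) \<longlongrightarrow> 0) (at_right 0)"
proof (rule tendsto_ennreal_0I)
  fix e :: real assume e: "0 < e"
  have "eventually (\<lambda>s. osc \<psi> s \<le> ennreal e) (at_right 0)"
    by (rule tendsto_ennreal_0D[OF osc_tendsto e]) fact+
  then obtain d where d: "0 < d" "\<And>s. 0 < s \<Longrightarrow> s < d \<Longrightarrow> osc \<psi> s \<le> ennreal e"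
    unfolding eventually_at_right_field by auto
  have "eventually (\<lambda>t. t \<in> {0<..<d}) (at_right 0)" using d(1) by (rule eventually_at_right_real)
  then show "eventually (\<lambda>t. L1 (\<lambda>x. flow_avg \<psi> t x / t - \<psi> x) \<le> ennreal e) (at_right 0)"
  proof eventually_elim
    case (elim t)
    then have t: "0 < t" "t < d" by auto
    let ?h = "\<lambda>s x. ennreal \<bar>S0 s x * \<psi> (x * exp s) - \<psi> x\<bar>"
    have pt: "ennreal \<bar>flow_avg \<psi> t x / t - \<psi> x\<bar> \<le> ennreal (1 / t) * (\<integral>\<^sup>+s\<in>{0..t}. ?h s x \<partial>lborel)" if x: "0 < x" for x
    proof -
      have c: "set_integrable lborel {0..t} (\<lambda>s. \<psi> x)" "(LBINT s:{0..t}. \<psi> x) = t * \<psi> x"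
        using t by (simp_all add: set_integrable_def set_lebesgue_integral_def)
      have "flow_avg \<psi> t x - t * \<psi> x = (LBINT s:{0..t}. S0 s x * \<psi> (x * exp s) - \<psi> x)"
        unfolding flow_avg_def using set_integral_diff(2)[OF int[OF x t(1)] c(1)] c(2) by simp
      then have "ennreal \<bar>flow_avg \<psi> t x - t * \<psi> x\<bar> \<le> (\<integral>\<^sup>+s. ennreal (norm (indicator {0..t} s *\<^sub>R (S0 s x * \<psi> (x * exp s) - \<psi> x))) \<partial>lborel)"
        using integral_norm_bound_ennreal[of lborel "\<lambda>s. indicator {0..t} s *\<^sub>R (S0 s x * \<psi> (x * exp s) - \<psi> x)"]
          set_integral_diff(1)[OF int[OF x t(1)] c(1)]
        by (simp add: set_lebesgue_integral_def set_integrable_def)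
      also have "\<dots> = (\<integral>\<^sup>+s\<in>{0..t}. ?h s x \<partial>lborel)"
        by (intro nn_integral_cong) (auto simp: indicator_def)
      finally have "ennreal (1 / t) * ennreal \<bar>flow_avg \<psi> t x - t * \<psi> x\<bar> \<le> ennreal (1 / t) * (\<integral>\<^sup>+s\<in>{0..t}. ?h s x \<partial>lborel)"
        by (rule mult_left_mono) simp
      moreover have "\<bar>flow_avg \<psi> t x / t - \<psi> x\<bar> = (1 / t) * \<bar>flow_avg \<psi> t x - t * \<psi> x\<bar>"
        using t by (simp add: abs_if field_simps)
      then have "ennreal \<bar>flow_avg \<psi> t x / t - \<psi> x\<bar> = ennreal (1 / t) * ennreal \<bar>flow_avg \<psi> t x - t * \<psi> x\<bar>"
        using t by (simp only: ennreal_mult[symmetric] abs_ge_zero zero_le_divide_1_iff less_imp_le)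
      ultimately show ?thesis by simp
    qed
    have "L1 (\<lambda>x. flow_avg \<psi> t x / t - \<psi> x) \<le> (\<integral>\<^sup>+x. (\<integral>\<^sup>+s. ennreal (1 / t) * (dens x * ?h s x) * indicator {0..t} s \<partial>lborel) \<partial>lborel)"
    proof (intro nn_integral_mono)
      fix x
      have "dens x * ennreal \<bar>flow_avg \<psi> t x / t - \<psi> x\<bar> \<le> dens x * (ennreal (1 / t) * (\<integral>\<^sup>+s\<in>{0..t}. ?h s x \<partial>lborel))"
        by (cases "0 < x") (auto simp: dens_nonpos intro!: mult_left_mono pt)
      also have "\<dots> = (\<integral>\<^sup>+s. (dens x * ennreal (1 / t)) * (?h s x * indicator {0..t} s) \<partial>lborel)"
        unfolding mult.assoc[symmetric] by (subst nn_integral_cmult[symmetric]) (simp_all add: mult.assoc)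
      also have "\<dots> = (\<integral>\<^sup>+s. ennreal (1 / t) * (dens x * ?h s x) * indicator {0..t} s \<partial>lborel)"
        by (intro nn_integral_cong) (simp only: mult_ac)
      finally show "dens x * ennreal \<bar>flow_avg \<psi> t x / t - \<psi> x\<bar> \<le> (\<integral>\<^sup>+s. ennreal (1 / t) * (dens x * ?h s x) * indicator {0..t} s \<partial>lborel)" .
    qed
    also have "\<dots> = (\<integral>\<^sup>+s. (\<integral>\<^sup>+x. ennreal (1 / t) * (dens x * ?h s x) * indicator {0..t} s \<partial>lborel) \<partial>lborel)"
      by (rule nn_integral_swap) measurable
    also have "\<dots> \<le> (\<integral>\<^sup>+s. ennreal (1 / t) * ennreal e * indicator {0..t} s \<partial>lborel)"
    proof (intro nn_integral_mono)
      fix s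
      show "(\<integral>\<^sup>+x. ennreal (1 / t) * (dens x * ?h s x) * indicator {0..t} s \<partial>lborel) \<le> ennreal (1 / t) * ennreal e * indicator {0..t} s"
      proof (cases "s \<in> {0..t}")
        case True
        have "osc \<psi> s \<le> ennreal e"
        \<comment> \<open>The estimate \<open>d\<close> covers positive times only; at time 0 the
          oscillation is 0.\<close>
        proof (cases "s = 0")
          case True then show ?thesis by (simp add: osc_def)
        qed (use True t d(2)[of s] in auto)
        then have "ennreal (1 / t) * osc \<psi> s \<le> ennreal (1 / t) * ennreal e" by (rule mult_left_mono) simp
        moreover have "(\<integral>\<^sup>+x. ennreal (1 / t) * (dens x * ?h s x) \<partial>lborel) = ennreal (1 / t) * osc \<psi> s"
          unfolding osc_def by (rule nn_integral_cmult) measurable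
        ultimately show ?thesis using True by simp
      qed simp
    qed
    also have "\<dots> = ennreal (1 / t) * ennreal e * ennreal t"
      using t by (subst nn_integral_cmult_indicator) simp_all
    also have "\<dots> = ennreal e" using t e by (simp add: ennreal_mult[symmetric])
    finally show ?case .
  qed
qed

end

section \<open>The generator\<close>

text \<open>The properties of a function in \<open>C_c^1(0,\<infinity>)\<close> that the limit uses.
  \<open>C1\<close> bounds \<open>x f'(x)\<close>, the derivative along the flow, and therefore also
  serves as the Lipschitz constant along it.\<close>

locale generator_setup = stationary_rate +
  fixes f D :: "real \<Rightarrow> real" and C C1 :: real
  assumes f_measurable [measurable]: "f \<in> borel_measurable borel"
    and D_measurable [measurable]: "D \<in> borel_measurable borel"
    and f_bound: "\<And>x. \<bar>f x\<bar> \<le> C"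
    and D_bound: "\<And>x. 0 < x \<Longrightarrow> \<bar>x * D x\<bar> \<le> C1"
    and f_lipschitz: "\<And>y r. 0 < y \<Longrightarrow> 0 \<le> r \<Longrightarrow> \<bar>f (y * exp r) - f y\<bar> \<le> C1 * r"
    and f_deriv: "\<And>x. 0 < x \<Longrightarrow> ((\<lambda>t. (f (x * exp t) - f x) / t) \<longlongrightarrow> x * D x) (at_right 0)"
begin

lemma C_nonneg: "0 \<le> C" and C1_nonneg: "0 \<le> C1"
  using f_bound[of 0] D_bound[of 1] by linarith+

definition favg :: "real \<Rightarrow> real" where
  "favg z = (LBINT u:{0..1}. 2 * u * f (z * u))"

lemma favg_measurable [measurable]: "favg \<in> borel_measurable borel"
proof -
  have "(\<lambda>(z, u). indicator {0..1} u *\<^sub>R (2 * u * f (z * u))) \<in> borel_measurable (borel \<Otimes>\<^sub>M lborel)"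
    by measurable
  then show ?thesis
    unfolding favg_def set_lebesgue_integral_def by (rule lborel.borel_measurable_lebesgue_integral)
qed

lemma favg_integrable: "integrable lborel (\<lambda>u. indicator {0..1} u *\<^sub>R (2 * u * f (z * u)))"
proof (rule Bochner_Integration.integrable_bound)
  have i: "integrable lborel (indicator {0..1} :: real \<Rightarrow> real)" by (rule integrable_real_indicator) auto
  show "integrable lborel (\<lambda>u::real. indicator {0..1} u *\<^sub>R (2 * C) :: real)"
    by (rule integrable_scaleR_left) (rule i)
  show "AE u in lborel. norm (indicator {0..1} u *\<^sub>R (2 * u * f (z * u))) \<le> norm (indicator {0..1} u *\<^sub>R (2 * C))"
  proof (intro AE_I2)
    fix u
    have "\<bar>2 * u * f (z * u)\<bar> \<le> 2 * C" if "u \<in> {0..1}"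
    proof -
      have "\<bar>u\<bar> * \<bar>f (z * u)\<bar> \<le> 1 * C" using that f_bound by (intro mult_mono) auto
      then show ?thesis by (simp add: abs_mult)
    qed
    then show "norm (indicator {0..1} u *\<^sub>R (2 * u * f (z * u))) \<le> norm (indicator {0..1} u *\<^sub>R (2 * C))"
      using C_nonneg by (cases "u \<in> {0..1}") auto
  qed
qed measurable

lemma integral_2u: "integrable lborel (\<lambda>u. indicator {0..1} u *\<^sub>R (2 * u) :: real)" "(LBINT u. indicator {0..1} u * (2 * u)) = (1 :: real)"
proof -
  have F: "((\<lambda>u. u\<^sup>2) has_real_derivative 2 * u) (at u)" for u :: real
    by (auto intro!: derivative_eq_intros)
  have "integrable lborel (\<lambda>u. 2 * u * indicator {0..1} u :: real)"
    by (rule integrable_FTC_Icc_nonneg[where F = "\<lambda>u. u\<^sup>2"]) (auto intro: F)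
  then show "integrable lborel (\<lambda>u. indicator {0..1} u *\<^sub>R (2 * u) :: real)" by (simp add: mult_ac)
  have "(\<integral>u. 2 * u * indicator {0..1} u \<partial>lborel) = 1\<^sup>2 - (0::real)\<^sup>2"
    by (rule integral_FTC_Icc_nonneg[where F = "\<lambda>u. u\<^sup>2"]) (auto intro: F)
  moreover have "(LBINT u. indicator {0..1} u * (2 * u)) = (\<integral>u. 2 * u * indicator {0..1} u \<partial>(lborel :: real measure))"
    by (rule Bochner_Integration.integral_cong) simp_all
  ultimately show "(LBINT u. indicator {0..1} u * (2 * u)) = (1 :: real)" by simp
qed

lemma avg_favg: "avg (\<lambda>y. ennreal (f y + C)) z = ennreal (favg z + C)"
proof -
  let ?g = "\<lambda>u. indicator {0..1} u *\<^sub>R (2 * u * f (z * u)) + C * (indicator {0..1} u *\<^sub>R (2 * u))"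
  have "avg (\<lambda>y. ennreal (f y + C)) z = (\<integral>\<^sup>+u. ennreal (?g u) \<partial>lborel)"
    unfolding avg_def
  proof (intro nn_integral_cong)
    fix u
    have "0 \<le> f (z * u) + C" using f_bound[of "z * u"] by (simp add: abs_le_iff)
    then show "ennreal (2 * u) * ennreal (f (z * u) + C) * indicator {0..1} u = ennreal (?g u)"
      by (cases "u \<in> {0..1}") (auto simp: ennreal_mult[symmetric] algebra_simps)
  qed
  also have "\<dots> = ennreal (\<integral>u. ?g u \<partial>lborel)"
  proof (rule nn_integral_eq_integral)
    show "integrable lborel ?g" using favg_integrable integral_2u by simp
    show "AE u in lborel. 0 \<le> ?g u"
    proof (intro AE_I2)
      fix u
      have "0 \<le> f (z * u) + C" using f_bound[of "z * u"] by (simp add: abs_le_iff)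
      then have "0 \<le> 2 * u * (f (z * u) + C)" if "u \<in> {0..1}" using that by simp
      then show "0 \<le> ?g u" by (cases "u \<in> {0..1}") (auto simp: algebra_simps)
    qed
  qed
  also have "(\<integral>u. ?g u \<partial>lborel) = favg z + C"
    using favg_integrable[of z] integral_2u(1) by (simp add: favg_def set_lebesgue_integral_def integral_2u(2))
  finally show ?thesis .
qed

lemma favg_nonneg: "0 \<le> favg z + C" and favg_bound: "\<bar>favg z\<bar> \<le> C"
proof -
  have b: "\<bar>favg z\<bar> \<le> C"
  proof -
    have "\<bar>favg z\<bar> \<le> (\<integral>u. \<bar>indicator {0..1} u *\<^sub>R (2 * u * f (z * u))\<bar> \<partial>lborel)"
      unfolding favg_def set_lebesgue_integral_def by (rule integral_abs_bound)
    also have "\<dots> \<le> (\<integral>u. C * (indicator {0..1} u *\<^sub>R (2 * u)) \<partial>lborel)"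
    proof (rule integral_mono)
      show "integrable lborel (\<lambda>u. \<bar>indicator {0..1} u *\<^sub>R (2 * u * f (z * u))\<bar>)"
        using favg_integrable by (rule integrable_abs)
      show "integrable lborel (\<lambda>u. C * (indicator {0..1} u *\<^sub>R (2 * u)))" using integral_2u(1) by simp
      fix u
      show "\<bar>indicator {0..1} u *\<^sub>R (2 * u * f (z * u))\<bar> \<le> C * (indicator {0..1} u *\<^sub>R (2 * u))"
        using mult_left_mono[OF f_bound[of "z * u"], of "2 * u"]
        by (cases "u \<in> {0..1}") (auto simp: abs_mult mult_ac)
    qed
    also have "\<dots> = C" by (simp add: integral_2u(2))
    finally show ?thesis .
  qed
  then show "\<bar>favg z\<bar> \<le> C" "0 \<le> favg z + C" by (auto simp: abs_le_iff)
qed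

text \<open>The decomposition of \<open>Tn_Suc\<close>, but stopped right after the first jump and
  regardless of later ones. The plain average of \<open>h\<close> appears, which yields a time
  average along the flow.\<close>

lemma nn_after_law:
  assumes x: "0 < x" and t: "0 \<le> t" and [measurable]: "h \<in> borel_measurable borel"
  shows "(\<integral>\<^sup>+v. indicator {v. first v x \<le> ennreal t} v * h (after v x) \<partial>Om)
    = (\<integral>\<^sup>+s\<in>{0..t}. ennreal (jrate (x * exp s) * S0 s x) * avg h (x * exp s) \<partial>lborel)"
proof -
  have m: "(\<lambda>v. indicator {v. first v x \<le> ennreal t} v * h (after v x)) \<in> borel_measurable Om"
  proof -
    note [measurable] = Om_component
    have A: "{v. first v x \<le> ennreal t} \<in> sets Om"
      using measurable_sets_Collect[of "\<lambda>v. first v x \<le> ennreal t" Om] by (simp add: pred_def[symmetric])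
    have "(\<lambda>v. after v x) \<in> borel_measurable Om" by measurable
    from measurable_compose[OF this assms(3)] show ?thesis
      by (intro borel_measurable_times_ennreal borel_measurable_indicator A)
  qed
  have "(\<integral>\<^sup>+v. indicator {v. first v x \<le> ennreal t} v * h (after v x) \<partial>Om)
    = (\<integral>\<^sup>+a. (\<integral>\<^sup>+b. indicator {a. survival_inv R x a \<le> ennreal t} a * h (x * exp (enn2real (survival_inv R x a)) * sqrt b) \<partial>unif) \<partial>unif)"
    unfolding nn_integral_Om_case2[OF m]
    by (simp add: first_def after_def indicator_def canon.emeasure_space_1[simplified])
  also have "\<dots> = (\<integral>\<^sup>+a. indicator {a. survival_inv R x a \<le> ennreal t} a * avg h (x * exp (enn2real (survival_inv R x a))) \<partial>unif)"
  proof (intro nn_integral_cong)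
    fix a
    have "(\<integral>\<^sup>+b. h (z * sqrt b) \<partial>unif) = avg h z" for z
      unfolding avg_def by (rule nn_integral_unif_sqrt[of "\<lambda>w. h (z * w)"]) measurable
    moreover have "(\<integral>\<^sup>+b. indicator {a. survival_inv R x a \<le> ennreal t} a * h (z * sqrt b) \<partial>unif)
      = indicator {a. survival_inv R x a \<le> ennreal t} a * (\<integral>\<^sup>+b. h (z * sqrt b) \<partial>unif)" for z
      by (rule nn_integral_cmult) measurable
    ultimately show "(\<integral>\<^sup>+b. indicator {a. survival_inv R x a \<le> ennreal t} a * h (x * exp (enn2real (survival_inv R x a)) * sqrt b) \<partial>unif)
      = indicator {a. survival_inv R x a \<le> ennreal t} a * avg h (x * exp (enn2real (survival_inv R x a)))" by simp
  qed
  also have "\<dots> = (\<integral>\<^sup>+s\<in>{0..t}. ennreal (jrate (x * exp s) * S0 s x) * avg h (x * exp s) \<partial>lborel)"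
    by (rule first_law[OF x t]) measurable
  finally show ?thesis .
qed

text \<open>The jump rate may be unbounded, but weighted with the survival factor its integral is a
  probability.\<close>

lemma flow_integrable:
  assumes x: "0 < x" and t: "0 \<le> t" and [measurable]: "g \<in> borel_measurable borel" and g: "\<And>z. \<bar>g z\<bar> \<le> B"
  shows "set_integrable lborel {0..t} (\<lambda>s. S0 s x * (jrate (x * exp s) * g (x * exp s)))"
  unfolding set_integrable_def
proof (rule integrableI_bounded)
  have B: "0 \<le> B" using g[of 0] by simp
  have "(\<integral>\<^sup>+s. ennreal (norm (indicator {0..t} s *\<^sub>R (S0 s x * (jrate (x * exp s) * g (x * exp s))))) \<partial>lborel)
      \<le> (\<integral>\<^sup>+s. ennreal B * (ennreal (jrate (x * exp s) * S0 s x) * indicator {0..t} s) \<partial>lborel)"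
  proof (intro nn_integral_mono)
    fix s
    have j: "0 \<le> jrate (x * exp s)" "0 < S0 s x" using x by (simp_all add: jrate_nonneg S0_bounds)
    have "\<bar>S0 s x * (jrate (x * exp s) * g (x * exp s))\<bar> = (jrate (x * exp s) * S0 s x) * \<bar>g (x * exp s)\<bar>"
      using j by (simp add: abs_mult)
    also have "\<dots> \<le> (jrate (x * exp s) * S0 s x) * B"
      using j g by (intro mult_left_mono) auto
    finally have "ennreal \<bar>S0 s x * (jrate (x * exp s) * g (x * exp s))\<bar> \<le> ennreal B * ennreal (jrate (x * exp s) * S0 s x)"
      using j B by (simp add: ennreal_mult[symmetric] mult.commute ennreal_leI)
    then show "ennreal (norm (indicator {0..t} s *\<^sub>R (S0 s x * (jrate (x * exp s) * g (x * exp s)))))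
      \<le> ennreal B * (ennreal (jrate (x * exp s) * S0 s x) * indicator {0..t} s)"
      by (cases "s \<in> {0..t}") auto
  qed
  also have "\<dots> = ennreal B * (\<integral>\<^sup>+s\<in>{0..t}. ennreal (jrate (x * exp s) * S0 s x) \<partial>lborel)"
    by (rule nn_integral_cmult) measurable
  also have "\<dots> < \<infinity>" using nn_integral_hazard[OF x order_refl t] by (simp add: ennreal_mult_less_top)
  finally show "(\<integral>\<^sup>+s. ennreal (norm (indicator {0..t} s *\<^sub>R (S0 s x * (jrate (x * exp s) * g (x * exp s))))) \<partial>lborel) < \<infinity>" .
qed measurable

text \<open>As a time average, the jump probability divided by \<open>t\<close> falls under
  \<open>flow_avg_tendsto\<close> and converges to the jump rate in L1(\<pi>).\<close>

lemma flow_avg_jrate: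
  assumes x: "0 < x" and t: "0 \<le> t"
  shows "flow_avg jrate t x = 1 - S0 t x"
proof -
  have i: "set_integrable lborel {0..t} (\<lambda>s. S0 s x * (jrate (x * exp s) * 1))"
    using flow_integrable[OF x t, of "\<lambda>_. 1" 1] by simp
  have "ennreal (flow_avg jrate t x) = (\<integral>\<^sup>+s. ennreal (indicator {0..t} s *\<^sub>R (S0 s x * (jrate (x * exp s) * 1))) \<partial>lborel)"
    unfolding flow_avg_def set_lebesgue_integral_def using i x
    by (subst nn_integral_eq_integral) (auto simp: set_integrable_def jrate_nonneg S0_bounds less_imp_le)
  also have "\<dots> = (\<integral>\<^sup>+s\<in>{0..t}. ennreal (jrate (x * exp s) * S0 s x) \<partial>lborel)"
    by (intro nn_integral_cong) (auto simp: indicator_def mult.commute)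
  also have "\<dots> = ennreal (1 - S0 t x)" using nn_integral_hazard[OF x order_refl t] by simp
  finally show ?thesis
    using S0_bounds(2)[OF t, of x] x
    by (subst (asm) ennreal_inj) (auto simp: flow_avg_def set_lebesgue_integral_def jrate_nonneg S0_bounds less_imp_le intro!: integral_nonneg_AE)
qed

text \<open>Adding the bound \<open>C\<close> to \<open>f\<close> reduces the signed case to the nonnegative one.\<close>

lemma after_law:
  assumes x: "0 < x" and t: "0 \<le> t"
  shows "(\<integral>v. indicator {v. first v x \<le> ennreal t} v * f (after v x) \<partial>Om) = flow_avg (\<lambda>z. jrate z * favg z) t x"
proof -
  note [measurable] = Om_component
  have [measurable]: "{v. first v x \<le> ennreal t} \<in> sets Om"
    using measurable_sets_Collect[of "\<lambda>v. first v x \<le> ennreal t" Om] by (simp add: pred_def[symmetric])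
  have m1: "(\<lambda>v. indicator {v. first v x \<le> ennreal t} v * f (after v x)) \<in> borel_measurable Om"
    by (intro borel_measurable_times borel_measurable_indicator) measurable
  have i1: "integrable Om (\<lambda>v. indicator {v. first v x \<le> ennreal t} v * f (after v x))"
    by (rule canon.integrable_const_bound[where B = C]) (use m1 f_bound C_nonneg in \<open>auto simp: indicator_def\<close>)
  have i2: "integrable Om (\<lambda>v. C * indicator {v. first v x \<le> ennreal t} v)"
    by (intro integrable_mult_right canon.integrable_const_bound[where B = 1]) (auto simp: indicator_def)
  let ?I = "\<lambda>v. indicator {v. first v x \<le> ennreal t} v * f (after v x) + C * indicator {v. first v x \<le> ennreal t} v"
  let ?J = "\<lambda>s. indicator {0..t} s *\<^sub>R (S0 s x * (jrate (x * exp s) * favg (x * exp s))) + C * (indicator {0..t} s *\<^sub>R (S0 s x * (jrate (x * exp s) * 1)))"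
  have j1: "integrable lborel (\<lambda>s. indicator {0..t} s *\<^sub>R (S0 s x * (jrate (x * exp s) * favg (x * exp s))))"
    using flow_integrable[OF x t, of favg C] favg_bound by (simp add: set_integrable_def)
  have j2: "integrable lborel (\<lambda>s. indicator {0..t} s *\<^sub>R (S0 s x * (jrate (x * exp s) * 1)))"
    using flow_integrable[OF x t, of "\<lambda>_. 1" 1] by (simp add: set_integrable_def)
  have fC: "0 \<le> f y + C" for y using f_bound[of y] by (simp add: abs_le_iff)
  have I0: "0 \<le> ?I v" for v
    using fC[of "after v x"] by (auto simp: indicator_def)
  have J_eq: "?J s = indicator {0..t} s * ((jrate (x * exp s) * S0 s x) * (favg (x * exp s) + C))" for s
    by (simp add: algebra_simps)
  have J0: "0 \<le> ?J s" for s
    unfolding J_eq using x favg_nonneg by (auto simp: indicator_def jrate_nonneg S0_bounds less_imp_le intro!: mult_nonneg_nonneg)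
  have "ennreal (\<integral>v. ?I v \<partial>Om) = (\<integral>\<^sup>+v. ennreal (?I v) \<partial>Om)"
    using i1 i2 I0 by (intro nn_integral_eq_integral[symmetric]) auto
  also have "\<dots> = (\<integral>\<^sup>+v. indicator {v. first v x \<le> ennreal t} v * ennreal (f (after v x) + C) \<partial>Om)"
    by (intro nn_integral_cong) (auto simp: indicator_def)
  also have "\<dots> = (\<integral>\<^sup>+s\<in>{0..t}. ennreal (jrate (x * exp s) * S0 s x) * avg (\<lambda>y. ennreal (f y + C)) (x * exp s) \<partial>lborel)"
    by (rule nn_after_law[OF x t]) measurable
  also have "\<dots> = (\<integral>\<^sup>+s. ennreal (?J s) \<partial>lborel)"
    unfolding avg_favg J_eq using x favg_nonneg
    by (intro nn_integral_cong) (auto simp: indicator_def ennreal_mult jrate_nonneg S0_bounds less_imp_le)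
  also have "\<dots> = ennreal (\<integral>s. ?J s \<partial>lborel)"
    using j1 j2 J0 by (intro nn_integral_eq_integral) auto
  finally have "(\<integral>v. ?I v \<partial>Om) = (\<integral>s. ?J s \<partial>lborel)"
    using I0 J0 by (subst (asm) ennreal_inj) (auto intro!: integral_nonneg_AE)
  moreover have "(\<integral>v. ?I v \<partial>Om) = (\<integral>v. indicator {v. first v x \<le> ennreal t} v * f (after v x) \<partial>Om) + C * (1 - S0 t x)"
    using i1 i2 measure_first[OF t, of x] by (simp add: S0_def)
  moreover have "(\<integral>s. ?J s \<partial>lborel) = flow_avg (\<lambda>z. jrate z * favg z) t x + C * (1 - S0 t x)"
    using j1 j2 flow_avg_jrate[OF x t] by (simp add: flow_avg_def set_lebesgue_integral_def)
  ultimately show ?thesis by simp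
qed

text \<open>The probability of at least two jumps, explosion included.\<close>

definition multi :: "real \<Rightarrow> real \<Rightarrow> ennreal" where
  "multi t x = (\<integral>\<^sup>+v. indicator {v. \<not> count 0 v x t \<and> \<not> count (Suc 0) v x t} v \<partial>Om)"

lemma multi_sets: "{v. \<not> count 0 v x t \<and> \<not> count (Suc 0) v x t} \<in> sets Om"
proof -
  have "{v. \<not> count 0 v x t \<and> \<not> count (Suc 0) v x t} = (space Om - {v. count 0 v x t}) \<inter> (space Om - {v. count (Suc 0) v x t})"
    by auto
  also have "\<dots> \<in> sets Om" by (intro sets.Int sets.compl_sets count_Om_sets)
  finally show ?thesis .
qed

lemma multi_sum: "Tn 0 t (\<lambda>_. 1) x + Tn (Suc 0) t (\<lambda>_. 1) x + multi t x = 1"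
proof -
  have "Tn 0 t (\<lambda>_. 1) x + Tn (Suc 0) t (\<lambda>_. 1) x + multi t x
    = (\<integral>\<^sup>+v. indicator {v. count 0 v x t} v * 1 + indicator {v. count (Suc 0) v x t} v * 1
        + indicator {v. \<not> count 0 v x t \<and> \<not> count (Suc 0) v x t} v \<partial>Om)"
    unfolding Tn_def multi_def using multi_sets count_Om_sets
    by (simp add: nn_integral_add)
  also have "\<dots> = (\<integral>\<^sup>+v. 1 \<partial>Om)"
    by (intro nn_integral_cong) (auto simp: indicator_def dest: count_unique)
  finally show ?thesis by (simp add: canon.emeasure_space_1[simplified])
qed

lemma multi_measurable [measurable]: "multi t \<in> borel_measurable borel"
proof -
  have "multi t x = 1 - (Tn 0 t (\<lambda>_. 1) x + Tn (Suc 0) t (\<lambda>_. 1) x)" for x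
  proof -
    have "Tn 0 t (\<lambda>_. 1) x + Tn (Suc 0) t (\<lambda>_. 1) x \<noteq> top" using multi_sum[of t x] by auto
    then have "multi t x = (Tn 0 t (\<lambda>_. 1) x + Tn (Suc 0) t (\<lambda>_. 1) x + multi t x) - (Tn 0 t (\<lambda>_. 1) x + Tn (Suc 0) t (\<lambda>_. 1) x)"
      by simp
    then show ?thesis by (simp only: multi_sum)
  qed
  then have "multi t = (\<lambda>x. 1 - (Tn 0 t (\<lambda>_. 1) x + Tn (Suc 0) t (\<lambda>_. 1) x))" by (rule ext)
  moreover have "(\<lambda>x. 1 - (Tn 0 t (\<lambda>_. 1) x + Tn (Suc 0) t (\<lambda>_. 1) x)) \<in> borel_measurable borel" by measurable
  ultimately show ?thesis by simp
qed

text \<open>The Poisson law gives \<open>1 - e^(-2t) (1 + 2t)\<close>, and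
  \<open>e^(-2t) \<ge> 1 - 2t\<close> bounds it by
  \<open>1 - (1 - 2t) (1 + 2t) = 4 t^2\<close>.\<close>

lemma dens_multi:
  assumes t: "0 \<le> t"
  shows "(\<integral>\<^sup>+x. dens x * multi t x \<partial>lborel) \<le> ennreal (4 * t\<^sup>2)"
proof -
  let ?M = "\<integral>\<^sup>+x. dens x * multi t x \<partial>lborel"
  have "ennreal (pois 0 t) + ennreal (pois (Suc 0) t) + ?M
     = (\<integral>\<^sup>+x. dens x * Tn 0 t (\<lambda>_. 1) x + dens x * Tn (Suc 0) t (\<lambda>_. 1) x + dens x * multi t x \<partial>lborel)"
    using dens_Tn[OF t, of "\<lambda>_. 1" 0] dens_Tn[OF t, of "\<lambda>_. 1" "Suc 0"]
    by (simp add: nn_integral_add mass_dens)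
  also have "\<dots> = (\<integral>\<^sup>+x. dens x * 1 \<partial>lborel)"
    unfolding distrib_left[symmetric] multi_sum ..
  also have "\<dots> = 1" by (simp add: mass_dens)
  finally have eq: "ennreal (pois 0 t) + ennreal (pois (Suc 0) t) + ?M = 1" .
  then have "?M \<le> 1" by (metis le_add2 add.commute le_iff_add)
  then have "?M < top" by (auto intro: order_le_less_trans)
  then obtain m where m: "?M = ennreal m" "0 \<le> m" by (cases ?M) auto
  have "ennreal (pois 0 t + pois (Suc 0) t + m) = ennreal 1"
    using eq m pois_nonneg[OF t] by simp
  then have "pois 0 t + pois (Suc 0) t + m = 1"
    using m pois_nonneg[OF t, of 0] pois_nonneg[OF t, of "Suc 0"] by (subst (asm) ennreal_inj) auto
  moreover have "(1 - 2 * t) * (1 + 2 * t) \<le> exp (- 2 * t) * (1 + 2 * t)"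
    using exp_ge_add_one_self[of "- 2 * t"] t by (intro mult_right_mono) auto
  ultimately have "m \<le> 4 * t\<^sup>2"
    by (simp add: pois_def algebra_simps power2_eq_square)
  then show ?thesis using m by (simp add: ennreal_leI)
qed

text \<open>\<open>f\<close> at time \<open>t\<close> is compared with \<open>f (x e^t)\<close>
  before the first jump and with \<open>f\<close> at the post-jump position afterwards. Without a
  jump there is no error; with exactly one, the growth after it lasts at most \<open>t\<close> and
  costs \<open>C1 * t\<close>; otherwise the error is at most \<open>2 * C\<close>.\<close>

lemma Pr_expansion:
  assumes x: "0 < x" and t: "0 \<le> t"
  shows "ennreal \<bar>Pr t f x - S0 t x * f (x * exp t) - flow_avg (\<lambda>z. jrate z * favg z) t x\<bar>
    \<le> ennreal (C1 * t) * Tn (Suc 0) t (\<lambda>_. 1) x + ennreal (2 * C) * multi t x"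
proof -
  note [measurable] = Om_component
  have [measurable]: "{v. first v x \<le> ennreal t} \<in> sets Om"
    using measurable_sets_Collect[of "\<lambda>v. first v x \<le> ennreal t" Om] by (simp add: pred_def[symmetric])
  let ?F = "\<lambda>v. indicator {v. first v x \<le> ennreal t} v :: real"
  have m1: "(\<lambda>v. ?F v * f (after v x)) \<in> borel_measurable Om"
    by (intro borel_measurable_times borel_measurable_indicator) measurable
  have iF: "integrable Om ?F"
    by (rule canon.integrable_const_bound[where B = 1]) (auto simp: indicator_def)
  have i1: "integrable Om (\<lambda>v. ?F v * f (after v x))"
    by (rule canon.integrable_const_bound[where B = C]) (use m1 f_bound C_nonneg in \<open>auto simp: indicator_def\<close>)
  have i2: "integrable Om (\<lambda>v. (1 - ?F v) * f (x * exp t))"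
    using iF by (intro integrable_mult_left Bochner_Integration.integrable_diff canon.integrable_const)
  have i3: "integrable Om (\<lambda>v. f (Z v x t))" using f_bound by (rule integrable_Z[OF f_measurable])
  \<comment> \<open>The pathwise error of this comparison.\<close>
  let ?W = "\<lambda>v. f (Z v x t) - (1 - ?F v) * f (x * exp t) - ?F v * f (after v x)"
  have "(\<integral>v. (1 - ?F v) * f (x * exp t) \<partial>Om) = S0 t x * f (x * exp t)"
    using iF measure_first[OF t, of x] by (simp add: S0_def)
  then have "Pr t f x - S0 t x * f (x * exp t) - flow_avg (\<lambda>z. jrate z * favg z) t x = (\<integral>v. ?W v \<partial>Om)"
    unfolding Bochner_Integration.integral_diff[OF Bochner_Integration.integrable_diff[OF i3 i2] i1]
      Bochner_Integration.integral_diff[OF i3 i2] Pr_def after_law[OF x t] by (simp only:)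
  then have "ennreal \<bar>Pr t f x - S0 t x * f (x * exp t) - flow_avg (\<lambda>z. jrate z * favg z) t x\<bar> \<le> (\<integral>\<^sup>+v. ennreal (norm (?W v)) \<partial>Om)"
    using integral_norm_bound_ennreal[of Om ?W] i1 i2 i3 by simp
  also have "\<dots> \<le> (\<integral>\<^sup>+v. ennreal (C1 * t) * (indicator {v. count (Suc 0) v x t} v * 1)
      + ennreal (2 * C) * indicator {v. \<not> count 0 v x t \<and> \<not> count (Suc 0) v x t} v \<partial>Om)"
  proof (rule nn_integral_mono_AE, use AE_good in eventually_elim)
    case (elim v)
    show ?case
    proof (cases "first v x \<le> ennreal t")
      case False
      then have "Z v x t = x * exp t" by (intro Z_before x) simp
      then show ?thesis using False by simp
    next
      case le: True
      then have n0: "\<not> count 0 v x t" by (simp add: count_0_iff not_less)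
      let ?s = "t - enn2real (first v x)"
      have s: "0 \<le> ?s" "?s \<le> t" using enn2real_leI[OF t le] by auto
      show ?thesis
      proof (cases "count (Suc 0) v x t")
        case True
        then have c: "count 0 (shift v) (after v x) ?s" using count_Suc_iff[OF t le] by simp
        have "Z v x t = after v x * exp ?s"
          using Z_after[OF t le x elim] Z_before[OF after_pos[OF x elim], of ?s "shift v"] c by (simp add: count_0_iff)
        then have "\<bar>f (Z v x t) - f (after v x)\<bar> \<le> C1 * ?s"
          using f_lipschitz[OF after_pos[OF x elim] s(1)] by simp
        also have "\<dots> \<le> C1 * t" using s C1_nonneg by (intro mult_left_mono) auto
        finally show ?thesis using True le n0 by (simp add: ennreal_leI)
      next
        case False
        have "\<bar>f (Z v x t) - f (after v x)\<bar> \<le> 2 * C"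
          using f_bound[of "Z v x t"] f_bound[of "after v x"] by linarith
        then show ?thesis using False le n0 by (simp add: ennreal_leI)
      qed
    qed
  qed
  also have "\<dots> = ennreal (C1 * t) * Tn (Suc 0) t (\<lambda>_. 1) x + ennreal (2 * C) * multi t x"
    unfolding Tn_def multi_def using multi_sets count_Om_sets
    by (simp add: nn_integral_add nn_integral_cmult)
  finally show ?thesis .
qed

definition err :: "real \<Rightarrow> real \<Rightarrow> real" where
  "err t x = (Pr t f x - S0 t x * f (x * exp t) - flow_avg (\<lambda>z. jrate z * favg z) t x) / t"

text \<open>One jump has \<pi>-probability at most 2t and error \<open>C1 * t\<close>; more jumps
  have at most \<open>4 t^2\<close> and error \<open>2 * C\<close>. Division by \<open>t\<close>
  leaves a bound of order \<open>t\<close>.\<close>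

lemma L1_err: "((\<lambda>t. L1 (err t)) \<longlongrightarrow> 0) (at_right 0)"
proof (rule tendsto_ennreal_0_le)
  have "((\<lambda>t. ennreal (2 * C1 * t + 8 * C * t)) \<longlongrightarrow> ennreal (2 * C1 * 0 + 8 * C * 0)) (at_right 0)"
    by (intro tendsto_intros)
  then show "((\<lambda>t. ennreal (2 * C1 * t + 8 * C * t)) \<longlongrightarrow> 0) (at_right 0)" by simp
  show "eventually (\<lambda>t. L1 (err t) \<le> ennreal (2 * C1 * t + 8 * C * t)) (at_right 0)"
    using eventually_at_right_less[of "0::real"]
  proof eventually_elim
    case (elim t)
    have "L1 (err t) \<le> (\<integral>\<^sup>+x. ennreal (1 / t) * (ennreal (C1 * t) * (dens x * Tn (Suc 0) t (\<lambda>_. 1) x) + ennreal (2 * C) * (dens x * multi t x)) \<partial>lborel)"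
    proof (intro nn_integral_mono)
      fix x
      show "dens x * ennreal \<bar>err t x\<bar> \<le> ennreal (1 / t) * (ennreal (C1 * t) * (dens x * Tn (Suc 0) t (\<lambda>_. 1) x) + ennreal (2 * C) * (dens x * multi t x))"
      proof (cases "0 < x")
        case True
        let ?d = "Pr t f x - S0 t x * f (x * exp t) - flow_avg (\<lambda>z. jrate z * favg z) t x"
        have "\<bar>err t x\<bar> = (1 / t) * \<bar>?d\<bar>" using elim by (simp add: err_def)
        then have "dens x * ennreal \<bar>err t x\<bar> = dens x * (ennreal (1 / t) * ennreal \<bar>?d\<bar>)"
          using elim by (simp only: ennreal_mult[symmetric] abs_ge_zero zero_le_divide_1_iff less_imp_le)
        also have "\<dots> \<le> dens x * (ennreal (1 / t) * (ennreal (C1 * t) * Tn (Suc 0) t (\<lambda>_. 1) x + ennreal (2 * C) * multi t x))"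
          using elim True by (intro mult_left_mono Pr_expansion) auto
        finally show ?thesis by (simp add: distrib_left mult_ac)
      qed (simp add: dens_nonpos)
    qed
    also have "\<dots> = ennreal (1 / t) * (ennreal (C1 * t) * (\<integral>\<^sup>+x. dens x * Tn (Suc 0) t (\<lambda>_. 1) x \<partial>lborel)
        + ennreal (2 * C) * (\<integral>\<^sup>+x. dens x * multi t x \<partial>lborel))"
      by (simp add: nn_integral_cmult nn_integral_add)
    also have "\<dots> \<le> ennreal (1 / t) * (ennreal (C1 * t) * ennreal (2 * t) + ennreal (2 * C) * ennreal (4 * t\<^sup>2))"
    proof (intro mult_left_mono add_mono)
      have "pois (Suc 0) t \<le> 2 * t" using elim by (simp add: pois_def mult_left_le_one_le)
      then show "(\<integral>\<^sup>+x. dens x * Tn (Suc 0) t (\<lambda>_. 1) x \<partial>lborel) \<le> ennreal (2 * t)"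
        using dens_Tn[of t "\<lambda>_. 1" "Suc 0"] elim by (simp add: mass_dens ennreal_leI)
      show "(\<integral>\<^sup>+x. dens x * multi t x \<partial>lborel) \<le> ennreal (4 * t\<^sup>2)" using elim by (intro dens_multi) simp
    qed simp_all
    also have "\<dots> = ennreal ((1 / t) * (C1 * t * (2 * t) + 2 * C * (4 * t\<^sup>2)))"
      using elim C_nonneg C1_nonneg by (simp add: ennreal_mult[symmetric] ennreal_plus[symmetric] del: ennreal_plus)
    also have "(1 / t) * (C1 * t * (2 * t) + 2 * C * (4 * t\<^sup>2)) = 2 * C1 * t + 8 * C * t"
      using elim by (simp add: field_simps power2_eq_square)
    finally show ?case .
  qed
qed

text \<open>This is \<open>dens_jump\<close> for the constant 1: the mean jump rate under \<pi> is
  2.\<close>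

lemma L1_jrate: "(\<integral>\<^sup>+x. dens x * ennreal (jrate x) \<partial>lborel) = 2"
proof -
  have "avg (\<lambda>_. 1) z = 1" for z
  proof -
    have "avg (\<lambda>_. 1) z = (\<integral>\<^sup>+u. ennreal (2 * u) * indicator {0..1} u \<partial>lborel)" by (simp add: avg_def)
    also have "\<dots> = ennreal (1\<^sup>2 - 0\<^sup>2)"
      by (rule nn_integral_FTC_Icc[where F = "\<lambda>u. u\<^sup>2"]) (auto intro!: derivative_eq_intros)
    finally show ?thesis by simp
  qed
  then show ?thesis using dens_jump[of "\<lambda>_. 1"] by (simp add: mass_dens)
qed

lemma L1_jrate_bounded:
  assumes [measurable]: "g \<in> borel_measurable borel" and g: "\<And>z. \<bar>g z\<bar> \<le> B"
  shows "L1 (\<lambda>z. jrate z * g z) < top"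
proof -
  have B: "0 \<le> B" using g[of 0] by simp
  have "L1 (\<lambda>z. jrate z * g z) \<le> (\<integral>\<^sup>+x. ennreal B * (dens x * ennreal (jrate x)) \<partial>lborel)"
  proof (intro nn_integral_mono)
    fix x
    show "dens x * ennreal \<bar>jrate x * g x\<bar> \<le> ennreal B * (dens x * ennreal (jrate x))"
    proof (cases "0 < x")
      case True
      then have "\<bar>jrate x * g x\<bar> \<le> B * jrate x"
        using g[of x] jrate_nonneg[of x] by (simp add: abs_mult mult.commute mult_right_mono)
      then have "ennreal \<bar>jrate x * g x\<bar> \<le> ennreal B * ennreal (jrate x)"
        using B True jrate_nonneg[of x] by (simp add: ennreal_mult[symmetric] ennreal_leI)
      then have "dens x * ennreal \<bar>jrate x * g x\<bar> \<le> dens x * (ennreal B * ennreal (jrate x))" by (rule mult_left_mono) simp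
      then show ?thesis by (simp add: mult_ac)
    qed (simp add: dens_nonpos)
  qed
  also have "\<dots> = ennreal B * 2" by (subst nn_integral_cmult) (simp_all add: L1_jrate)
  also have "\<dots> < top" by (simp add: ennreal_mult_less_top)
  finally show ?thesis .
qed

section \<open>Assembling the generator\<close>

definition gen :: "real \<Rightarrow> real" where
  "gen x = x * D x + jrate x * (favg x - f x)"

lemma gen_measurable [measurable]: "gen \<in> borel_measurable borel"
  unfolding gen_def by measurable

lemma flow_tendsto: "((\<lambda>t. f (x * exp t)) \<longlongrightarrow> f x) (at_right 0)" if "0 < x"
proof -
  have "((\<lambda>t. f (x * exp t) - f x) \<longlongrightarrow> 0) (at_right 0)"
  proof (rule Lim_null_comparison)
    have "((\<lambda>t. C1 * t) \<longlongrightarrow> C1 * 0) (at_right 0)" by (intro tendsto_intros)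
    then show "((\<lambda>t. C1 * t) \<longlongrightarrow> 0) (at_right 0)" by simp
    show "eventually (\<lambda>t. norm (f (x * exp t) - f x) \<le> C1 * t) (at_right 0)"
      using eventually_at_right_less[of "0::real"] by eventually_elim (use f_lipschitz[OF that] in simp)
  qed
  from tendsto_add[OF this tendsto_const[of "f x"]] show ?thesis by simp
qed

lemma ennreal_abs_add_le: "ennreal \<bar>a + b\<bar> \<le> ennreal \<bar>a\<bar> + ennreal \<bar>b :: real\<bar>"
  by (rule ennreal_le_add) simp_all

lemma L1_add_le:
  assumes [measurable]: "g \<in> borel_measurable borel" "h \<in> borel_measurable borel"
  shows "L1 (\<lambda>x. g x + h x) \<le> L1 g + L1 h"
proof -
  have "L1 (\<lambda>x. g x + h x) \<le> (\<integral>\<^sup>+x. dens x * ennreal \<bar>g x\<bar> + dens x * ennreal \<bar>h x\<bar> \<partial>lborel)"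
    unfolding distrib_left[symmetric] by (intro nn_integral_mono mult_left_mono ennreal_abs_add_le) simp
  also have "\<dots> = L1 g + L1 h" by (rule nn_integral_add) measurable
  finally show ?thesis .
qed

lemma flow_avg_measurable [measurable]:
  assumes [measurable]: "\<psi> \<in> borel_measurable borel"
  shows "flow_avg \<psi> t \<in> borel_measurable borel"
proof -
  have "(\<lambda>(x, s). indicator {0..t} s *\<^sub>R (S0 s x * \<psi> (x * exp s))) \<in> borel_measurable (borel \<Otimes>\<^sub>M lborel)"
    by measurable
  then show ?thesis
    unfolding flow_avg_def set_lebesgue_integral_def by (rule lborel.borel_measurable_lebesgue_integral)
qed

lemma err_measurable [measurable]: "err t \<in> borel_measurable borel"
  unfolding err_def by measurable

theorem L1_generator: "((\<lambda>t. L1 (\<lambda>x. (Pr t f x - f x) / t - gen x)) \<longlongrightarrow> 0) (at_right 0)"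
proof -
  \<comment> \<open>The error splits as \<open>err + a - b' - c + d\<close>. Here \<open>a\<close>
    is the growth quotient minus its limit, \<open>b\<close> compares the jump probability divided
    by \<open>t\<close> with the rate and is weighted in \<open>b'\<close> by the grown value of
    \<open>f\<close>, \<open>c\<close> replaces that grown value by \<open>f x\<close> in the loss
    term, and \<open>d\<close> is the gain term minus its limit.\<close>
  let ?a = "\<lambda>t x. (f (x * exp t) - f x) / t - x * D x"
  let ?b = "\<lambda>t x. flow_avg jrate t x / t - jrate x"
  let ?b' = "\<lambda>t x. f (x * exp t) * ?b t x"
  let ?c = "\<lambda>t x. (f (x * exp t) - f x) * jrate x"
  let ?d = "\<lambda>t x. flow_avg (\<lambda>z. jrate z * favg z) t x / t - jrate x * favg x"
  have fin: "L1 jrate < top"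
    using L1_jrate_bounded[of "\<lambda>_. 1" 1] by simp
  have a: "((\<lambda>t. L1 (?a t)) \<longlongrightarrow> 0) (at_right 0)"
  proof (rule tendsto_L1_dominated[where w = "\<lambda>_. 2 * C1"])
    show "(\<integral>\<^sup>+x. dens x * ennreal (2 * C1) \<partial>lborel) < top"
      by (subst nn_integral_multc) (simp_all add: mass_dens)
    show "\<bar>?a t x\<bar> \<le> 2 * C1" if "0 < t" "0 < x" for t x
    proof -
      have "\<bar>(f (x * exp t) - f x) / t\<bar> \<le> C1"
        using f_lipschitz[OF that(2), of t] that by (simp add: pos_divide_le_eq)
      then show ?thesis using D_bound[OF that(2)] by linarith
    qed
    show "AE x in lborel. 0 < x \<longrightarrow> ((\<lambda>t. ?a t x) \<longlongrightarrow> 0) (at_right 0)"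
    proof (intro AE_I2 impI)
      fix x :: real assume "0 < x"
      from tendsto_diff[OF f_deriv[OF this] tendsto_const[of "x * D x"]]
      show "((\<lambda>t. ?a t x) \<longlongrightarrow> 0) (at_right 0)" by simp
    qed
  qed measurable
  have b: "((\<lambda>t. L1 (?b t)) \<longlongrightarrow> 0) (at_right 0)"
  proof (rule flow_avg_tendsto[OF _ fin])
    show "set_integrable lborel {0..t} (\<lambda>s. S0 s x * jrate (x * exp s))" if "0 < x" "0 < t" for t x
      using flow_integrable[of x t "\<lambda>_. 1" 1] that by simp
  qed measurable
  have b': "((\<lambda>t. L1 (?b' t)) \<longlongrightarrow> 0) (at_right 0)"
  proof (rule tendsto_ennreal_0_le)
    have "((\<lambda>t. ennreal C * L1 (?b t)) \<longlongrightarrow> ennreal C * 0) (at_right 0)"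
      by (rule tendsto_mult_ennreal[OF tendsto_const b]) simp
    then show "((\<lambda>t. ennreal C * L1 (?b t)) \<longlongrightarrow> 0) (at_right 0)" by simp
    show "eventually (\<lambda>t. L1 (?b' t) \<le> ennreal C * L1 (?b t)) (at_right 0)"
    proof (intro always_eventually allI)
      fix t
      have "L1 (?b' t) \<le> (\<integral>\<^sup>+x. ennreal C * (dens x * ennreal \<bar>?b t x\<bar>) \<partial>lborel)"
      proof (intro nn_integral_mono)
        fix x
        have "\<bar>?b' t x\<bar> \<le> C * \<bar>?b t x\<bar>"
          unfolding abs_mult using f_bound by (intro mult_right_mono) auto
        then have "ennreal \<bar>?b' t x\<bar> \<le> ennreal C * ennreal \<bar>?b t x\<bar>"
          using C_nonneg by (simp only: ennreal_mult[symmetric] abs_ge_zero ennreal_leI)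
        then have "dens x * ennreal \<bar>?b' t x\<bar> \<le> dens x * (ennreal C * ennreal \<bar>?b t x\<bar>)" by (rule mult_left_mono) simp
        then show "dens x * ennreal \<bar>?b' t x\<bar> \<le> ennreal C * (dens x * ennreal \<bar>?b t x\<bar>)" by (simp only: mult_ac)
      qed
      also have "\<dots> = ennreal C * L1 (?b t)" by (rule nn_integral_cmult) measurable
      finally show "L1 (?b' t) \<le> ennreal C * L1 (?b t)" .
    qed
  qed
  have c: "((\<lambda>t. L1 (?c t)) \<longlongrightarrow> 0) (at_right 0)"
  proof (rule tendsto_L1_dominated[where w = "\<lambda>x. 2 * C * jrate x"])
    have "(\<integral>\<^sup>+x. dens x * ennreal (2 * C * jrate x) \<partial>lborel) = (\<integral>\<^sup>+x. ennreal (2 * C) * (dens x * ennreal (jrate x)) \<partial>lborel)"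
    proof (intro nn_integral_cong)
      fix x show "dens x * ennreal (2 * C * jrate x) = ennreal (2 * C) * (dens x * ennreal (jrate x))"
        using C_nonneg jrate_nonneg[of x] by (cases "0 < x") (simp_all add: dens_nonpos ennreal_mult mult_ac)
    qed
    also have "\<dots> = ennreal (2 * C) * 2" by (subst nn_integral_cmult) (simp_all add: L1_jrate)
    finally show "(\<integral>\<^sup>+x. dens x * ennreal (2 * C * jrate x) \<partial>lborel) < top" by (simp add: ennreal_mult_less_top)
    show "\<bar>?c t x\<bar> \<le> 2 * C * jrate x" if "0 < t" "0 < x" for t x
    proof -
      have "\<bar>f (x * exp t) - f x\<bar> \<le> 2 * C" using f_bound[of "x * exp t"] f_bound[of x] by linarith
      then show ?thesis using jrate_nonneg[of x] that by (simp add: abs_mult mult_right_mono)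
    qed
    show "AE x in lborel. 0 < x \<longrightarrow> ((\<lambda>t. ?c t x) \<longlongrightarrow> 0) (at_right 0)"
    proof (intro AE_I2 impI)
      fix x :: real assume "0 < x"
      have "((\<lambda>t. ?c t x) \<longlongrightarrow> (f x - f x) * jrate x) (at_right 0)"
        by (intro tendsto_intros flow_tendsto) fact
      then show "((\<lambda>t. ?c t x) \<longlongrightarrow> 0) (at_right 0)" by simp
    qed
  qed measurable
  have d: "((\<lambda>t. L1 (?d t)) \<longlongrightarrow> 0) (at_right 0)"
  proof (rule flow_avg_tendsto)
    show "L1 (\<lambda>z. jrate z * favg z) < top" by (rule L1_jrate_bounded[OF _ favg_bound]) measurable
    show "set_integrable lborel {0..t} (\<lambda>s. S0 s x * (jrate (x * exp s) * favg (x * exp s)))" if "0 < x" "0 < t" for t x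
      using flow_integrable[of x t favg C] that favg_bound by simp
  qed measurable
  have "((\<lambda>t. L1 (err t) + (L1 (?a t) + (L1 (?b' t) + (L1 (?c t) + L1 (?d t))))) \<longlongrightarrow> 0 + (0 + (0 + (0 + 0)))) (at_right 0)"
    by (intro tendsto_add L1_err a b' c d)
  then have "((\<lambda>t. L1 (err t) + (L1 (?a t) + (L1 (?b' t) + (L1 (?c t) + L1 (?d t))))) \<longlongrightarrow> 0) (at_right 0)" by simp
  then show ?thesis
  proof (rule tendsto_ennreal_0_le)
    show "eventually (\<lambda>t. L1 (\<lambda>x. (Pr t f x - f x) / t - gen x)
        \<le> L1 (err t) + (L1 (?a t) + (L1 (?b' t) + (L1 (?c t) + L1 (?d t))))) (at_right 0)"
      using eventually_at_right_less[of "0::real"]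
    proof eventually_elim
      case (elim t)
      have "L1 (\<lambda>x. (Pr t f x - f x) / t - gen x) = L1 (\<lambda>x. err t x + (?a t x + (- ?b' t x + (- ?c t x + ?d t x))))"
      proof (intro nn_integral_cong)
        fix x
        show "dens x * ennreal \<bar>(Pr t f x - f x) / t - gen x\<bar> = dens x * ennreal \<bar>err t x + (?a t x + (- ?b' t x + (- ?c t x + ?d t x)))\<bar>"
        proof (cases "0 < x")
          case True
          have "S0 t x = 1 - flow_avg jrate t x" using flow_avg_jrate[OF True, of t] elim by simp
          then have "err t x = (Pr t f x - (1 - flow_avg jrate t x) * f (x * exp t) - flow_avg (\<lambda>z. jrate z * favg z) t x) / t"
            by (simp add: err_def)
          then have "(Pr t f x - f x) / t - gen x = err t x + (?a t x + (- ?b' t x + (- ?c t x + ?d t x)))"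
            by (simp add: gen_def diff_divide_distrib add_divide_distrib algebra_simps)
          then show ?thesis by (simp only:)
        qed (simp add: dens_nonpos)
      qed
      also have "\<dots> \<le> L1 (err t) + L1 (\<lambda>x. ?a t x + (- ?b' t x + (- ?c t x + ?d t x)))"
        by (rule L1_add_le) measurable
      also have "\<dots> \<le> L1 (err t) + (L1 (?a t) + L1 (\<lambda>x. - ?b' t x + (- ?c t x + ?d t x)))"
        by (intro add_left_mono L1_add_le) measurable
      also have "\<dots> \<le> L1 (err t) + (L1 (?a t) + (L1 (\<lambda>x. - ?b' t x) + L1 (\<lambda>x. - ?c t x + ?d t x)))"
        by (intro add_left_mono L1_add_le) measurable
      also have "\<dots> \<le> L1 (err t) + (L1 (?a t) + (L1 (\<lambda>x. - ?b' t x) + (L1 (\<lambda>x. - ?c t x) + L1 (?d t))))"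
        by (intro add_left_mono L1_add_le) measurable
      finally show ?case by (simp only: abs_minus_cancel)
    qed
  qed
qed

lemma gen_L1: "L1 gen < top"
proof -
  have "L1 gen \<le> L1 (\<lambda>x. x * D x) + L1 (\<lambda>x. jrate x * (favg x - f x))"
    unfolding gen_def by (rule L1_add_le) measurable
  moreover have "L1 (\<lambda>x. x * D x) \<le> (\<integral>\<^sup>+x. dens x * ennreal C1 \<partial>lborel)"
  proof (intro nn_integral_mono)
    fix x show "dens x * ennreal \<bar>x * D x\<bar> \<le> dens x * ennreal C1"
      using D_bound[of x] by (cases "0 < x") (auto simp: dens_nonpos intro!: mult_left_mono ennreal_leI)
  qed
  moreover have "(\<integral>\<^sup>+x. dens x * ennreal C1 \<partial>lborel) < top"
    by (subst nn_integral_multc) (simp_all add: mass_dens)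
  moreover have "L1 (\<lambda>x. jrate x * (favg x - f x)) < top"
  proof (rule L1_jrate_bounded)
    show "\<bar>favg z - f z\<bar> \<le> 2 * C" for z using favg_bound[of z] f_bound[of z] by linarith
  qed measurable
  ultimately show ?thesis by (meson ennreal_add_less_top order_le_less_trans)
qed

end

section \<open>The theorem\<close>

text \<open>Differentiating along the flow, \<open>r \<mapsto> f (y e^r)\<close> has derivative
  \<open>x f'(x)\<close> at \<open>x = y e^r\<close>, which is bounded by compactness of the
  support. This gives the Lipschitz bound and the limit of the growth quotient.\<close>

lemma C1c_pos_properties:
  assumes "C1c_pos f"
  obtains D C C1 where "f \<in> borel_measurable borel" "D \<in> borel_measurable borel"
    "\<And>x. \<bar>f x\<bar> \<le> C" "\<And>x. 0 < x \<Longrightarrow> \<bar>x * D x\<bar> \<le> C1"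
    "\<And>y r. 0 < y \<Longrightarrow> 0 \<le> r \<Longrightarrow> \<bar>f (y * exp r) - f y\<bar> \<le> C1 * r"
    "\<And>x. 0 < x \<Longrightarrow> ((\<lambda>t. (f (x * exp t) - f x) / t) \<longlongrightarrow> x * D x) (at_right 0)"
    "\<And>x. 0 < x \<Longrightarrow> D x = deriv f x" "\<And>x. x \<le> 0 \<Longrightarrow> f x = 0"
proof -
  obtain K where K: "compact K" "K \<subseteq> {0<..}" "\<And>x. x \<notin> K \<Longrightarrow> f x = 0"
    using assms by (auto simp: C1c_pos_def)
  obtain D0 where D0: "\<And>x. 0 < x \<Longrightarrow> (f has_vector_derivative D0 x) (at x)" "continuous_on {0<..} D0"
    using assms by (auto simp: C1c_pos_def C1_differentiable_on_def)
  define D where "D x = indicator {0<..} x *\<^sub>R D0 x" for x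
  have der: "(f has_real_derivative D x) (at x)" if "0 < x" for x
    using D0(1)[OF that] that by (simp add: D_def has_real_derivative_iff_has_vector_derivative)
  have f_cont: "continuous_on {0<..} f"
    by (rule DERIV_continuous_on[where D = D]) (auto intro: has_field_derivative_at_within der)
  have f0: "f x = 0" if "x \<le> 0" for x using K(2,3) that by force
  have fm: "f \<in> borel_measurable borel"
  proof -
    have "(\<lambda>x. indicator {0<..} x *\<^sub>R f x) \<in> borel_measurable borel"
      by (rule borel_measurable_continuous_on_indicator) (simp_all add: f_cont)
    moreover have "(\<lambda>x. indicator {0<..} x *\<^sub>R f x) = f" using f0 by (auto simp: indicator_def fun_eq_iff)
    ultimately show ?thesis by simp
  qed
  have Dm: "D \<in> borel_measurable borel"
    unfolding D_def by (rule borel_measurable_continuous_on_indicator) (simp_all add: D0)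
  have "compact (f ` K)" using K f_cont by (intro compact_continuous_image continuous_on_subset[OF f_cont])
  then obtain C where "\<forall>y\<in>f ` K. norm y \<le> C" using compact_imp_bounded bounded_iff by metis
  then have C: "\<bar>f x\<bar> \<le> max C 0" for x using K(3) by (cases "x \<in> K") auto
  have "continuous_on K (\<lambda>x. x * D0 x)" by (intro continuous_intros continuous_on_subset[OF D0(2) K(2)])
  then have "compact ((\<lambda>x. x * D0 x) ` K)" using K by (intro compact_continuous_image)
  then obtain B where B: "\<forall>y\<in>(\<lambda>x. x * D0 x) ` K. norm y \<le> B" using compact_imp_bounded bounded_iff by metis
  have D_bd: "\<bar>x * D x\<bar> \<le> max B 0" if x: "0 < x" for x
  proof (cases "x \<in> K")
    case True
    then show ?thesis using B x by (force simp: D_def)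
  next
    case False
    \<comment> \<open>Off the support \<open>f\<close> vanishes in a whole neighbourhood, so its
      derivative is 0 there.\<close>
    have "open (- K)" using K(1) by (simp add: compact_imp_closed open_Compl)
    then have "(f has_real_derivative 0) (at x)"
      by (rule has_field_derivative_transform_within_open[of "\<lambda>_. 0", rotated]) (use False K(3) in auto)
    then have "D x = 0" using der[OF x] by (rule DERIV_unique[rotated])
    then show ?thesis by simp
  qed
  have der_exp: "((\<lambda>r. f (y * exp r)) has_real_derivative (y * exp r) * D (y * exp r)) (at r)" if "0 < y" for y r
  proof -
    have "((\<lambda>r. y * exp r) has_real_derivative y * exp r) (at r)" by (auto intro!: derivative_eq_intros)
    from DERIV_chain2[OF der this] show ?thesis using that by (simp add: mult.commute)
  qed
  show ?thesis
  proof (rule that[OF fm Dm C D_bd])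
    show "\<bar>f (y * exp r) - f y\<bar> \<le> max B 0 * r" if "0 < y" "0 \<le> r" for y r
    proof -
      have "norm (f (y * exp r) - f (y * exp 0)) \<le> max B 0 * norm (r - 0)"
        by (rule field_differentiable_bound[of UNIV "\<lambda>r. f (y * exp r)" "\<lambda>r. (y * exp r) * D (y * exp r)"])
           (use der_exp[OF that(1)] D_bd that in auto)
      then show ?thesis using that by simp
    qed
    show "((\<lambda>t. (f (x * exp t) - f x) / t) \<longlongrightarrow> x * D x) (at_right 0)" if "0 < x" for x
    proof -
      have "((\<lambda>h. (f (x * exp (0 + h)) - f (x * exp 0)) / h) \<longlongrightarrow> (x * exp 0) * D (x * exp 0)) (at 0)"
        using der_exp[OF that, of 0] unfolding DERIV_def .
      then have "((\<lambda>h. (f (x * exp h) - f x) / h) \<longlongrightarrow> x * D x) (at 0)" by simp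
      then show ?thesis by (rule tendsto_within_subset[where S = UNIV, simplified])
    qed
    show "D x = deriv f x" if "0 < x" for x using DERIV_imp_deriv[OF der[OF that]] by simp
    show "f x = 0" if "x \<le> 0" for x using f0[OF that] .
  qed
qed

lemma restrict_stationary_measurable:
  fixes g :: "real \<Rightarrow> 'b::topological_space"
  assumes "g \<in> borel_measurable borel" shows "g \<in> borel_measurable (stationary_measure F)"
proof -
  have "g \<in> borel_measurable (stieltjes F)"
    using assms by (simp add: stieltjes_def cong: measurable_cong_sets)
  then show ?thesis unfolding stationary_measure_def by (rule measurable_restrict_space1)
qed

lemma space_stationary_measure: "space (stationary_measure F) = {0<..}"
  by (simp add: stationary_measure_def stieltjes_def space_restrict_space)

section \<open>Invariance and generator for the process on the given space\<close>

context cell_setup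
begin

context
  fixes Fd c
  assumes st: "stationary_rate R c"
    and nn_stat: "\<And>g. g \<in> borel_measurable borel \<Longrightarrow>
      (\<integral>\<^sup>+x. g x \<partial>stationary_measure Fd) = (\<integral>\<^sup>+x\<in>{0<..}. g x * ennreal (c * x * exp (- H x)) \<partial>lborel)"
    and ps: "prob_space (stationary_measure Fd)"
begin

interpretation stationary_rate R c by (rule st)

lemma nn_stationary:
  assumes "g \<in> borel_measurable borel"
  shows "(\<integral>\<^sup>+x. g x \<partial>stationary_measure Fd) = (\<integral>\<^sup>+x. dens x * g x \<partial>lborel)"
  unfolding nn_stat[OF assms] dens_def by (intro nn_integral_cong) (simp add: mult_ac)

lemma Pr_invariant:
  assumes t: "0 \<le> t" and f [measurable]: "f \<in> borel_measurable borel" and fb: "\<And>x. \<bar>f x\<bar> \<le> (C::real)"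
  shows "(\<integral>x. Pr t f x \<partial>stationary_measure Fd) = (\<integral>x. f x \<partial>stationary_measure Fd)"
proof -
  interpret P: prob_space "stationary_measure Fd" by (rule ps)
  have C: "0 \<le> C" using fb[of 0] by simp
  \<comment> \<open>Invariance is available for nonnegative functions; adding the bound
    \<open>C\<close> reduces to them, since the semigroup preserves constants.\<close>
  have fC: "0 \<le> f x + C" "f x + C \<le> 2 * C" for x using fb[of x] by (auto simp: abs_le_iff)
  have PrC: "Pr t (\<lambda>x. f x + C) x = Pr t f x + C" for x
    unfolding Pr_def using integrable_Z[OF f fb] by simp
  have i1: "integrable (stationary_measure Fd) (Pr t f)"
    by (rule P.integrable_const_bound[where B = C])
       (auto simp: Pr_bound[OF f fb] intro!: restrict_stationary_measurable)
  have i2: "integrable (stationary_measure Fd) f"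
    by (rule P.integrable_const_bound[where B = C]) (auto simp: fb intro!: restrict_stationary_measurable)
  have p0: "0 \<le> Pr t f x + C" for x using Pr_bound[OF f fb, of t x] by (simp add: abs_le_iff)
  have "ennreal (\<integral>x. Pr t f x + C \<partial>stationary_measure Fd) = (\<integral>\<^sup>+x. ennreal (Pr t f x + C) \<partial>stationary_measure Fd)"
    using i1 p0 by (intro nn_integral_eq_integral[symmetric]) auto
  also have "\<dots> = (\<integral>\<^sup>+x. dens x * ennreal (Pr t f x + C) \<partial>lborel)"
    by (rule nn_stationary) measurable
  also have "\<dots> = (\<integral>\<^sup>+x. dens x * Pn t (\<lambda>x. ennreal (f x + C)) x \<partial>lborel)"
    using Pn_eq_Pr[of "\<lambda>x. f x + C" "2 * C" t] fC by (simp add: PrC)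
  also have "\<dots> = (\<integral>\<^sup>+x. dens x * ennreal (f x + C) \<partial>lborel)"
    by (rule dens_Pn[OF t]) measurable
  also have "\<dots> = (\<integral>\<^sup>+x. ennreal (f x + C) \<partial>stationary_measure Fd)"
    by (rule nn_stationary[symmetric]) measurable
  also have "\<dots> = ennreal (\<integral>x. f x + C \<partial>stationary_measure Fd)"
    using i2 fC by (intro nn_integral_eq_integral) auto
  finally have "(\<integral>x. Pr t f x + C \<partial>stationary_measure Fd) = (\<integral>x. f x + C \<partial>stationary_measure Fd)"
    using fC p0 by (subst (asm) ennreal_inj) (auto intro!: integral_nonneg_AE)
  then show ?thesis using i1 i2 by (simp add: P.prob_space)
qed

theorem invariant_X: "invariant_prob (transition_op M X) (stationary_measure Fd)"
  unfolding invariant_prob_def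
proof (intro conjI allI impI)
  fix t :: real and f assume t: "0 \<le> t" and f: "bounded_borel_half_line f"
  obtain C where C: "\<And>x. \<bar>half_ext f x\<bar> \<le> C" using half_ext_bound[OF f] by blast
  have "(\<integral>x. transition_op M X t f x \<partial>stationary_measure Fd) = (\<integral>x. half_ext f x \<partial>stationary_measure Fd)"
    unfolding transition_op_eq[OF f] by (rule Pr_invariant[OF t bounded_borel_half_line_ext[OF f] C])
  also have "\<dots> = (\<integral>x. f x \<partial>stationary_measure Fd)"
    by (rule Bochner_Integration.integral_cong) (auto simp: half_ext_def space_stationary_measure)
  finally show "(\<integral>x. transition_op M X t f x \<partial>stationary_measure Fd) = (\<integral>x. f x \<partial>stationary_measure Fd)" .
qed (rule ps)

theorem generator_X:
  assumes f: "C1c_pos f"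
  shows "tendsto_L1 (stationary_measure Fd) (\<lambda>t x. (transition_op M X t f x - f x) / t) (generator R f) (at_right 0)"
proof -
  obtain D C C1 where fD: "f \<in> borel_measurable borel" "D \<in> borel_measurable borel"
    "\<And>x. \<bar>f x\<bar> \<le> C" "\<And>x. 0 < x \<Longrightarrow> \<bar>x * D x\<bar> \<le> C1"
    "\<And>y r. 0 < y \<Longrightarrow> 0 \<le> r \<Longrightarrow> \<bar>f (y * exp r) - f y\<bar> \<le> C1 * r"
    "\<And>x. 0 < x \<Longrightarrow> ((\<lambda>t. (f (x * exp t) - f x) / t) \<longlongrightarrow> x * D x) (at_right 0)"
    and deriv: "\<And>x. 0 < x \<Longrightarrow> D x = deriv f x" and f0: "\<And>x. x \<le> 0 \<Longrightarrow> f x = 0"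
    using C1c_pos_properties[OF f] by blast
  interpret G: generator_setup R c f D C C1
    by unfold_locales (use fD in auto)
  interpret P: prob_space "stationary_measure Fd" by (rule ps)
  note [measurable] = fD(1,2)
  have ext: "half_ext f = f" using f0 by (auto simp: half_ext_def fun_eq_iff)
  have bb: "bounded_borel_half_line f"
    unfolding bounded_borel_half_line_def
  proof
    show "f \<in> borel_measurable (restrict_space borel {0..})" by (rule measurable_restrict_space1) measurable
    show "bounded (f ` {0..})" using fD(3) by (auto simp: bounded_iff)
  qed
  have P: "transition_op M X t f x = Pr t f x" for t x
    using transition_op_eq[OF bb, of t x] by (simp add: ext)
  \<comment> \<open>Substitute \<open>u = x v\<close>: the Jacobian \<open>x\<close> turns the
    kernel \<open>2u / x^2\<close> into \<open>2v\<close>.\<close>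
  have favg: "(LBINT u:{0..x}. 2 * u / x\<^sup>2 * f u) = G.favg x" if x: "0 < x" for x
  proof -
    have "(LBINT u:{0..x}. 2 * u / x\<^sup>2 * f u)
        = \<bar>x\<bar> *\<^sub>R (\<integral>v. indicator {0..x} (0 + x * v) *\<^sub>R (2 * (0 + x * v) / x\<^sup>2 * f (0 + x * v)) \<partial>lborel)"
      unfolding set_lebesgue_integral_def using x by (intro lborel_integral_real_affine) simp
    also have "\<dots> = (\<integral>v. \<bar>x\<bar> *\<^sub>R (indicator {0..x} (0 + x * v) *\<^sub>R (2 * (0 + x * v) / x\<^sup>2 * f (0 + x * v))) \<partial>lborel)"
      by simp
    also have "\<dots> = G.favg x"
      unfolding G.favg_def set_lebesgue_integral_def
    proof (rule Bochner_Integration.integral_cong)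
      fix v
      have "0 + x * v \<in> {0..x} \<longleftrightarrow> v \<in> {0..1}"
        using x by (auto simp: zero_le_mult_iff mult_le_cancel_left1)
      then show "\<bar>x\<bar> *\<^sub>R (indicator {0..x} (0 + x * v) *\<^sub>R (2 * (0 + x * v) / x\<^sup>2 * f (0 + x * v)))
          = indicator {0..1} v *\<^sub>R (2 * v * f (x * v))"
        using x by (cases "v \<in> {0..1}") (auto simp: power2_eq_square)
    qed simp
    finally show ?thesis .
  qed
  \<comment> \<open>The formulas are compared on (0,\<infinity>), the space of \<pi>, where
    \<open>D\<close> is the derivative of \<open>f\<close>.\<close>
  have gen: "generator R f x = G.gen x" if "x \<in> space (stationary_measure Fd)" for x
    using that favg[of x] deriv[of x]
    by (simp add: generator_def G.gen_def jrate_def space_stationary_measure)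
  have sm: "g \<in> borel_measurable (stationary_measure Fd)" if "g \<in> borel_measurable borel" for g :: "real \<Rightarrow> real"
    by (rule restrict_stationary_measurable[OF that])
  have L1: "(\<integral>\<^sup>+x. ennreal (norm (g x)) \<partial>stationary_measure Fd) = L1 g" if [measurable]: "g \<in> borel_measurable borel" for g :: "real \<Rightarrow> real"
    using nn_stationary[of "\<lambda>x. ennreal (norm (g x))"] by simp
  have ig: "integrable (stationary_measure Fd) G.gen"
    by (rule integrableI_bounded) (use G.gen_L1 in \<open>simp_all add: sm L1 del: real_norm_def\<close>)
  have iP: "integrable (stationary_measure Fd) (\<lambda>x. (Pr t f x - f x) / t)" for t
    using Pr_bound[OF fD(1,3)] fD(3)
    by (intro integrable_divide Bochner_Integration.integrable_diff P.integrable_const_bound[where B = C]) (auto intro!: sm)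
  have "((\<lambda>t. enn2real (L1 (\<lambda>x. (Pr t f x - f x) / t - G.gen x))) \<longlongrightarrow> 0) (at_right 0)"
    using G.L1_generator by (intro tendsto_enn2real) simp_all
  moreover have "enn2real (L1 (\<lambda>x. (Pr t f x - f x) / t - G.gen x))
      = (\<integral>x. \<bar>(Pr t f x - f x) / t - generator R f x\<bar> \<partial>stationary_measure Fd)" for t
  proof -
    have "ennreal (\<integral>x. \<bar>(Pr t f x - f x) / t - G.gen x\<bar> \<partial>stationary_measure Fd)
        = (\<integral>\<^sup>+x. ennreal \<bar>(Pr t f x - f x) / t - G.gen x\<bar> \<partial>stationary_measure Fd)"
      using iP[of t] ig by (intro nn_integral_eq_integral[symmetric]) auto
    also have "\<dots> = L1 (\<lambda>x. (Pr t f x - f x) / t - G.gen x)"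
      using L1[of "\<lambda>x. (Pr t f x - f x) / t - G.gen x"] by simp
    finally have e: "ennreal (\<integral>x. \<bar>(Pr t f x - f x) / t - G.gen x\<bar> \<partial>stationary_measure Fd)
        = L1 (\<lambda>x. (Pr t f x - f x) / t - G.gen x)" .
    have "enn2real (L1 (\<lambda>x. (Pr t f x - f x) / t - G.gen x)) = (\<integral>x. \<bar>(Pr t f x - f x) / t - G.gen x\<bar> \<partial>stationary_measure Fd)"
      unfolding e[symmetric] by (rule enn2real_ennreal) (rule integral_nonneg_AE, simp)
    also have "\<dots> = (\<integral>x. \<bar>(Pr t f x - f x) / t - generator R f x\<bar> \<partial>stationary_measure Fd)"
      by (rule Bochner_Integration.integral_cong) (simp_all add: gen)
    finally show ?thesis .
  qed
  ultimately have "((\<lambda>t. \<integral>x. \<bar>(Pr t f x - f x) / t - generator R f x\<bar> \<partial>stationary_measure Fd) \<longlongrightarrow> 0) (at_right 0)"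
    by simp
  moreover have "integrable (stationary_measure Fd) (generator R f)"
    using ig by (subst Bochner_Integration.integrable_cong[OF refl gen])
  ultimately show ?thesis
    unfolding tendsto_L1_def P using iP by simp
qed

end

theorem stationary_X:
  assumes "stationary_distr R Fd"
  shows "invariant_prob (transition_op M X) (stationary_measure Fd)"
    and "C1c_pos f \<Longrightarrow> tendsto_L1 (stationary_measure Fd) (\<lambda>t x. (transition_op M X t f x - f x) / t) (generator R f) (at_right 0)"
proof -
  obtain c where c: "0 < c"
    "\<And>g. g \<in> borel_measurable borel \<Longrightarrow>
      (\<integral>\<^sup>+x. g x \<partial>stationary_measure Fd) = (\<integral>\<^sup>+x\<in>{0<..}. g x * ennreal (c * x * exp (- H x)) \<partial>lborel)"
    "\<And>v. 0 < v \<Longrightarrow> (\<integral>\<^sup>+z\<in>{v..}. ennreal (R z) * ennreal (exp (- H z)) \<partial>lborel) = ennreal (exp (- H v))"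
    and ps: "prob_space (stationary_measure Fd)"
    using stationary_density[OF assms] by blast
  have "(\<integral>\<^sup>+x\<in>{0<..}. ennreal (c * x * exp (- H x)) \<partial>lborel) = 1"
    using c(2)[of "\<lambda>_. 1"] prob_space.emeasure_space_1[OF ps] by simp
  then have st: "stationary_rate R c"
    using c by unfold_locales auto
  show "invariant_prob (transition_op M X) (stationary_measure Fd)"
    by (rule invariant_X[OF st c(2) ps])
  show "C1c_pos f \<Longrightarrow> tendsto_L1 (stationary_measure Fd) (\<lambda>t x. (transition_op M X t f x - f x) / t) (generator R f) (at_right 0)"
    by (rule generator_X[OF st c(2) ps])
qed

end

section \<open>Reduction to the rate extended by 0\<close>

lemma rate_half_ext:
  assumes "admissible_rate R" shows "rate (half_ext R)"
proof
  have "R \<in> borel_measurable (restrict_space borel {0..})" using assms by (simp add: admissible_rate_def)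
  then show m [measurable]: "half_ext R \<in> borel_measurable borel" by (rule half_ext_measurable)
  show nn: "0 \<le> half_ext R x" for x using assms by (simp add: half_ext_def admissible_rate_def)
  \<comment> \<open>Admissibility speaks of positive \<open>k\<close>; enlarging the interval to
    \<open>max k 1\<close> covers every real \<open>k\<close>.\<close>
  show "set_integrable lborel {0..k} (half_ext R)" for k
    unfolding set_integrable_def
  proof (rule integrableI_bounded)
    have "(\<integral>\<^sup>+x. ennreal (norm (indicator {0..k} x *\<^sub>R half_ext R x)) \<partial>lborel) \<le> (\<integral>\<^sup>+x\<in>{0..max k 1}. ennreal (R x) \<partial>lborel)"
      using nn by (intro nn_integral_mono) (auto simp: indicator_def half_ext_def)
    also have "\<dots> < \<infinity>" using assms by (simp add: admissible_rate_def)
    finally show "(\<integral>\<^sup>+x. ennreal (norm (indicator {0..k} x *\<^sub>R half_ext R x)) \<partial>lborel) < \<infinity>" .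
  qed measurable
qed

lemma survival_half_ext: "0 \<le> t \<Longrightarrow> survival (half_ext R) z t = survival R z t"
proof (cases "0 \<le> z")
  case True
  then have "(LBINT u:{z..z * exp t}. half_ext R u) = (LBINT u:{z..z * exp t}. R u)"
    by (intro set_lebesgue_integral_cong) (auto simp: half_ext_def)
  then show ?thesis by (simp add: survival_def)
next
  case False
  assume "0 \<le> t"
  then have "z * exp t \<le> z" using False by (auto simp: mult_le_cancel_left2)
  \<comment> \<open>For a negative \<open>z\<close> the interval has at most the point
    \<open>z\<close>, so both integrals vanish whatever the values of the rate are there.\<close>
  then have "indicator {z..z * exp t} u = (0 :: real)" if "u \<noteq> z" for u
    using that by (auto simp: indicator_def)
  then have "(LBINT u:{z..z * exp t}. S u) = 0" for S :: "real \<Rightarrow> real"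
    unfolding set_lebesgue_integral_def
    by (intro integral_eq_zero_AE eventually_mono[OF AE_lborel_singleton[of z]]) simp
  then show ?thesis by (simp add: survival_def)
qed

lemma survival_inv_half_ext: "survival_inv (half_ext R) z u = survival_inv R z u"
proof -
  have "{ennreal t |t. 0 \<le> t \<and> survival (half_ext R) z t \<le> u} = {ennreal t |t. 0 \<le> t \<and> survival R z t \<le> u}"
    using survival_half_ext by auto
  then show ?thesis by (simp add: survival_inv_def)
qed

lemma cell_process_half_ext: "cell_process (half_ext R) U = cell_process R U"
proof -
  have "jump_time (half_ext R) u x k = jump_time R u x k" for u x k
    by (induction k) (simp_all add: jump_time.simps survival_inv_half_ext)
  then have jt: "jump_time (half_ext R) = jump_time R" by (intro ext)
  show ?thesis unfolding cell_process_def[abs_def] cell_path_def lifetime_def jt ..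
qed

text \<open>The evolution equation is imposed for \<open>x > 0\<close>, so the rate is integrated
  only over positive sizes.\<close>

lemma stationary_distr_half_ext:
  assumes "stationary_distr R F" shows "stationary_distr (half_ext R) F"
proof -
  have "(\<integral>\<^sup>+z\<in>{y..}. ennreal (half_ext R z / z) \<partial>stieltjes F) = (\<integral>\<^sup>+z\<in>{y..}. ennreal (R z / z) \<partial>stieltjes F)" if "0 < y" for y
    using that by (intro nn_integral_cong) (auto simp: half_ext_def indicator_def)
  then have "(\<integral>\<^sup>+z\<in>{exp (s - t) * x..}. ennreal (half_ext R z / z) \<partial>stieltjes F)
      = (\<integral>\<^sup>+z\<in>{exp (s - t) * x..}. ennreal (R z / z) \<partial>stieltjes F)" if "0 < x" for s t x
    using that by simp
  then show ?thesis
    using assms unfolding stationary_distr_def solutions_def mem_Collect_eq by simp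
qed

lemma generator_half_ext: "0 < x \<Longrightarrow> generator (half_ext R) f x = generator R f x"
  by (simp add: generator_def half_ext_def)

theorem proposition3p5:
  fixes R :: "real \<Rightarrow> real" and M :: "'w measure" and U :: "nat \<Rightarrow> 'w \<Rightarrow> real"
    and X :: "real \<Rightarrow> real \<Rightarrow> 'w \<Rightarrow> real"
    and P :: "real \<Rightarrow> (real \<Rightarrow> real) \<Rightarrow> real \<Rightarrow> real"
  assumes "admissible_rate R"
    and "prob_space M"
    and "driving_sequence M U"
    and "X = cell_process R U"
    and "P = transition_op M X"
  shows "strong_Markov_process M X P \<and>
    (\<forall>F. stationary_distr R F \<longrightarrow>
       invariant_prob P (stationary_measure F) \<and>
       (\<forall>f. C1c_pos f \<longrightarrow>
          tendsto_L1 (stationary_measure F) (\<lambda>t x. (P t f x - f x) / t) (generator R f) (at_right 0)))"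
proof -
  interpret r: rate "half_ext R" by (rule rate_half_ext[OF assms(1)])
  interpret c: cell_setup "half_ext R" M U
    using assms(2,3) by (intro cell_setup.intro cell_setup_axioms.intro r.rate_axioms)
  have X: "X = c.X"
    unfolding assms(4) cell_process_half_ext[symmetric, of R] by (intro ext c.cell_process_eq)
  \<comment> \<open>Both generators agree on (0,\<infinity>), which is the whole space of the
    stationary measure.\<close>
  have tendsto_cong: "tendsto_L1 (stationary_measure F) g (generator (half_ext R) f) (at_right 0)
      \<longleftrightarrow> tendsto_L1 (stationary_measure F) g (generator R f) (at_right 0)" for F f and g :: "real \<Rightarrow> real \<Rightarrow> real"
  proof -
    have gen: "generator (half_ext R) f x = generator R f x" if "x \<in> space (stationary_measure F)" for x
      using that by (simp add: space_stationary_measure generator_half_ext)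
    have "integrable (stationary_measure F) (generator (half_ext R) f) \<longleftrightarrow> integrable (stationary_measure F) (generator R f)"
      by (rule Bochner_Integration.integrable_cong) (simp_all add: gen)
    moreover have "(\<integral>x. \<bar>g t x - generator (half_ext R) f x\<bar> \<partial>stationary_measure F)
        = (\<integral>x. \<bar>g t x - generator R f x\<bar> \<partial>stationary_measure F)" for t
      by (rule Bochner_Integration.integral_cong) (simp_all add: gen)
    ultimately show ?thesis by (simp add: tendsto_L1_def)
  qed
  show ?thesis
  proof (intro conjI allI impI)
    show "strong_Markov_process M X P"
      unfolding assms(5) X by (rule c.strong_Markov_X)
  next
    fix F assume "stationary_distr R F"
    then have st: "stationary_distr (half_ext R) F" by (rule stationary_distr_half_ext)
    show "invariant_prob P (stationary_measure F)"
      unfolding assms(5) X by (rule c.stationary_X(1)[OF st])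
    fix f assume "C1c_pos f"
    then show "tendsto_L1 (stationary_measure F) (\<lambda>t x. (P t f x - f x) / t) (generator R f) (at_right 0)"
      unfolding assms(5) X tendsto_cong[symmetric] by (rule c.stationary_X(2)[OF st])
  qed
qed

end
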